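(* Let $\mathcal B$ be a $\mathcal T$-shadowed bicategory equipped with $G$-twisting data. For every object $R$ and every $g,h\in G$, there is a natural isomorphism $$\mathbf C_{h,g}\colon{}^g\langle\!\langle-\rangle\!\rangle_R\xRightarrow{\ \cong\ }{}^{hgh^{-1}}\langle\!\langle-\rangle\!\rangle_R$$ of functors $\mathcal B^{G\text{-tw}}(R,R)\to\mathcal T$. These isomorphisms are compatible with the twisted cyclicity maps, i.e. for 1-cells $M\colon R\to S$, $N\colon S\to R$ in $\mathcal B^{G\text{-tw}}$, $$\mathbf C_{h,g}(N\odot M)\circ{}^g\theta_{M,N}={}^{hgh^{-1}}\theta_{M,N}\circ\mathbf C_{h,g}(M\odot N),$$ and they satisfy $$\mathbf C_{e,g}=\mathrm{id}\qquad\text{and}\qquad\mathbf C_{k,hgh^{-1}}\circ\mathbf C_{h,g}=\mathbf C_{kh,g}$$ for all $g,h,k\in G$.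
   Context: **Bicategories.** For 1-cells $M\colon A\to B$, $N\colon B\to C$ the horizontal composite is written $M\odot N\colon A\to C$ (first $M$, then $N$); $U_A$ is the unit 1-cell; associators and unitors $\mathfrak a,\mathfrak l,\mathfrak r$ are suppressed where harmless. $\mathrm{Pic}_{\mathcal B}(A)$ is the monoidal groupoid (under $\odot$) of invertible 1-cells $A\to A$ and invertible 2-cells. **$G$-twisting data** ($G$ a group): for each 0-cell $A$ a strong monoidal functor $\Theta_A\colon G\to\mathrm{Pic}_{\mathcal B}(A)$ with structure 2-cells $\mu^A_{g,h}\colon\Theta_A(g)\odot\Theta_A(h)\Rightarrow\Theta_A(gh)$, $\eta^A\colon U_A\Rightarrow\Theta_A(e)$. For $M\colon A\to B$: ${}^gM=\Theta_A(g^{-1})\odot M$, $M^g=M\odot\Theta_B(g)$; ${}^gf=\mathrm{id}\odot f$ for a 2-cell $f$. **Bicategory of $G$-twists $\mathcal B^{G\text{-tw}}$.** Same 0-cells. A 1-cell $A\to B$ is $(M,\tau)$ with $M\colon A\to B$ in $\mathcal B$ and invertible 2-cells $\tau_g\colon\Theta_A(g)\odot M\Rightarrow M\odot\Theta_B(g)$, $g\in G$, such that $\tau_e$ is the canonical isomorphism given by $\eta^A,\eta^B$ and unitors, and $\tau_{gh}=(\mathrm{id}_M\odot\mu^B_{g,h})(\tau_g\odot\mathrm{id})(\mathrm{id}\odot\tau_h)((\mu^A_{g,h})^{-1}\odot\mathrm{id}_M)$. A 2-cell $(M,\tau)\Rightarrow(N,\sigma)$ is a 2-cell $f\colon M\Rightarrow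 N$ with $\sigma_g(\mathrm{id}\odot f)=(f\odot\mathrm{id})\tau_g$ for all $g$. Composite: $(M\odot N,\tau\star\sigma)$, $(\tau\star\sigma)_g=(\mathrm{id}_M\odot\sigma_g)(\tau_g\odot\mathrm{id}_N)$. Unit: $U_A$ with $\mathfrak l^{-1}\mathfrak r$. Transport map: $g_M=(\tau_{g^{-1}})^{-1}\colon M^{g^{-1}}\Rightarrow{}^gM$. **Shadows.** A $\mathcal T$-shadow on $\mathcal B$ is a family of functors $\langle\!\langle-\rangle\!\rangle_R\colon\mathcal B(R,R)\to\mathcal T$ with natural isomorphisms $\theta_{M,N}\colon\langle\!\langle M\odot N\rangle\!\rangle_R\cong\langle\!\langle N\odot M\rangle\!\rangle_S$ ($M\colon R\to S$, $N\colon S\to R$) such that, up to associators, $\theta_{M\odot N,P}=\theta_{N,P\odot M}\circ\theta_{M,N\odot P}$, and $\langle\!\langle\mathfrak l\rangle\!\rangle\circ\theta_{M,U_R}=\langle\!\langle\mathfrak r\rangle\!\rangle$, $\langle\!\langle\mathfrak r\rangle\!\rangle\circ\theta_{U_R,M}=\langle\!\langle\mathfrak l\rangle\!\rangle$. **Induced $g$-twisted shadow.** ${}^g\langle\!\langle(M,\tau)\rangle\!\rangle_R=\langle\!\langle{}^gM\rangle\!\rangle_R$, ${}^g\langle\!\langle f\rangle\!\rangle_R=\langle\!\langle{}^gf\rangle\!\rangle_R$. The twisted cyclicity ${}^g\theta_{M,N}\colon{}^g\langle\!\langle M\odot N\rangle\!\rangle_R\to{}^g\langle\!\langle N\odot M\rangle\!\rangle_S$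 is the composite $\langle\!\langle\Theta_R(g^{-1})\odot M\odot N\rangle\!\rangle_R\xrightarrow{\theta}\langle\!\langle N\odot\Theta_R(g^{-1})\odot M\rangle\!\rangle_S\xrightarrow{\langle\!\langle g_N\odot\mathrm{id}_M\rangle\!\rangle}\langle\!\langle\Theta_S(g^{-1})\odot N\odot M\rangle\!\rangle_S$. *)

theory Defs
  imports "HOL-Algebra.Group"
begin

section \<open>Categories, functors and natural isomorphisms\<close>

record ('x, 'a) cat =
  Obj :: "'x set"
  Arr :: "'a set"
  Dom :: "'a \<Rightarrow> 'x"
  Cod :: "'a \<Rightarrow> 'x"
  Idt :: "'x \<Rightarrow> 'a"
  Comp :: "'a \<Rightarrow> 'a \<Rightarrow> 'a"  (infixr "\<cdot>\<index>" 55)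

definition cat_hom :: "('x, 'a, 'z) cat_scheme \<Rightarrow> 'x \<Rightarrow> 'x \<Rightarrow> 'a set" where
  "cat_hom C x y = {f \<in> Arr C. Dom C f = x \<and> Cod C f = y}"

locale category =
  fixes C :: "('x, 'a, 'z) cat_scheme" (structure)
  assumes dom_in_Obj: "f \<in> Arr C \<Longrightarrow> Dom C f \<in> Obj C"
    and cod_in_Obj: "f \<in> Arr C \<Longrightarrow> Cod C f \<in> Obj C"
    and id_in_hom: "x \<in> Obj C \<Longrightarrow> Idt C x \<in> cat_hom C x x"
    and comp_in_hom: "\<lbrakk>f \<in> cat_hom C x y; g \<in> cat_hom C y z\<rbrakk> \<Longrightarrow> g \<cdot> f \<in> cat_hom C x z"
    and id_comp: "f \<in> cat_hom C x y \<Longrightarrow> Idt C y \<cdot> f = f"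
    and comp_id: "f \<in> cat_hom C x y \<Longrightarrow> f \<cdot> Idt C x = f"
    and comp_assoc: "\<lbrakk>f \<in> cat_hom C w x; g \<in> cat_hom C x y; h \<in> cat_hom C y z\<rbrakk>
      \<Longrightarrow> (h \<cdot> g) \<cdot> f = h \<cdot> (g \<cdot> f)"

definition inverse_arrows :: "('x, 'a, 'z) cat_scheme \<Rightarrow> 'a \<Rightarrow> 'a \<Rightarrow> bool" where
  "inverse_arrows C f g \<longleftrightarrow>
     f \<in> Arr C \<and> g \<in> cat_hom C (Cod C f) (Dom C f) \<and>
     g \<cdot>\<^bsub>C\<^esub> f = Idt C (Dom C f) \<and> f \<cdot>\<^bsub>C\<^esub> g = Idt C (Cod C f)"

definition is_iso :: "('x, 'a, 'z) cat_scheme \<Rightarrow> 'a \<Rightarrow> bool" where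
  "is_iso C f \<longleftrightarrow> (\<exists>g. inverse_arrows C f g)"

definition cat_inv :: "('x, 'a, 'z) cat_scheme \<Rightarrow> 'a \<Rightarrow> 'a" where
  "cat_inv C f = (THE g. inverse_arrows C f g)"

definition isomorphic :: "('x, 'a, 'z) cat_scheme \<Rightarrow> 'x \<Rightarrow> 'x \<Rightarrow> bool" where
  "isomorphic C x y \<longleftrightarrow> (\<exists>f \<in> cat_hom C x y. is_iso C f)"

definition product_cat ::
  "('x, 'a, 'z) cat_scheme \<Rightarrow> ('y, 'b, 'w) cat_scheme \<Rightarrow> ('x \<times> 'y, 'a \<times> 'b) cat" where
  "product_cat C D = \<lparr>
     Obj = Obj C \<times> Obj D,
     Arr = Arr C \<times> Arr D,
     Dom = (\<lambda>(f, g). (Dom C f, Dom D g)),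
     Cod = (\<lambda>(f, g). (Cod C f, Cod D g)),
     Idt = (\<lambda>(x, y). (Idt C x, Idt D y)),
     Comp = (\<lambda>(f', g') (f, g). (f' \<cdot>\<^bsub>C\<^esub> f, g' \<cdot>\<^bsub>D\<^esub> g))\<rparr>"

record ('x, 'a, 'y, 'b) cat_functor =
  ObMap :: "'x \<Rightarrow> 'y"
  ArMap :: "'a \<Rightarrow> 'b"

locale is_functor =
  source: category C + target: category D
  for C :: "('x, 'a, 'z) cat_scheme" and D :: "('y, 'b, 'w) cat_scheme" +
  fixes F :: "('x, 'a, 'y, 'b) cat_functor"
  assumes map_Obj: "x \<in> Obj C \<Longrightarrow> ObMap F x \<in> Obj D"
    and map_hom: "f \<in> cat_hom C x y \<Longrightarrow> ArMap F f \<in> cat_hom D (ObMap F x) (ObMap F y)"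
    and map_id: "x \<in> Obj C \<Longrightarrow> ArMap F (Idt C x) = Idt D (ObMap F x)"
    and map_comp: "\<lbrakk>f \<in> cat_hom C x y; g \<in> cat_hom C y z\<rbrakk>
      \<Longrightarrow> ArMap F (g \<cdot>\<^bsub>C\<^esub> f) = ArMap F g \<cdot>\<^bsub>D\<^esub> ArMap F f"

locale natural_isomorphism =
  F: is_functor C D F + G: is_functor C D G
  for C :: "('x, 'a, 'z) cat_scheme" and D :: "('y, 'b, 'w) cat_scheme"
    and F :: "('x, 'a, 'y, 'b) cat_functor" and G :: "('x, 'a, 'y, 'b) cat_functor" +
  fixes \<phi> :: "'x \<Rightarrow> 'b"
  assumes component_in_hom: "x \<in> Obj C \<Longrightarrow> \<phi> x \<in> cat_hom D (ObMap F x) (ObMap G x)"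
    and component_iso: "x \<in> Obj C \<Longrightarrow> is_iso D (\<phi> x)"
    and naturality: "f \<in> cat_hom C x y
      \<Longrightarrow> \<phi> y \<cdot>\<^bsub>D\<^esub> ArMap F f = ArMap G f \<cdot>\<^bsub>D\<^esub> \<phi> x"

section \<open>Bicategories\<close>

text \<open>
  The underlying \<open>cat\<close> of a bicategory is the disjoint union of its hom-categories: objects are
  the 1-cells, arrows the 2-cells, and composition is vertical composition. Horizontal composites
  are written in diagrammatic order, on 1-cells with \<open>\<odot>\<close> and on 2-cells with \<open>\<star>\<close>.
\<close>

record ('o, 'm, 'c) bicat = "('m, 'c) cat" +
  Cell0 :: "'o set"
  Src :: "'m \<Rightarrow> 'o"
  Trg :: "'m \<Rightarrow> 'o"
  Unit1 :: "'o \<Rightarrow> 'm"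
  HComp1 :: "'m \<Rightarrow> 'm \<Rightarrow> 'm"  (infixl "\<odot>\<index>" 70)
  HComp2 :: "'c \<Rightarrow> 'c \<Rightarrow> 'c"  (infixl "\<star>\<index>" 70)
  Assoc :: "'m \<Rightarrow> 'm \<Rightarrow> 'm \<Rightarrow> 'c"
  LUnit :: "'m \<Rightarrow> 'c"
  RUnit :: "'m \<Rightarrow> 'c"

definition cells1 :: "('o, 'm, 'c, 'z) bicat_scheme \<Rightarrow> 'o \<Rightarrow> 'o \<Rightarrow> 'm set" where
  "cells1 B R S = {M \<in> Obj B. Src B M = R \<and> Trg B M = S}"

definition hom_cat :: "('o, 'm, 'c, 'z) bicat_scheme \<Rightarrow> 'o \<Rightarrow> 'o \<Rightarrow> ('m, 'c) cat" where
  "hom_cat B R S = \<lparr>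
     Obj = cells1 B R S,
     Arr = {f \<in> Arr B. Dom B f \<in> cells1 B R S \<and> Cod B f \<in> cells1 B R S},
     Dom = Dom B, Cod = Cod B, Idt = Idt B, Comp = Comp B\<rparr>"

locale bicategory = category B
  for B :: "('o, 'm, 'c, 'z) bicat_scheme" (structure) +
  assumes src_in_Cell0: "M \<in> Obj B \<Longrightarrow> Src B M \<in> Cell0 B"
    and trg_in_Cell0: "M \<in> Obj B \<Longrightarrow> Trg B M \<in> Cell0 B"
    and parallel_src: "f \<in> Arr B \<Longrightarrow> Src B (Cod B f) = Src B (Dom B f)"
    and parallel_trg: "f \<in> Arr B \<Longrightarrow> Trg B (Cod B f) = Trg B (Dom B f)"
    and unit_cells1: "R \<in> Cell0 B \<Longrightarrow> Unit1 B R \<in> cells1 B R R"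
    and hcomp_functor: "\<lbrakk>R \<in> Cell0 B; S \<in> Cell0 B; P \<in> Cell0 B\<rbrakk> \<Longrightarrow>
      is_functor (product_cat (hom_cat B R S) (hom_cat B S P)) (hom_cat B R P)
        \<lparr>ObMap = \<lambda>(M, N). M \<odot> N, ArMap = \<lambda>(f, g). f \<star> g\<rparr>"
    and assoc_natural: "\<lbrakk>R \<in> Cell0 B; S \<in> Cell0 B; P \<in> Cell0 B; Q \<in> Cell0 B\<rbrakk> \<Longrightarrow>
      natural_isomorphism
        (product_cat (product_cat (hom_cat B R S) (hom_cat B S P)) (hom_cat B P Q)) (hom_cat B R Q)
        \<lparr>ObMap = \<lambda>((M, N), K). (M \<odot> N) \<odot> K, ArMap = \<lambda>((f, g), k). (f \<star> g) \<star> k\<rparr>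
        \<lparr>ObMap = \<lambda>((M, N), K). M \<odot> (N \<odot> K), ArMap = \<lambda>((f, g), k). f \<star> (g \<star> k)\<rparr>
        (\<lambda>((M, N), K). Assoc B M N K)"
    and lunit_natural: "\<lbrakk>R \<in> Cell0 B; S \<in> Cell0 B\<rbrakk> \<Longrightarrow>
      natural_isomorphism (hom_cat B R S) (hom_cat B R S)
        \<lparr>ObMap = \<lambda>M. Unit1 B R \<odot> M, ArMap = \<lambda>f. Idt B (Unit1 B R) \<star> f\<rparr>
        \<lparr>ObMap = \<lambda>M. M, ArMap = \<lambda>f. f\<rparr>
        (LUnit B)"
    and runit_natural: "\<lbrakk>R \<in> Cell0 B; S \<in> Cell0 B\<rbrakk> \<Longrightarrow>
      natural_isomorphism (hom_cat B R S) (hom_cat B R S)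
        \<lparr>ObMap = \<lambda>M. M \<odot> Unit1 B S, ArMap = \<lambda>f. f \<star> Idt B (Unit1 B S)\<rparr>
        \<lparr>ObMap = \<lambda>M. M, ArMap = \<lambda>f. f\<rparr>
        (RUnit B)"
    and triangle: "\<lbrakk>M \<in> cells1 B R S; N \<in> cells1 B S P\<rbrakk> \<Longrightarrow>
      (Idt B M \<star> LUnit B N) \<cdot> Assoc B M (Unit1 B S) N = RUnit B M \<star> Idt B N"
    and pentagon: "\<lbrakk>K \<in> cells1 B R S; L \<in> cells1 B S P; M \<in> cells1 B P Q; N \<in> cells1 B Q W\<rbrakk> \<Longrightarrow>
      Assoc B K L (M \<odot> N) \<cdot> Assoc B (K \<odot> L) M N =
      (Idt B K \<star> Assoc B L M N) \<cdot> Assoc B K (L \<odot> M) N \<cdot> (Assoc B K L M \<star> Idt B N)"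

section \<open>Shadows\<close>

locale shadow = bicategory B + target: category T
  for B :: "('o, 'm, 'c, 'z) bicat_scheme" (structure) and T :: "('t, 'u, 'w) cat_scheme" +
  fixes sh :: "'o \<Rightarrow> ('m, 'c, 't, 'u) cat_functor"
    and \<theta> :: "'m \<Rightarrow> 'm \<Rightarrow> 'u"
  assumes shadow_functor: "R \<in> Cell0 B \<Longrightarrow> is_functor (hom_cat B R R) T (sh R)"
    and cyclicity_natural: "\<lbrakk>R \<in> Cell0 B; S \<in> Cell0 B\<rbrakk> \<Longrightarrow>
      natural_isomorphism (product_cat (hom_cat B R S) (hom_cat B S R)) T
        \<lparr>ObMap = \<lambda>(M, N). ObMap (sh R) (M \<odot> N), ArMap = \<lambda>(f, g). ArMap (sh R) (f \<star> g)\<rparr>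
        \<lparr>ObMap = \<lambda>(M, N). ObMap (sh S) (N \<odot> M), ArMap = \<lambda>(f, g). ArMap (sh S) (g \<star> f)\<rparr>
        (\<lambda>(M, N). \<theta> M N)"
    and cyclicity_hexagon: "\<lbrakk>M \<in> cells1 B R S; N \<in> cells1 B S P; K \<in> cells1 B P R\<rbrakk> \<Longrightarrow>
      \<theta> (M \<odot> N) K =
        ArMap (sh P) (Assoc B K M N) \<cdot>\<^bsub>T\<^esub> \<theta> N (K \<odot> M) \<cdot>\<^bsub>T\<^esub>
        ArMap (sh S) (Assoc B N K M) \<cdot>\<^bsub>T\<^esub> \<theta> M (N \<odot> K) \<cdot>\<^bsub>T\<^esub> ArMap (sh R) (Assoc B M N K)"
    and cyclicity_unit_right: "M \<in> cells1 B R R \<Longrightarrow>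
      ArMap (sh R) (LUnit B M) \<cdot>\<^bsub>T\<^esub> \<theta> M (Unit1 B R) = ArMap (sh R) (RUnit B M)"
    and cyclicity_unit_left: "M \<in> cells1 B R R \<Longrightarrow>
      ArMap (sh R) (RUnit B M) \<cdot>\<^bsub>T\<^esub> \<theta> (Unit1 B R) M = ArMap (sh R) (LUnit B M)"

section \<open>Twisting data\<close>

definition invertible_1cell :: "('o, 'm, 'c, 'z) bicat_scheme \<Rightarrow> 'm \<Rightarrow> bool" where
  "invertible_1cell B M \<longleftrightarrow> M \<in> Obj B \<and>
     (\<exists>N \<in> cells1 B (Trg B M) (Src B M).
        isomorphic B (M \<odot>\<^bsub>B\<^esub> N) (Unit1 B (Src B M)) \<and>
        isomorphic B (N \<odot>\<^bsub>B\<^esub> M) (Unit1 B (Trg B M)))"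

definition Pic :: "('o, 'm, 'c, 'z) bicat_scheme \<Rightarrow> 'o \<Rightarrow> ('m, 'c) cat" where
  "Pic B A = \<lparr>
     Obj = {M \<in> cells1 B A A. invertible_1cell B M},
     Arr = {f \<in> Arr (hom_cat B A A). is_iso B f \<and>
              invertible_1cell B (Dom B f) \<and> invertible_1cell B (Cod B f)},
     Dom = Dom B, Cod = Cod B, Idt = Idt B, Comp = Comp B\<rparr>"

text \<open>
  A strong monoidal functor from \<open>G\<close> to \<open>Pic B A\<close>, where \<open>G\<close> is regarded as a discrete monoidal
  category (so there is no naturality condition) and the monoidal structure of \<open>Pic B A\<close> is the
  horizontal composition of \<open>B\<close>.
\<close>

locale twisting_data = bicategory B + group G
  for B :: "('o, 'm, 'c, 'z) bicat_scheme" and G :: "('g, 'y) monoid_scheme" +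
  fixes \<Theta> :: "'o \<Rightarrow> 'g \<Rightarrow> 'm"
    and \<mu> :: "'o \<Rightarrow> 'g \<Rightarrow> 'g \<Rightarrow> 'c"
    and \<eta> :: "'o \<Rightarrow> 'c"
  assumes Theta_Pic: "\<lbrakk>A \<in> Cell0 B; g \<in> carrier G\<rbrakk> \<Longrightarrow> \<Theta> A g \<in> Obj (Pic B A)"
    and mu_in_hom: "\<lbrakk>A \<in> Cell0 B; g \<in> carrier G; h \<in> carrier G\<rbrakk> \<Longrightarrow>
      \<mu> A g h \<in> cat_hom (Pic B A) (\<Theta> A g \<odot>\<^bsub>B\<^esub> \<Theta> A h) (\<Theta> A (g \<otimes>\<^bsub>G\<^esub> h))"
    and eta_in_hom: "A \<in> Cell0 B \<Longrightarrow> \<eta> A \<in> cat_hom (Pic B A) (Unit1 B A) (\<Theta> A \<one>\<^bsub>G\<^esub>)"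
    and mu_assoc: "\<lbrakk>A \<in> Cell0 B; g \<in> carrier G; h \<in> carrier G; k \<in> carrier G\<rbrakk> \<Longrightarrow>
      \<mu> A g (h \<otimes>\<^bsub>G\<^esub> k) \<cdot>\<^bsub>B\<^esub> (Idt B (\<Theta> A g) \<star>\<^bsub>B\<^esub> \<mu> A h k) \<cdot>\<^bsub>B\<^esub> Assoc B (\<Theta> A g) (\<Theta> A h) (\<Theta> A k) =
      \<mu> A (g \<otimes>\<^bsub>G\<^esub> h) k \<cdot>\<^bsub>B\<^esub> (\<mu> A g h \<star>\<^bsub>B\<^esub> Idt B (\<Theta> A k))"
    and mu_left_unit: "\<lbrakk>A \<in> Cell0 B; g \<in> carrier G\<rbrakk> \<Longrightarrow>
      \<mu> A \<one>\<^bsub>G\<^esub> g \<cdot>\<^bsub>B\<^esub> (\<eta> A \<star>\<^bsub>B\<^esub> Idt B (\<Theta> A g)) = LUnit B (\<Theta> A g)"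
    and mu_right_unit: "\<lbrakk>A \<in> Cell0 B; g \<in> carrier G\<rbrakk> \<Longrightarrow>
      \<mu> A g \<one>\<^bsub>G\<^esub> \<cdot>\<^bsub>B\<^esub> (Idt B (\<Theta> A g) \<star>\<^bsub>B\<^esub> \<eta> A) = RUnit B (\<Theta> A g)"

section \<open>The bicategory of twists\<close>

text \<open>
  A 1-cell is a pair \<open>(M, \<tau>)\<close>. The family \<open>\<tau>\<close> is indexed by \<open>carrier G\<close>, hence extensional.
\<close>

definition is_twist ::
  "('o, 'm, 'c, 'z) bicat_scheme \<Rightarrow> ('g, 'y) monoid_scheme \<Rightarrow> ('o \<Rightarrow> 'g \<Rightarrow> 'm) \<Rightarrow>
   ('o \<Rightarrow> 'g \<Rightarrow> 'g \<Rightarrow> 'c) \<Rightarrow> ('o \<Rightarrow> 'c) \<Rightarrow> 'm \<times> ('g \<Rightarrow> 'c) \<Rightarrow> bool" where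
  "is_twist B G \<Theta> \<mu> \<eta> = (\<lambda>(M, \<tau>). let R = Src B M; S = Trg B M in
     M \<in> Obj B \<and> \<tau> \<in> extensional (carrier G) \<and>
     (\<forall>g \<in> carrier G. \<tau> g \<in> cat_hom B (\<Theta> R g \<odot>\<^bsub>B\<^esub> M) (M \<odot>\<^bsub>B\<^esub> \<Theta> S g) \<and> is_iso B (\<tau> g)) \<and>
     \<tau> \<one>\<^bsub>G\<^esub> = (Idt B M \<star>\<^bsub>B\<^esub> \<eta> S) \<cdot>\<^bsub>B\<^esub> cat_inv B (RUnit B M) \<cdot>\<^bsub>B\<^esub> LUnit B M \<cdot>\<^bsub>B\<^esub>
             (cat_inv B (\<eta> R) \<star>\<^bsub>B\<^esub> Idt B M) \<and>
     (\<forall>g \<in> carrier G. \<forall>h \<in> carrier G.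
        \<tau> (g \<otimes>\<^bsub>G\<^esub> h) =
          (Idt B M \<star>\<^bsub>B\<^esub> \<mu> S g h) \<cdot>\<^bsub>B\<^esub> Assoc B M (\<Theta> S g) (\<Theta> S h) \<cdot>\<^bsub>B\<^esub>
          (\<tau> g \<star>\<^bsub>B\<^esub> Idt B (\<Theta> S h)) \<cdot>\<^bsub>B\<^esub> cat_inv B (Assoc B (\<Theta> R g) M (\<Theta> S h)) \<cdot>\<^bsub>B\<^esub>
          (Idt B (\<Theta> R g) \<star>\<^bsub>B\<^esub> \<tau> h) \<cdot>\<^bsub>B\<^esub> Assoc B (\<Theta> R g) (\<Theta> R h) M \<cdot>\<^bsub>B\<^esub>
          (cat_inv B (\<mu> R g h) \<star>\<^bsub>B\<^esub> Idt B M)))"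

definition twist_hcomp ::
  "('o, 'm, 'c, 'z) bicat_scheme \<Rightarrow> ('g, 'y) monoid_scheme \<Rightarrow> ('o \<Rightarrow> 'g \<Rightarrow> 'm) \<Rightarrow>
   'm \<times> ('g \<Rightarrow> 'c) \<Rightarrow> 'm \<times> ('g \<Rightarrow> 'c) \<Rightarrow> 'm \<times> ('g \<Rightarrow> 'c)" where
  "twist_hcomp B G \<Theta> = (\<lambda>(M, \<tau>) (N, \<sigma>). (M \<odot>\<^bsub>B\<^esub> N,
     \<lambda>g \<in> carrier G.
       cat_inv B (Assoc B M N (\<Theta> (Trg B N) g)) \<cdot>\<^bsub>B\<^esub> (Idt B M \<star>\<^bsub>B\<^esub> \<sigma> g) \<cdot>\<^bsub>B\<^esub>
       Assoc B M (\<Theta> (Trg B M) g) N \<cdot>\<^bsub>B\<^esub> (\<tau> g \<star>\<^bsub>B\<^esub> Idt B N) \<cdot>\<^bsub>B\<^esub>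
       cat_inv B (Assoc B (\<Theta> (Src B M) g) M N)))"

text \<open>
  A 2-cell is a triple \<open>(x, f, y)\<close> recording its source \<open>x = (M, \<tau>)\<close> and target \<open>y = (N, \<sigma>)\<close>
  besides the underlying 2-cell \<open>f\<close> of \<open>B\<close>, since \<open>f\<close> alone does not determine \<open>\<tau>\<close> and \<open>\<sigma>\<close>.
\<close>

definition is_twist_2cell ::
  "('o, 'm, 'c, 'z) bicat_scheme \<Rightarrow> ('g, 'y) monoid_scheme \<Rightarrow> ('o \<Rightarrow> 'g \<Rightarrow> 'm) \<Rightarrow>
   ('o \<Rightarrow> 'g \<Rightarrow> 'g \<Rightarrow> 'c) \<Rightarrow> ('o \<Rightarrow> 'c) \<Rightarrow>
   ('m \<times> ('g \<Rightarrow> 'c)) \<times> 'c \<times> ('m \<times> ('g \<Rightarrow> 'c)) \<Rightarrow> bool" where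
  "is_twist_2cell B G \<Theta> \<mu> \<eta> = (\<lambda>((M, \<tau>), f, (N, \<sigma>)).
     is_twist B G \<Theta> \<mu> \<eta> (M, \<tau>) \<and> is_twist B G \<Theta> \<mu> \<eta> (N, \<sigma>) \<and> f \<in> cat_hom B M N \<and>
     (\<forall>g \<in> carrier G.
        \<sigma> g \<cdot>\<^bsub>B\<^esub> (Idt B (\<Theta> (Src B M) g) \<star>\<^bsub>B\<^esub> f) = (f \<star>\<^bsub>B\<^esub> Idt B (\<Theta> (Trg B M) g)) \<cdot>\<^bsub>B\<^esub> \<tau> g))"

definition twist_bicat ::
  "('o, 'm, 'c, 'z) bicat_scheme \<Rightarrow> ('g, 'y) monoid_scheme \<Rightarrow> ('o \<Rightarrow> 'g \<Rightarrow> 'm) \<Rightarrow>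
   ('o \<Rightarrow> 'g \<Rightarrow> 'g \<Rightarrow> 'c) \<Rightarrow> ('o \<Rightarrow> 'c) \<Rightarrow>
   ('o, 'm \<times> ('g \<Rightarrow> 'c), ('m \<times> ('g \<Rightarrow> 'c)) \<times> 'c \<times> ('m \<times> ('g \<Rightarrow> 'c))) bicat" where
  "twist_bicat B G \<Theta> \<mu> \<eta> = (let hc = twist_hcomp B G \<Theta>;
      U = (\<lambda>A. (Unit1 B A, \<lambda>g \<in> carrier G. cat_inv B (LUnit B (\<Theta> A g)) \<cdot>\<^bsub>B\<^esub> RUnit B (\<Theta> A g)))
    in \<lparr>
     Obj = {x. is_twist B G \<Theta> \<mu> \<eta> x},
     Arr = {p. is_twist_2cell B G \<Theta> \<mu> \<eta> p},
     Dom = (\<lambda>(x, f, y). x),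
     Cod = (\<lambda>(x, f, y). y),
     Idt = (\<lambda>x. (x, Idt B (fst x), x)),
     Comp = (\<lambda>(y, g, z) (x, f, y'). (x, g \<cdot>\<^bsub>B\<^esub> f, z)),
     Cell0 = Cell0 B,
     Src = (\<lambda>x. Src B (fst x)),
     Trg = (\<lambda>x. Trg B (fst x)),
     Unit1 = U,
     HComp1 = hc,
     HComp2 = (\<lambda>(x, f, y) (x', f', y'). (hc x x', f \<star>\<^bsub>B\<^esub> f', hc y y')),
     Assoc = (\<lambda>x y z. (hc (hc x y) z, Assoc B (fst x) (fst y) (fst z), hc x (hc y z))),
     LUnit = (\<lambda>x. (hc (U (Src B (fst x))) x, LUnit B (fst x), x)),
     RUnit = (\<lambda>x. (hc x (U (Trg B (fst x))), RUnit B (fst x), x))\<rparr>)"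

section \<open>Twisted shadows\<close>

definition left_twist ::
  "('o, 'm, 'c, 'z) bicat_scheme \<Rightarrow> ('g, 'y) monoid_scheme \<Rightarrow> ('o \<Rightarrow> 'g \<Rightarrow> 'm) \<Rightarrow> 'g \<Rightarrow> 'm \<Rightarrow> 'm" where
  "left_twist B G \<Theta> g M = \<Theta> (Src B M) (inv\<^bsub>G\<^esub> g) \<odot>\<^bsub>B\<^esub> M"

definition left_twist_2cell ::
  "('o, 'm, 'c, 'z) bicat_scheme \<Rightarrow> ('g, 'y) monoid_scheme \<Rightarrow> ('o \<Rightarrow> 'g \<Rightarrow> 'm) \<Rightarrow> 'g \<Rightarrow> 'c \<Rightarrow> 'c" where
  "left_twist_2cell B G \<Theta> g f = Idt B (\<Theta> (Src B (Dom B f)) (inv\<^bsub>G\<^esub> g)) \<star>\<^bsub>B\<^esub> f"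

definition twisted_shadow ::
  "('o, 'm, 'c, 'z) bicat_scheme \<Rightarrow> ('g, 'y) monoid_scheme \<Rightarrow> ('o \<Rightarrow> 'g \<Rightarrow> 'm) \<Rightarrow>
   ('o \<Rightarrow> ('m, 'c, 't, 'u) cat_functor) \<Rightarrow> 'g \<Rightarrow> 'o \<Rightarrow>
   ('m \<times> ('g \<Rightarrow> 'c), ('m \<times> ('g \<Rightarrow> 'c)) \<times> 'c \<times> ('m \<times> ('g \<Rightarrow> 'c)), 't, 'u) cat_functor" where
  "twisted_shadow B G \<Theta> sh g R = \<lparr>
     ObMap = (\<lambda>(M, \<tau>). ObMap (sh R) (left_twist B G \<Theta> g M)),
     ArMap = (\<lambda>(x, f, y). ArMap (sh R) (left_twist_2cell B G \<Theta> g f))\<rparr>"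

definition transport_map ::
  "('o, 'm, 'c, 'z) bicat_scheme \<Rightarrow> ('g, 'y) monoid_scheme \<Rightarrow> 'g \<Rightarrow> 'm \<times> ('g \<Rightarrow> 'c) \<Rightarrow> 'c" where
  "transport_map B G g = (\<lambda>(M, \<tau>). cat_inv B (\<tau> (inv\<^bsub>G\<^esub> g)))"

definition twisted_cyclicity ::
  "('o, 'm, 'c, 'z) bicat_scheme \<Rightarrow> ('t, 'u, 'w) cat_scheme \<Rightarrow> ('g, 'y) monoid_scheme \<Rightarrow>
   ('o \<Rightarrow> 'g \<Rightarrow> 'm) \<Rightarrow> ('o \<Rightarrow> ('m, 'c, 't, 'u) cat_functor) \<Rightarrow> ('m \<Rightarrow> 'm \<Rightarrow> 'u) \<Rightarrow>
   'g \<Rightarrow> 'm \<times> ('g \<Rightarrow> 'c) \<Rightarrow> 'm \<times> ('g \<Rightarrow> 'c) \<Rightarrow> 'u" where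
  "twisted_cyclicity B T G \<Theta> sh \<theta> g x y = (let
      M = fst x; N = fst y; R = Src B M; S = Trg B M;
      \<Theta>R = \<Theta> R (inv\<^bsub>G\<^esub> g); \<Theta>S = \<Theta> S (inv\<^bsub>G\<^esub> g)
    in
      ArMap (sh S) (Assoc B \<Theta>S N M) \<cdot>\<^bsub>T\<^esub>
      ArMap (sh S) (transport_map B G g y \<star>\<^bsub>B\<^esub> Idt B M) \<cdot>\<^bsub>T\<^esub>
      ArMap (sh S) (cat_inv B (Assoc B N \<Theta>R M)) \<cdot>\<^bsub>T\<^esub>
      \<theta> (\<Theta>R \<odot>\<^bsub>B\<^esub> M) N \<cdot>\<^bsub>T\<^esub>
      ArMap (sh R) (cat_inv B (Assoc B \<Theta>R M N)))"

end

theory Submission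
  imports Defs
begin

text \<open>
  Suppress associators and write \<open>\<Theta> x\<close> for the 1-cell attached to a group element \<open>x\<close>. The twist \<open>\<tau>\<close> of a
  1-cell \<open>M\<close> is used through its inverses \<open>s y : M \<Theta>(y) \<Rightarrow> \<Theta>(y) M\<close>, which form a half-braiding of \<open>M\<close>
  with the family \<open>\<Theta>\<close>, compatible with the multiplications \<open>\<mu>\<close>. From a half-braiding and the
  cyclicity of the shadow one gets, for all \<open>y\<close> and \<open>x\<close>, the conjugation map

    \<open>\<langle>\<Theta>(y x) M\<rangle> \<cong> \<langle>\<Theta>(y) \<Theta>(x) M\<rangle> \<rightarrow> \<langle>\<Theta>(x) M \<Theta>(y)\<rangle> \<rightarrow> \<langle>\<Theta>(x) \<Theta>(y) M\<rangle> \<cong> \<langle>\<Theta>(x y) M\<rangle>\<close>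

  which rotates \<open>\<Theta>(y)\<close> to the back and then slides it past \<open>M\<close> by \<open>s y\<close>. With \<open>y = h\<inverse>\<close> and
  \<open>x = h g\<inverse>\<close> its source is the \<open>g\<close>-twisted shadow and its target the \<open>h g h\<inverse>\<close>-twisted one; this is
  the required isomorphism (\<open>twisted_conj\<close>).

  Naturality is the naturality of the rotation together with the fact that 2-cells of twists commute
  with half-braidings. The composition law says that rotating and sliding \<open>\<Theta>(y) \<Theta>(z)\<close> in one go is the
  same as doing it letter by letter (\<open>slide_hc1\<close>, \<open>conjugation_mult\<close>): this is the hexagon for the
  rotations and the multiplicativity of the half-braiding. At the unit of the group the map is thus
  an idempotent isomorphism, hence an identity. Compatibility with the twisted cyclicity
  (\<open>slide_twisted_rot\<close>, \<open>conjugation_twisted_rot\<close>) moves the half-braidings out of the way by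
  naturality of the rotations; the rotations that remain agree by two instances of the hexagon.

  All of this is short when \<open>\<odot>\<close> is strictly associative, so that case is treated abstractly
  (\<open>strict_shadow\<close>, \<open>strict_twist\<close>). A general bicategory is replaced by its strictification: 1-cells are
  nonempty composable words of 1-cells, 2-cells are 2-cells between the right-bracketed composites,
  and juxtaposition is concatenation, corrected by the canonical rebracketing \<open>word_splice\<close>. The pentagon makes
  this strictly associative (\<open>splice_assoc\<close>, \<open>word_hcomp_assoc\<close>), and the shadow transports to words
  (\<open>strict_shadow_words\<close>). A composite of two 1-cells of the bicategory is a one-letter word, isomorphic but
  not equal to the two-letter word; \<open>conjugation_regroup\<close> shows that conjugation does not see the
  difference.
\<close>

section \<open>Arrows and isomorphisms of a category\<close>

context category
begin

lemma hom_iff: "f \<in> cat_hom C x y \<longleftrightarrow> f \<in> Arr C \<and> Dom C f = x \<and> Cod C f = y"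
  by (simp add: cat_hom_def)

lemma id_arr [simp]:
  assumes "x \<in> Obj C"
  shows "Idt C x \<in> Arr C" "Dom C (Idt C x) = x" "Cod C (Idt C x) = x"
  using id_in_hom[OF assms] by (simp_all add: hom_iff)

lemma comp_arr [simp]:
  assumes "f \<in> Arr C" "g \<in> Arr C" "Cod C f = Dom C g"
  shows "g \<cdot> f \<in> Arr C" "Dom C (g \<cdot> f) = Dom C f" "Cod C (g \<cdot> f) = Cod C g"
  using comp_in_hom[of f "Dom C f" "Cod C f" g "Cod C g"] assms by (simp_all add: hom_iff)

lemma comp_assoc_arr [simp]:
  assumes "f \<in> Arr C" "g \<in> Arr C" "h \<in> Arr C" "Cod C f = Dom C g" "Cod C g = Dom C h"
  shows "(h \<cdot> g) \<cdot> f = h \<cdot> (g \<cdot> f)"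
  using comp_assoc[of f "Dom C f" "Cod C f" g "Cod C g" h "Cod C h"] assms by (simp add: hom_iff)

lemma id_comp_arr [simp]: "f \<in> Arr C \<Longrightarrow> Cod C f = x \<Longrightarrow> Idt C x \<cdot> f = f"
  using id_comp[of f "Dom C f" x] by (simp add: hom_iff)

lemma comp_id_arr [simp]: "f \<in> Arr C \<Longrightarrow> Dom C f = x \<Longrightarrow> f \<cdot> Idt C x = f"
  using comp_id[of f x "Cod C f"] by (simp add: hom_iff)

text \<open>
  Equations between composites of two arrows are applied inside longer, right-bracketed composites
  through this lemma and the next one.
\<close>

lemma comp_extend:
  assumes "g \<cdot> f = g' \<cdot> f'"
    and "k \<in> Arr C" "f \<in> Arr C" "g \<in> Arr C" "Cod C k = Dom C f" "Cod C f = Dom C g"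
    and "f' \<in> Arr C" "g' \<in> Arr C" "Cod C k = Dom C f'" "Cod C f' = Dom C g'"
  shows "g \<cdot> (f \<cdot> k) = g' \<cdot> (f' \<cdot> k)"
  using assms comp_assoc_arr by metis

lemma comp_extend1:
  assumes "g \<cdot> f = h"
    and "k \<in> Arr C" "f \<in> Arr C" "g \<in> Arr C" "Cod C k = Dom C f" "Cod C f = Dom C g"
  shows "g \<cdot> (f \<cdot> k) = h \<cdot> k"
  using assms comp_assoc_arr by metis

lemma inverse_arrows_unique:
  assumes "inverse_arrows C f g" "inverse_arrows C f g'"
  shows "g = g'"
proof -
  have g: "f \<in> Arr C" "g \<in> Arr C" "Dom C g = Cod C f" "Cod C g = Dom C f"
    "g \<cdot> f = Idt C (Dom C f)"
    using assms(1) by (auto simp: inverse_arrows_def hom_iff)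
  have g': "g' \<in> Arr C" "Dom C g' = Cod C f" "Cod C g' = Dom C f" "f \<cdot> g' = Idt C (Cod C f)"
    using assms(2) by (auto simp: inverse_arrows_def hom_iff)
  have "g = g \<cdot> (f \<cdot> g')" using g g' by simp
  also have "\<dots> = (g \<cdot> f) \<cdot> g'" using g(1-4) g'(1-3) by simp
  also have "\<dots> = g'" by (simp only: g(5)) (use g(1-4) g'(1-3) in simp)
  finally show ?thesis .
qed

lemma is_isoI:
  assumes "f \<in> Arr C" "g \<in> Arr C" "Dom C g = Cod C f" "Cod C g = Dom C f"
    and "g \<cdot> f = Idt C (Dom C f)" "f \<cdot> g = Idt C (Cod C f)"
  shows "is_iso C f"
  using assms unfolding is_iso_def inverse_arrows_def hom_iff by blast

lemma cat_inv_inverse: "is_iso C f \<Longrightarrow> inverse_arrows C f (cat_inv C f)"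
  unfolding is_iso_def cat_inv_def by (metis inverse_arrows_unique theI)

lemma iso_arr: "is_iso C f \<Longrightarrow> f \<in> Arr C"
  by (auto simp: is_iso_def inverse_arrows_def)

lemma cat_inv_arr [simp]:
  assumes "is_iso C f"
  shows "cat_inv C f \<in> Arr C" "Dom C (cat_inv C f) = Cod C f" "Cod C (cat_inv C f) = Dom C f"
  using cat_inv_inverse[OF assms] by (auto simp: inverse_arrows_def hom_iff)

lemma cat_inv_comp [simp]:
  assumes "is_iso C f"
  shows "cat_inv C f \<cdot> f = Idt C (Dom C f)" "f \<cdot> cat_inv C f = Idt C (Cod C f)"
  using cat_inv_inverse[OF assms] by (auto simp: inverse_arrows_def)

lemma cat_inv_comp_extend [simp]:
  assumes "is_iso C f" "k \<in> Arr C"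
  shows "Cod C k = Dom C f \<Longrightarrow> cat_inv C f \<cdot> (f \<cdot> k) = k"
    and "Cod C k = Cod C f \<Longrightarrow> f \<cdot> (cat_inv C f \<cdot> k) = k"
  using assms iso_arr[OF assms(1)] by (simp_all add: comp_extend1[where h = "Idt C _"])

lemma iso_cat_inv [simp]: "is_iso C f \<Longrightarrow> is_iso C (cat_inv C f)"
  using iso_arr by (intro is_isoI[where g = f]) simp_all

lemma iso_id [simp]: "x \<in> Obj C \<Longrightarrow> is_iso C (Idt C x)"
  by (intro is_isoI[where g = "Idt C x"]) simp_all

lemma iso_comp [simp]:
  assumes "is_iso C f" "is_iso C g" "Cod C f = Dom C g"
  shows "is_iso C (g \<cdot> f)"
proof (rule is_isoI[where g = "cat_inv C f \<cdot> cat_inv C g"])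
  have "f \<in> Arr C" "g \<in> Arr C" using assms iso_arr by auto
  then show "g \<cdot> f \<in> Arr C" "cat_inv C f \<cdot> cat_inv C g \<in> Arr C"
    "Dom C (cat_inv C f \<cdot> cat_inv C g) = Cod C (g \<cdot> f)"
    "Cod C (cat_inv C f \<cdot> cat_inv C g) = Dom C (g \<cdot> f)"
    "(cat_inv C f \<cdot> cat_inv C g) \<cdot> (g \<cdot> f) = Idt C (Dom C (g \<cdot> f))"
    "(g \<cdot> f) \<cdot> (cat_inv C f \<cdot> cat_inv C g) = Idt C (Cod C (g \<cdot> f))"
    using assms by simp_all
qed

lemma cat_inv_unique:
  assumes "f \<in> Arr C" "g \<in> Arr C" "Dom C g = Cod C f" "Cod C g = Dom C f"
    and "g \<cdot> f = Idt C (Dom C f)" "f \<cdot> g = Idt C (Cod C f)"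
  shows "cat_inv C f = g"
proof -
  have "inverse_arrows C f g" using assms by (simp add: inverse_arrows_def hom_iff)
  then show ?thesis using inverse_arrows_unique cat_inv_inverse is_iso_def by metis
qed

lemma cat_inv_id [simp]: "x \<in> Obj C \<Longrightarrow> cat_inv C (Idt C x) = Idt C x"
  by (rule cat_inv_unique) simp_all

lemma cat_inv_cat_inv [simp]: "is_iso C f \<Longrightarrow> cat_inv C (cat_inv C f) = f"
  using iso_arr by (intro cat_inv_unique) simp_all

lemma cat_inv_comp_rev:
  assumes "is_iso C f" "is_iso C g" "Cod C f = Dom C g"
  shows "cat_inv C (g \<cdot> f) = cat_inv C f \<cdot> cat_inv C g"
  using assms iso_arr[OF assms(1)] iso_arr[OF assms(2)] by (intro cat_inv_unique) simp_all

lemma iso_cancel_right: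
  assumes "is_iso C f" "g \<cdot> f = h \<cdot> f" "g \<in> Arr C" "h \<in> Arr C" "Dom C g = Cod C f" "Dom C h = Cod C f"
  shows "g = h"
proof -
  have f: "f \<in> Arr C" using assms(1) iso_arr by blast
  have "g = (g \<cdot> f) \<cdot> cat_inv C f" using assms(1,3-6) f by simp
  also have "\<dots> = (h \<cdot> f) \<cdot> cat_inv C f" by (simp only: assms(2))
  also have "\<dots> = h" using assms(1,3-6) f by simp
  finally show ?thesis .
qed

lemma iso_cancel_left:
  assumes "is_iso C f" "f \<cdot> g = f \<cdot> h" "g \<in> Arr C" "h \<in> Arr C" "Cod C g = Dom C f" "Cod C h = Dom C f"
  shows "g = h"
proof -
  have "g = cat_inv C f \<cdot> (f \<cdot> g)" using assms(1,3-6) by simp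
  also have "\<dots> = cat_inv C f \<cdot> (f \<cdot> h)" by (simp only: assms(2))
  also have "\<dots> = h" using assms(1,3-6) by simp
  finally show ?thesis .
qed

lemma idempotent_iso_id:
  assumes "is_iso C f" "Cod C f = Dom C f" "f \<cdot> f = f"
  shows "f = Idt C (Dom C f)"
proof (rule iso_cancel_left[OF assms(1)])
  have "f \<in> Arr C" using assms(1) iso_arr by blast
  then show "f \<cdot> f = f \<cdot> Idt C (Dom C f)" "f \<in> Arr C" "Idt C (Dom C f) \<in> Arr C"
    "Cod C f = Dom C f" "Cod C (Idt C (Dom C f)) = Dom C f"
    using assms dom_in_Obj by simp_all
qed

end

section \<open>Strictly associative shadows\<close>

text \<open>
  A shadow on a strictly associative bicategory without units: \<open>hc1\<close> and \<open>hc2\<close> are juxtaposition of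
  1-cells and 2-cells, \<open>tro\<close> and \<open>tr\<close> the shadow on objects and arrows, and \<open>rot\<close> its cyclicity.
  The model of interest is given by words of 1-cells.
\<close>

locale strict_shadow = V: category V + T: category T
  for V :: "('w, 'a, 'z) cat_scheme" (structure) and T :: "('t, 'u, 'v) cat_scheme" +
  fixes src trg :: "'w \<Rightarrow> 'o"
    and hc1 :: "'w \<Rightarrow> 'w \<Rightarrow> 'w"  (infixr "\<bullet>" 70)
    and hc2 :: "'a \<Rightarrow> 'a \<Rightarrow> 'a"  (infixr "\<diamondop>" 70)
    and tro :: "'w \<Rightarrow> 't"
    and tr :: "'a \<Rightarrow> 'u"
    and rot :: "'w \<Rightarrow> 'w \<Rightarrow> 'u"
  assumes src_Cod: "f \<in> Arr V \<Longrightarrow> src (Cod V f) = src (Dom V f)"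
    and trg_Cod: "f \<in> Arr V \<Longrightarrow> trg (Cod V f) = trg (Dom V f)"
    and hc1_Obj: "\<lbrakk>M \<in> Obj V; N \<in> Obj V; trg M = src N\<rbrakk> \<Longrightarrow> M \<bullet> N \<in> Obj V"
    and src_hc1: "\<lbrakk>M \<in> Obj V; N \<in> Obj V; trg M = src N\<rbrakk> \<Longrightarrow> src (M \<bullet> N) = src M"
    and trg_hc1: "\<lbrakk>M \<in> Obj V; N \<in> Obj V; trg M = src N\<rbrakk> \<Longrightarrow> trg (M \<bullet> N) = trg N"
    and hc1_assoc: "(M \<bullet> N) \<bullet> K = M \<bullet> (N \<bullet> K)"
    and hc2_hom: "\<lbrakk>f \<in> Arr V; g \<in> Arr V; trg (Dom V f) = src (Dom V g)\<rbrakk> \<Longrightarrow>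
      f \<diamondop> g \<in> cat_hom V (Dom V f \<bullet> Dom V g) (Cod V f \<bullet> Cod V g)"
    and hc2_id: "\<lbrakk>M \<in> Obj V; N \<in> Obj V; trg M = src N\<rbrakk> \<Longrightarrow> Idt V M \<diamondop> Idt V N = Idt V (M \<bullet> N)"
    and interchange: "\<lbrakk>f \<in> Arr V; f' \<in> Arr V; g \<in> Arr V; g' \<in> Arr V; Cod V f = Dom V f';
      Cod V g = Dom V g'; trg (Dom V f) = src (Dom V g)\<rbrakk> \<Longrightarrow>
      (f' \<cdot> f) \<diamondop> (g' \<cdot> g) = (f' \<diamondop> g') \<cdot> (f \<diamondop> g)"
    and hc2_assoc: "\<lbrakk>f \<in> Arr V; g \<in> Arr V; h \<in> Arr V; trg (Dom V f) = src (Dom V g);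
      trg (Dom V g) = src (Dom V h)\<rbrakk> \<Longrightarrow> (f \<diamondop> g) \<diamondop> h = f \<diamondop> (g \<diamondop> h)"
    and tr_hom: "\<lbrakk>f \<in> Arr V; trg (Dom V f) = src (Dom V f)\<rbrakk> \<Longrightarrow>
      tr f \<in> cat_hom T (tro (Dom V f)) (tro (Cod V f))"
    and tr_id: "\<lbrakk>M \<in> Obj V; trg M = src M\<rbrakk> \<Longrightarrow> tr (Idt V M) = Idt T (tro M)"
    and tr_comp: "\<lbrakk>f \<in> Arr V; g \<in> Arr V; Cod V f = Dom V g; trg (Dom V f) = src (Dom V f)\<rbrakk> \<Longrightarrow>
      tr (g \<cdot> f) = tr g \<cdot>\<^bsub>T\<^esub> tr f"
    and rot_hom: "\<lbrakk>M \<in> Obj V; N \<in> Obj V; trg M = src N; trg N = src M\<rbrakk> \<Longrightarrow>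
      rot M N \<in> cat_hom T (tro (M \<bullet> N)) (tro (N \<bullet> M))"
    and rot_iso: "\<lbrakk>M \<in> Obj V; N \<in> Obj V; trg M = src N; trg N = src M\<rbrakk> \<Longrightarrow> is_iso T (rot M N)"
    and rot_natural: "\<lbrakk>f \<in> Arr V; g \<in> Arr V; trg (Dom V f) = src (Dom V g);
      trg (Dom V g) = src (Dom V f)\<rbrakk> \<Longrightarrow>
      rot (Cod V f) (Cod V g) \<cdot>\<^bsub>T\<^esub> tr (f \<diamondop> g) = tr (g \<diamondop> f) \<cdot>\<^bsub>T\<^esub> rot (Dom V f) (Dom V g)"
    and rot_hexagon: "\<lbrakk>M \<in> Obj V; N \<in> Obj V; K \<in> Obj V; trg M = src N; trg N = src K;
      trg K = src M\<rbrakk> \<Longrightarrow>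
      rot (M \<bullet> N) K = rot N (K \<bullet> M) \<cdot>\<^bsub>T\<^esub> rot M (N \<bullet> K)"
begin

lemma hc2_arr [simp]:
  assumes "f \<in> Arr V" "g \<in> Arr V" "trg (Dom V f) = src (Dom V g)"
  shows "f \<diamondop> g \<in> Arr V" "Dom V (f \<diamondop> g) = Dom V f \<bullet> Dom V g" "Cod V (f \<diamondop> g) = Cod V f \<bullet> Cod V g"
  using hc2_hom[OF assms] by (simp_all add: V.hom_iff)

lemma tr_arr [simp]:
  assumes "f \<in> Arr V" "trg (Dom V f) = src (Dom V f)"
  shows "tr f \<in> Arr T" "Dom T (tr f) = tro (Dom V f)" "Cod T (tr f) = tro (Cod V f)"
  using tr_hom[OF assms] by (simp_all add: T.hom_iff)

lemma rot_arr [simp]: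
  assumes "M \<in> Obj V" "N \<in> Obj V" "trg M = src N" "trg N = src M"
  shows "rot M N \<in> Arr T" "Dom T (rot M N) = tro (M \<bullet> N)" "Cod T (rot M N) = tro (N \<bullet> M)"
  using rot_hom[OF assms] by (simp_all add: T.hom_iff)

lemmas [simp] = src_Cod trg_Cod hc1_Obj src_hc1 trg_hc1 hc1_assoc hc2_id hc2_assoc tr_id rot_iso
  V.dom_in_Obj V.cod_in_Obj

lemma tro_Obj [simp]: "M \<in> Obj V \<Longrightarrow> trg M = src M \<Longrightarrow> tro M \<in> Obj T"
  using T.dom_in_Obj[of "tr (Idt V M)"] tr_arr[of "Idt V M"] by (simp del: tr_id)

lemma hc2_iso [simp]:
  assumes "is_iso V f" "is_iso V g" "trg (Dom V f) = src (Dom V g)"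
  shows "is_iso V (f \<diamondop> g)"
proof (rule V.is_isoI[where g = "cat_inv V f \<diamondop> cat_inv V g"])
  note [simp] = V.iso_arr[OF assms(1)] V.iso_arr[OF assms(2)]
  show "f \<diamondop> g \<in> Arr V" "cat_inv V f \<diamondop> cat_inv V g \<in> Arr V"
    "Dom V (cat_inv V f \<diamondop> cat_inv V g) = Cod V (f \<diamondop> g)"
    "Cod V (cat_inv V f \<diamondop> cat_inv V g) = Dom V (f \<diamondop> g)"
    "(cat_inv V f \<diamondop> cat_inv V g) \<cdot> (f \<diamondop> g) = Idt V (Dom V (f \<diamondop> g))"
    "(f \<diamondop> g) \<cdot> (cat_inv V f \<diamondop> cat_inv V g) = Idt V (Cod V (f \<diamondop> g))"
    using assms by (simp_all flip: interchange)
qed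

lemma tr_iso [simp]:
  assumes "is_iso V f" "trg (Dom V f) = src (Dom V f)"
  shows "is_iso T (tr f)"
  using assms V.iso_arr[OF assms(1)]
  by (intro T.is_isoI[where g = "tr (cat_inv V f)"]) (simp_all flip: tr_comp)

text \<open>
  The map \<open>\<langle>F X M\<rangle> \<rightarrow> \<langle>X M F\<rangle> \<rightarrow> \<langle>X F' M\<rangle>\<close> that rotates \<open>F\<close> to the back and moves it past \<open>M\<close> by
  \<open>s : M F \<Rightarrow> F' M\<close>.
\<close>

definition slide :: "'w \<Rightarrow> 'w \<Rightarrow> 'w \<Rightarrow> 'a \<Rightarrow> 'u" where
  "slide F X M s = tr (Idt V X \<diamondop> s) \<cdot>\<^bsub>T\<^esub> rot F (X \<bullet> M)"

text \<open>
  The strict form of the twisted cyclicity: \<open>\<langle>F M N\<rangle> \<rightarrow> \<langle>N F M\<rangle> \<rightarrow> \<langle>F' N M\<rangle>\<close> for \<open>n : N F \<Rightarrow> F' N\<close>.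
\<close>

definition twisted_rot :: "'w \<Rightarrow> 'w \<Rightarrow> 'w \<Rightarrow> 'a \<Rightarrow> 'u" where
  "twisted_rot F M N n = tr (n \<diamondop> Idt V M) \<cdot>\<^bsub>T\<^esub> rot (F \<bullet> M) N"

lemma slide_arr [simp]:
  assumes "F \<in> Obj V" "X \<in> Obj V" "M \<in> Obj V" "F' \<in> Obj V"
    and "trg X = src M" "trg M = src X" "src F = src X" "trg F = src X" "src F' = src M" "trg F' = src M"
    and "s \<in> Arr V" "Dom V s = M \<bullet> F" "Cod V s = F' \<bullet> M"
  shows "slide F X M s \<in> Arr T" "Dom T (slide F X M s) = tro (F \<bullet> X \<bullet> M)"
    "Cod T (slide F X M s) = tro (X \<bullet> F' \<bullet> M)"
  using assms by (simp_all add: slide_def)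

lemma slide_iso:
  assumes "F \<in> Obj V" "X \<in> Obj V" "M \<in> Obj V" "trg X = src M" "trg M = src X" "src F = src X" "trg F = src X"
    and "is_iso V s" "Dom V s = M \<bullet> F"
  shows "is_iso T (slide F X M s)"
  using assms V.iso_arr[OF assms(8)] by (simp add: slide_def)

text \<open>
  One statement covers naturality in \<open>F\<close>, in \<open>X\<close> and in \<open>M\<close>: for \<open>F\<close> and \<open>X\<close> it is applied to the multiplications
  \<open>\<mu>\<close>, for \<open>M\<close> to 2-cells of twists.
\<close>

lemma slide_natural:
  assumes f: "f \<in> Arr V" "Dom V f = F" "Cod V f = F'"
    and x: "x \<in> Arr V" "Dom V x = X" "Cod V x = X'"
    and m: "m \<in> Arr V" "Dom V m = M" "Cod V m = M'"
    and f': "f' \<in> Arr V" "Dom V f' = H" "Cod V f' = H'"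
    and c: "trg X = src M" "trg M = src X" "src F = src X" "trg F = src X" "src H = src M" "trg H = src M"
    and s: "s \<in> Arr V" "Dom V s = M \<bullet> F" "Cod V s = H \<bullet> M"
    and s': "s' \<in> Arr V" "Dom V s' = M' \<bullet> F'" "Cod V s' = H' \<bullet> M'"
    and comm: "s' \<cdot> (m \<diamondop> f) = (f' \<diamondop> m) \<cdot> s"
  shows "slide F' X' M' s' \<cdot>\<^bsub>T\<^esub> tr (f \<diamondop> x \<diamondop> m) = tr (x \<diamondop> f' \<diamondop> m) \<cdot>\<^bsub>T\<^esub> slide F X M s"
proof -
  have o: "F \<in> Obj V" "X \<in> Obj V" "M \<in> Obj V" "H \<in> Obj V" using f x m f' by auto
  have o': "F' \<in> Obj V" "X' \<in> Obj V" "M' \<in> Obj V" "H' \<in> Obj V" using f x m f' by auto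
  have e: "src F' = src F" "src X' = src X" "src M' = src M" "src H' = src H"
    "trg F' = trg F" "trg X' = trg X" "trg M' = trg M" "trg H' = trg H"
    using f x m f' src_Cod trg_Cod by metis+
  note [simp] = f x m f' c s s' o o' e
  have n: "rot F' (X' \<bullet> M') \<cdot>\<^bsub>T\<^esub> tr (f \<diamondop> x \<diamondop> m) = tr (x \<diamondop> m \<diamondop> f) \<cdot>\<^bsub>T\<^esub> rot F (X \<bullet> M)"
    using rot_natural[of f "x \<diamondop> m"] by simp
  have x1: "(Idt V X' \<diamondop> s') \<cdot> (x \<diamondop> m \<diamondop> f) = (x \<diamondop> f' \<diamondop> m) \<cdot> (Idt V X \<diamondop> s)"
    by (simp flip: interchange add: comm)
  have "tr (Idt V X' \<diamondop> s') \<cdot>\<^bsub>T\<^esub> tr (x \<diamondop> m \<diamondop> f) = tr (x \<diamondop> f' \<diamondop> m) \<cdot>\<^bsub>T\<^esub> tr (Idt V X \<diamondop> s)"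
    using x1 by (simp flip: tr_comp)
  from T.comp_extend[OF this, of "rot F (X \<bullet> M)"] n
  show ?thesis by (simp add: slide_def)
qed

text \<open>
  The hexagon, read as: rotating \<open>F H\<close> to the back in one go is rotating \<open>F\<close> and then \<open>H\<close>. The slide
  of \<open>F\<close> past \<open>M\<close> can wait until after the rotation of \<open>H\<close>, by naturality of that rotation.
\<close>

lemma slide_hc1:
  assumes o: "F \<in> Obj V" "H \<in> Obj V" "X \<in> Obj V" "M \<in> Obj V" "F' \<in> Obj V" "H' \<in> Obj V"
    and c: "trg X = src M" "trg M = src X" "src F = src X" "trg F = src X"
      "src H = src X" "trg H = src X" "src F' = src M" "trg F' = src M" "src H' = src M" "trg H' = src M"
    and s: "s \<in> Arr V" "Dom V s = M \<bullet> F" "Cod V s = F' \<bullet> M"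
    and t: "t \<in> Arr V" "Dom V t = M \<bullet> H" "Cod V t = H' \<bullet> M"
  shows "slide (F \<bullet> H) X M ((Idt V F' \<diamondop> t) \<cdot> (s \<diamondop> Idt V H))
    = slide H (X \<bullet> F') M t \<cdot>\<^bsub>T\<^esub> slide F (H \<bullet> X) M s"
proof -
  note [simp] = o c s t
  have n: "rot H (X \<bullet> F' \<bullet> M) \<cdot>\<^bsub>T\<^esub> tr (Idt V H \<diamondop> Idt V X \<diamondop> s)
      = tr (Idt V X \<diamondop> s \<diamondop> Idt V H) \<cdot>\<^bsub>T\<^esub> rot H (X \<bullet> M \<bullet> F)"
    using rot_natural[of "Idt V H" "Idt V X \<diamondop> s"] by simp
  have w: "Idt V (X \<bullet> F') = Idt V X \<diamondop> Idt V F'" "Idt V (H \<bullet> X) = Idt V H \<diamondop> Idt V X" by simp_all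
  have "slide H (X \<bullet> F') M t \<cdot>\<^bsub>T\<^esub> slide F (H \<bullet> X) M s
      = tr (Idt V X \<diamondop> Idt V F' \<diamondop> t) \<cdot>\<^bsub>T\<^esub> ((rot H (X \<bullet> F' \<bullet> M) \<cdot>\<^bsub>T\<^esub> tr (Idt V H \<diamondop> Idt V X \<diamondop> s))
        \<cdot>\<^bsub>T\<^esub> rot F (H \<bullet> X \<bullet> M))"
    by (simp add: slide_def w del: hc2_id)
  also have "\<dots> = tr (Idt V X \<diamondop> Idt V F' \<diamondop> t) \<cdot>\<^bsub>T\<^esub> (tr (Idt V X \<diamondop> s \<diamondop> Idt V H) \<cdot>\<^bsub>T\<^esub>
      rot (F \<bullet> H) (X \<bullet> M))"
    unfolding n by (simp add: rot_hexagon)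
  also have "\<dots> = tr (Idt V X \<diamondop> ((Idt V F' \<diamondop> t) \<cdot> (s \<diamondop> Idt V H))) \<cdot>\<^bsub>T\<^esub> rot (F \<bullet> H) (X \<bullet> M)"
    using interchange[of "Idt V X" "Idt V X" "s \<diamondop> Idt V H" "Idt V F' \<diamondop> t"]
    by (simp add: tr_comp del: hc2_id)
  finally show ?thesis by (simp add: slide_def)
qed

lemma twisted_rot_natural:
  assumes f: "f \<in> Arr V" "Dom V f = F" "Cod V f = F'"
    and h: "h \<in> Arr V" "Dom V h = H" "Cod V h = H'"
    and o: "M \<in> Obj V" "N \<in> Obj V"
    and c: "trg M = src N" "trg N = src M" "src F = src M" "trg F = src M" "src H = src N" "trg H = src N"
    and n: "n \<in> Arr V" "Dom V n = N \<bullet> F" "Cod V n = H \<bullet> N"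
    and n': "n' \<in> Arr V" "Dom V n' = N \<bullet> F'" "Cod V n' = H' \<bullet> N"
    and comm: "n' \<cdot> (Idt V N \<diamondop> f) = (h \<diamondop> Idt V N) \<cdot> n"
  shows "twisted_rot F' M N n' \<cdot>\<^bsub>T\<^esub> tr (f \<diamondop> Idt V M \<diamondop> Idt V N)
    = tr (h \<diamondop> Idt V N \<diamondop> Idt V M) \<cdot>\<^bsub>T\<^esub> twisted_rot F M N n"
proof -
  have o': "F \<in> Obj V" "H \<in> Obj V" "F' \<in> Obj V" "H' \<in> Obj V" using f h by auto
  have e: "src F' = src F" "src H' = src H" "trg F' = trg F" "trg H' = trg H"
    using f h src_Cod trg_Cod by metis+
  note [simp] = f h o c n n' o' e
  have r: "rot (F' \<bullet> M) N \<cdot>\<^bsub>T\<^esub> tr (f \<diamondop> Idt V M \<diamondop> Idt V N) = tr (Idt V N \<diamondop> f \<diamondop> Idt V M) \<cdot>\<^bsub>T\<^esub> rot (F \<bullet> M) N"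
    using rot_natural[of "f \<diamondop> Idt V M" "Idt V N"] by simp
  have "(n' \<diamondop> Idt V M) \<cdot> (Idt V N \<diamondop> f \<diamondop> Idt V M) = (h \<diamondop> Idt V N \<diamondop> Idt V M) \<cdot> (n \<diamondop> Idt V M)"
    using interchange[of "Idt V N \<diamondop> f" n' "Idt V M" "Idt V M"]
      interchange[of n "h \<diamondop> Idt V N" "Idt V M" "Idt V M"] comm
    by (simp del: hc2_id)
  then have "tr (n' \<diamondop> Idt V M) \<cdot>\<^bsub>T\<^esub> tr (Idt V N \<diamondop> f \<diamondop> Idt V M)
      = tr (h \<diamondop> Idt V N \<diamondop> Idt V M) \<cdot>\<^bsub>T\<^esub> tr (n \<diamondop> Idt V M)"
    by (simp flip: tr_comp del: hc2_id)
  from T.comp_extend[OF this, of "rot (F \<bullet> M) N"] show ?thesis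
    using r by (simp add: twisted_rot_def del: hc2_id)
qed

text \<open>
  Both sides slide \<open>Y\<close> past \<open>N\<close>, \<open>M\<close> and \<open>N\<close> again, and \<open>X\<close> past \<open>N\<close>. After the half-braidings
  are moved to the front by naturality, the remaining rotations agree by the hexagon, applied on the left
  to \<open>Y, X M, N\<close> and on the right to \<open>X M, Y', N\<close>.
\<close>

lemma slide_twisted_rot:
  assumes o: "M \<in> Obj V" "N \<in> Obj V" "X \<in> Obj V" "Y \<in> Obj V" "X' \<in> Obj V" "Y' \<in> Obj V"
    and c: "trg M = src N" "trg N = src M" "src X = src M" "trg X = src M" "src Y = src M" "trg Y = src M"
      "src X' = src N" "trg X' = src N" "src Y' = src N" "trg Y' = src N"
    and m: "m \<in> Arr V" "Dom V m = M \<bullet> Y'" "Cod V m = Y \<bullet> M"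
    and ny: "ny \<in> Arr V" "Dom V ny = N \<bullet> Y" "Cod V ny = Y' \<bullet> N"
    and nx: "nx \<in> Arr V" "Dom V nx = N \<bullet> X" "Cod V nx = X' \<bullet> N"
  shows "slide Y' X' (N \<bullet> M) ((ny \<diamondop> Idt V M) \<cdot> (Idt V N \<diamondop> m)) \<cdot>\<^bsub>T\<^esub>
      twisted_rot (Y \<bullet> X) M N ((Idt V Y' \<diamondop> nx) \<cdot> (ny \<diamondop> Idt V X))
    = twisted_rot (X \<bullet> Y) M N ((Idt V X' \<diamondop> ny) \<cdot> (nx \<diamondop> Idt V Y)) \<cdot>\<^bsub>T\<^esub>
      slide Y X (M \<bullet> N) ((m \<diamondop> Idt V N) \<cdot> (Idt V M \<diamondop> ny))"
proof -
  note [simp] = o c m ny nx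
  note [simp del] = hc2_id
  let ?L = "tr (Idt V X' \<diamondop> ny \<diamondop> Idt V M)" and ?K = "tr (nx \<diamondop> Idt V Y \<diamondop> Idt V M)"
    and ?J = "tr (Idt V N \<diamondop> Idt V X \<diamondop> m)"
  have i: "Idt V (M \<bullet> Y') = Idt V M \<diamondop> Idt V Y'" "Idt V (X' \<bullet> N) = Idt V X' \<diamondop> Idt V N"
    "Idt V (N \<bullet> X) = Idt V N \<diamondop> Idt V X" "Idt V (Y \<bullet> M) = Idt V Y \<diamondop> Idt V M"
    by (simp_all add: hc2_id)
  have l: "slide Y' X' (N \<bullet> M) ((ny \<diamondop> Idt V M) \<cdot> (Idt V N \<diamondop> m)) =
      ?L \<cdot>\<^bsub>T\<^esub> (tr (Idt V X' \<diamondop> Idt V N \<diamondop> m) \<cdot>\<^bsub>T\<^esub> rot Y' (X' \<bullet> N \<bullet> M))"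
    using interchange[of "Idt V X'" "Idt V X'" "Idt V N \<diamondop> m" "ny \<diamondop> Idt V M"]
    by (simp add: slide_def tr_comp)
  have t: "twisted_rot (Y \<bullet> X) M N ((Idt V Y' \<diamondop> nx) \<cdot> (ny \<diamondop> Idt V X)) =
      tr (Idt V Y' \<diamondop> nx \<diamondop> Idt V M) \<cdot>\<^bsub>T\<^esub> (tr (ny \<diamondop> Idt V X \<diamondop> Idt V M) \<cdot>\<^bsub>T\<^esub> rot (Y \<bullet> X \<bullet> M) N)"
    using interchange[of "ny \<diamondop> Idt V X" "Idt V Y' \<diamondop> nx" "Idt V M" "Idt V M"]
    by (simp add: twisted_rot_def tr_comp)
  have t': "twisted_rot (X \<bullet> Y) M N ((Idt V X' \<diamondop> ny) \<cdot> (nx \<diamondop> Idt V Y)) =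
      ?L \<cdot>\<^bsub>T\<^esub> (?K \<cdot>\<^bsub>T\<^esub> rot (X \<bullet> Y \<bullet> M) N)"
    using interchange[of "nx \<diamondop> Idt V Y" "Idt V X' \<diamondop> ny" "Idt V M" "Idt V M"]
    by (simp add: twisted_rot_def tr_comp)
  have l': "slide Y X (M \<bullet> N) ((m \<diamondop> Idt V N) \<cdot> (Idt V M \<diamondop> ny)) =
      tr (Idt V X \<diamondop> m \<diamondop> Idt V N) \<cdot>\<^bsub>T\<^esub> (tr (Idt V X \<diamondop> Idt V M \<diamondop> ny) \<cdot>\<^bsub>T\<^esub> rot Y (X \<bullet> M \<bullet> N))"
    using interchange[of "Idt V X" "Idt V X" "Idt V M \<diamondop> ny" "m \<diamondop> Idt V N"]
    by (simp add: slide_def tr_comp)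
  have r1: "rot Y' (X' \<bullet> N \<bullet> M) \<cdot>\<^bsub>T\<^esub> tr (Idt V Y' \<diamondop> nx \<diamondop> Idt V M) =
      tr (nx \<diamondop> Idt V M \<diamondop> Idt V Y') \<cdot>\<^bsub>T\<^esub> rot Y' (N \<bullet> X \<bullet> M)"
    using rot_natural[of "Idt V Y'" "nx \<diamondop> Idt V M"] by simp
  have r2: "rot (X \<bullet> Y \<bullet> M) N \<cdot>\<^bsub>T\<^esub> tr (Idt V X \<diamondop> m \<diamondop> Idt V N) = ?J \<cdot>\<^bsub>T\<^esub> rot (X \<bullet> M \<bullet> Y') N"
    using rot_natural[of "Idt V X \<diamondop> m" "Idt V N"] by simp
  have r3: "rot (X \<bullet> M) (Y' \<bullet> N) \<cdot>\<^bsub>T\<^esub> tr (Idt V X \<diamondop> Idt V M \<diamondop> ny) =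
      tr (ny \<diamondop> Idt V X \<diamondop> Idt V M) \<cdot>\<^bsub>T\<^esub> rot (X \<bullet> M) (N \<bullet> Y)"
    using rot_natural[of "Idt V X \<diamondop> Idt V M" ny] by simp
  have h1: "rot (Y \<bullet> X \<bullet> M) N = rot (X \<bullet> M) (N \<bullet> Y) \<cdot>\<^bsub>T\<^esub> rot Y (X \<bullet> M \<bullet> N)"
    using rot_hexagon[of Y "X \<bullet> M" N] by simp
  have h2: "rot (X \<bullet> M \<bullet> Y') N = rot Y' (N \<bullet> X \<bullet> M) \<cdot>\<^bsub>T\<^esub> rot (X \<bullet> M) (Y' \<bullet> N)"
    using rot_hexagon[of "X \<bullet> M" Y' N] by simp
  have v: "tr (Idt V X' \<diamondop> Idt V N \<diamondop> m) \<cdot>\<^bsub>T\<^esub> tr (nx \<diamondop> Idt V M \<diamondop> Idt V Y') = ?K \<cdot>\<^bsub>T\<^esub> ?J"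
  proof -
    have "(Idt V (X' \<bullet> N) \<diamondop> m) \<cdot> (nx \<diamondop> Idt V (M \<bullet> Y')) = (nx \<diamondop> Idt V (Y \<bullet> M)) \<cdot> (Idt V (N \<bullet> X) \<diamondop> m)"
      by (simp flip: interchange)
    then show ?thesis by (simp add: i flip: tr_comp)
  qed
  let ?B = "tr (Idt V X' \<diamondop> Idt V N \<diamondop> m)" and ?E = "tr (ny \<diamondop> Idt V X \<diamondop> Idt V M)"
    and ?C = "tr (Idt V Y' \<diamondop> nx \<diamondop> Idt V M)" and ?G = "tr (nx \<diamondop> Idt V M \<diamondop> Idt V Y')"
    and ?P = "tr (Idt V X \<diamondop> Idt V M \<diamondop> ny)" and ?Q = "tr (Idt V X \<diamondop> m \<diamondop> Idt V N)"
    and ?r = "rot Y (X \<bullet> M \<bullet> N)"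
  have "slide Y' X' (N \<bullet> M) ((ny \<diamondop> Idt V M) \<cdot> (Idt V N \<diamondop> m)) \<cdot>\<^bsub>T\<^esub>
      twisted_rot (Y \<bullet> X) M N ((Idt V Y' \<diamondop> nx) \<cdot> (ny \<diamondop> Idt V X))
    = ?L \<cdot>\<^bsub>T\<^esub> (?B \<cdot>\<^bsub>T\<^esub> ((rot Y' (X' \<bullet> N \<bullet> M) \<cdot>\<^bsub>T\<^esub> ?C) \<cdot>\<^bsub>T\<^esub> (?E \<cdot>\<^bsub>T\<^esub> rot (Y \<bullet> X \<bullet> M) N)))"
    unfolding l t by simp
  also have "\<dots> = ?L \<cdot>\<^bsub>T\<^esub> ((?B \<cdot>\<^bsub>T\<^esub> ?G) \<cdot>\<^bsub>T\<^esub> (rot Y' (N \<bullet> X \<bullet> M) \<cdot>\<^bsub>T\<^esub>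
      ((?E \<cdot>\<^bsub>T\<^esub> rot (X \<bullet> M) (N \<bullet> Y)) \<cdot>\<^bsub>T\<^esub> ?r)))"
    unfolding r1 h1 by simp
  also have "\<dots> = ?L \<cdot>\<^bsub>T\<^esub> (?K \<cdot>\<^bsub>T\<^esub> ((?J \<cdot>\<^bsub>T\<^esub> rot (X \<bullet> M \<bullet> Y') N) \<cdot>\<^bsub>T\<^esub> (?P \<cdot>\<^bsub>T\<^esub> ?r)))"
    unfolding v r3[symmetric] h2 by simp
  also have "\<dots> = ?L \<cdot>\<^bsub>T\<^esub> (?K \<cdot>\<^bsub>T\<^esub> ((rot (X \<bullet> Y \<bullet> M) N \<cdot>\<^bsub>T\<^esub> ?Q) \<cdot>\<^bsub>T\<^esub> (?P \<cdot>\<^bsub>T\<^esub> ?r)))"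
    unfolding r2 ..
  also have "\<dots> = twisted_rot (X \<bullet> Y) M N ((Idt V X' \<diamondop> ny) \<cdot> (nx \<diamondop> Idt V Y)) \<cdot>\<^bsub>T\<^esub>
      slide Y X (M \<bullet> N) ((m \<diamondop> Idt V N) \<cdot> (Idt V M \<diamondop> ny))"
    unfolding l' t' by simp
  finally show ?thesis .
qed

end

section \<open>Conjugation on strictly associative shadows\<close>

text \<open>
  The 2-cells \<open>\<mu>\<close> make each family \<open>\<Theta> A\<close> multiplicative. The set \<open>ob\<close> holds the objects over which
  \<open>\<Theta>\<close> is specified.
\<close>

locale strict_twist = strict_shadow V T src trg hc1 hc2 tro tr rot + group G
  for V :: "('w, 'a, 'z) cat_scheme" (structure) and T :: "('t, 'u, 'v) cat_scheme"
    and src trg :: "'w \<Rightarrow> 'o"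
    and hc1 :: "'w \<Rightarrow> 'w \<Rightarrow> 'w"  (infixr "\<bullet>" 70)
    and hc2 :: "'a \<Rightarrow> 'a \<Rightarrow> 'a"  (infixr "\<diamondop>" 70)
    and tro tr rot
    and G :: "('g, 'y) monoid_scheme" +
  fixes ob :: "'o set" and \<Theta> :: "'o \<Rightarrow> 'g \<Rightarrow> 'w" and \<mu> :: "'o \<Rightarrow> 'g \<Rightarrow> 'g \<Rightarrow> 'a"
  assumes Theta_Obj [simp]: "\<lbrakk>A \<in> ob; g \<in> carrier G\<rbrakk> \<Longrightarrow> \<Theta> A g \<in> Obj V"
    and Theta_src [simp]: "\<lbrakk>A \<in> ob; g \<in> carrier G\<rbrakk> \<Longrightarrow> src (\<Theta> A g) = A"
    and Theta_trg [simp]: "\<lbrakk>A \<in> ob; g \<in> carrier G\<rbrakk> \<Longrightarrow> trg (\<Theta> A g) = A"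
    and mult_hom: "\<lbrakk>A \<in> ob; g \<in> carrier G; h \<in> carrier G\<rbrakk> \<Longrightarrow>
      \<mu> A g h \<in> cat_hom V (\<Theta> A g \<bullet> \<Theta> A h) (\<Theta> A (g \<otimes>\<^bsub>G\<^esub> h))"
    and mult_iso [simp]: "\<lbrakk>A \<in> ob; g \<in> carrier G; h \<in> carrier G\<rbrakk> \<Longrightarrow> is_iso V (\<mu> A g h)"
    and mult_assoc: "\<lbrakk>A \<in> ob; g \<in> carrier G; h \<in> carrier G; k \<in> carrier G\<rbrakk> \<Longrightarrow>
      \<mu> A g (h \<otimes>\<^bsub>G\<^esub> k) \<cdot> (Idt V (\<Theta> A g) \<diamondop> \<mu> A h k) =
      \<mu> A (g \<otimes>\<^bsub>G\<^esub> h) k \<cdot> (\<mu> A g h \<diamondop> Idt V (\<Theta> A k))"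
begin

lemma mult_arr [simp]:
  assumes "A \<in> ob" "g \<in> carrier G" "h \<in> carrier G"
  shows "\<mu> A g h \<in> Arr V" "Dom V (\<mu> A g h) = \<Theta> A g \<bullet> \<Theta> A h"
    "Cod V (\<mu> A g h) = \<Theta> A (g \<otimes>\<^bsub>G\<^esub> h)"
  using mult_hom[OF assms] by (simp_all add: V.hom_iff)

text \<open>
  The family \<open>s\<close> consists of the inverses of the components of a twist. In this direction they compose
  directly with rotations, as \<open>rot\<close> produces \<open>M \<Theta>(y)\<close> and \<open>s y\<close> consumes it.
\<close>

definition half_braiding :: "'w \<Rightarrow> ('g \<Rightarrow> 'a) \<Rightarrow> bool" where
  "half_braiding M s \<longleftrightarrow> M \<in> Obj V \<and> src M \<in> ob \<and> trg M \<in> ob \<and>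
    (\<forall>y \<in> carrier G. is_iso V (s y) \<and>
       s y \<in> cat_hom V (M \<bullet> \<Theta> (trg M) y) (\<Theta> (src M) y \<bullet> M)) \<and>
    (\<forall>y \<in> carrier G. \<forall>z \<in> carrier G.
       s (y \<otimes>\<^bsub>G\<^esub> z) \<cdot> (Idt V M \<diamondop> \<mu> (trg M) y z) = (\<mu> (src M) y z \<diamondop> Idt V M) \<cdot>
         ((Idt V (\<Theta> (src M) y) \<diamondop> s z) \<cdot> (s y \<diamondop> Idt V (\<Theta> (trg M) z))))"

lemma half_braidingD:
  assumes "half_braiding M s"
  shows "M \<in> Obj V" "src M \<in> ob" "trg M \<in> ob"
    and "y \<in> carrier G \<Longrightarrow> is_iso V (s y)"
    and "y \<in> carrier G \<Longrightarrow> s y \<in> Arr V"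
    and "y \<in> carrier G \<Longrightarrow> Dom V (s y) = M \<bullet> \<Theta> (trg M) y"
    and "y \<in> carrier G \<Longrightarrow> Cod V (s y) = \<Theta> (src M) y \<bullet> M"
  using assms by (auto simp: half_braiding_def V.hom_iff)

lemma half_braiding_mult:
  assumes "half_braiding M s" "y \<in> carrier G" "z \<in> carrier G"
  shows "s (y \<otimes>\<^bsub>G\<^esub> z) \<cdot> (Idt V M \<diamondop> \<mu> (trg M) y z) = (\<mu> (src M) y z \<diamondop> Idt V M) \<cdot>
    ((Idt V (\<Theta> (src M) y) \<diamondop> s z) \<cdot> (s y \<diamondop> Idt V (\<Theta> (trg M) z)))"
  using assms by (simp add: half_braiding_def)

definition conjugation :: "'g \<Rightarrow> 'g \<Rightarrow> 'w \<Rightarrow> 'a \<Rightarrow> 'u" where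
  "conjugation y x M s = tr (\<mu> (src M) x y \<diamondop> Idt V M) \<cdot>\<^bsub>T\<^esub> slide (\<Theta> (src M) y) (\<Theta> (src M) x) M s \<cdot>\<^bsub>T\<^esub>
    tr (cat_inv V (\<mu> (src M) y x) \<diamondop> Idt V M)"

text \<open>
  The inverse of \<open>\<mu>\<close> in the definition of \<open>conjugation\<close> is inconvenient; since \<open>\<mu>\<close> is invertible,
  \<open>conjugation_mult_cell\<close> determines the map, and the lemmas after it are proved by precomposing with \<open>\<mu>\<close>.
\<close>

context
  fixes y x M s R
  assumes yx [simp]: "y \<in> carrier G" "x \<in> carrier G"
    and M [simp]: "M \<in> Obj V" "src M = R" "trg M = R" "R \<in> ob"
    and s [simp]: "s \<in> Arr V" "Dom V s = M \<bullet> \<Theta> R y" "Cod V s = \<Theta> R y \<bullet> M"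
begin

lemma conjugation_arr [simp]:
  "conjugation y x M s \<in> Arr T" "Dom T (conjugation y x M s) = tro (\<Theta> R (y \<otimes>\<^bsub>G\<^esub> x) \<bullet> M)"
  "Cod T (conjugation y x M s) = tro (\<Theta> R (x \<otimes>\<^bsub>G\<^esub> y) \<bullet> M)"
  by (simp_all add: conjugation_def slide_arr[where F' = "\<Theta> R y"])

lemma conjugation_mult_cell:
  "conjugation y x M s \<cdot>\<^bsub>T\<^esub> tr (\<mu> R y x \<diamondop> Idt V M) =
   tr (\<mu> R x y \<diamondop> Idt V M) \<cdot>\<^bsub>T\<^esub> slide (\<Theta> R y) (\<Theta> R x) M s"
proof -
  have "tr (cat_inv V (\<mu> R y x) \<diamondop> Idt V M) \<cdot>\<^bsub>T\<^esub> tr (\<mu> R y x \<diamondop> Idt V M) = Idt T (tro (\<Theta> R y \<bullet> \<Theta> R x \<bullet> M))"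
    by (simp flip: tr_comp interchange)
  then show ?thesis by (simp add: conjugation_def slide_arr[where F' = "\<Theta> R y"])
qed

end

lemma conjugation_iso:
  assumes "y \<in> carrier G" "x \<in> carrier G" "M \<in> Obj V" "src M = R" "trg M = R" "R \<in> ob"
    and "is_iso V s" "Dom V s = M \<bullet> \<Theta> R y" "Cod V s = \<Theta> R y \<bullet> M"
  shows "is_iso T (conjugation y x M s)"
  using assms V.iso_arr[OF assms(7)]
  by (simp add: conjugation_def slide_iso slide_arr[where F' = "\<Theta> R y"])

lemma conjugation_natural:
  assumes [simp]: "y \<in> carrier G" "x \<in> carrier G" "R \<in> ob"
    and m [simp]: "m \<in> Arr V" "Dom V m = M" "Cod V m = M'" "src M = R" "trg M = R"
    and s [simp]: "s \<in> Arr V" "Dom V s = M \<bullet> \<Theta> R y" "Cod V s = \<Theta> R y \<bullet> M"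
    and s' [simp]: "s' \<in> Arr V" "Dom V s' = M' \<bullet> \<Theta> R y" "Cod V s' = \<Theta> R y \<bullet> M'"
    and comm: "s' \<cdot> (m \<diamondop> Idt V (\<Theta> R y)) = (Idt V (\<Theta> R y) \<diamondop> m) \<cdot> s"
  shows "conjugation y x M' s' \<cdot>\<^bsub>T\<^esub> tr (Idt V (\<Theta> R (y \<otimes>\<^bsub>G\<^esub> x)) \<diamondop> m) =
    tr (Idt V (\<Theta> R (x \<otimes>\<^bsub>G\<^esub> y)) \<diamondop> m) \<cdot>\<^bsub>T\<^esub> conjugation y x M s"
proof -
  have o [simp]: "M \<in> Obj V" "M' \<in> Obj V" "src M' = R" "trg M' = R"
    using V.dom_in_Obj[OF m(1)] V.cod_in_Obj[OF m(1)] src_Cod[OF m(1)] trg_Cod[OF m(1)] by simp_all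
  let ?Y = "\<Theta> R y" and ?X = "\<Theta> R x"
  have sl: "slide ?Y ?X M' s' \<cdot>\<^bsub>T\<^esub> tr (Idt V ?Y \<diamondop> Idt V ?X \<diamondop> m) =
      tr (Idt V ?X \<diamondop> Idt V ?Y \<diamondop> m) \<cdot>\<^bsub>T\<^esub> slide ?Y ?X M s"
    by (rule slide_natural[where H = ?Y]) (simp_all add: comm)
  have e: "tr (\<mu> R a b \<diamondop> Idt V M') \<cdot>\<^bsub>T\<^esub> tr (Idt V (\<Theta> R a) \<diamondop> Idt V (\<Theta> R b) \<diamondop> m) =
      tr (Idt V (\<Theta> R (a \<otimes>\<^bsub>G\<^esub> b)) \<diamondop> m) \<cdot>\<^bsub>T\<^esub> tr (\<mu> R a b \<diamondop> Idt V M)"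
    if [simp]: "a \<in> carrier G" "b \<in> carrier G" for a b
  proof -
    have "(\<mu> R a b \<diamondop> Idt V M') \<cdot> (Idt V (\<Theta> R a \<bullet> \<Theta> R b) \<diamondop> m) =
      (Idt V (\<Theta> R (a \<otimes>\<^bsub>G\<^esub> b)) \<diamondop> m) \<cdot> (\<mu> R a b \<diamondop> Idt V M)"
      by (simp flip: interchange)
    then show ?thesis by (simp flip: tr_comp hc2_id)
  qed
  note [simp] = slide_arr[where F' = ?Y]
  show ?thesis
  proof (rule T.iso_cancel_right[where f = "tr (\<mu> R y x \<diamondop> Idt V M)"])
    have "(conjugation y x M' s' \<cdot>\<^bsub>T\<^esub> tr (Idt V (\<Theta> R (y \<otimes>\<^bsub>G\<^esub> x)) \<diamondop> m)) \<cdot>\<^bsub>T\<^esub> tr (\<mu> R y x \<diamondop> Idt V M)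
      = conjugation y x M' s' \<cdot>\<^bsub>T\<^esub> (tr (Idt V (\<Theta> R (y \<otimes>\<^bsub>G\<^esub> x)) \<diamondop> m) \<cdot>\<^bsub>T\<^esub> tr (\<mu> R y x \<diamondop> Idt V M))"
      by (simp add: conjugation_arr[where R = R])
    also have "\<dots> = (conjugation y x M' s' \<cdot>\<^bsub>T\<^esub> tr (\<mu> R y x \<diamondop> Idt V M')) \<cdot>\<^bsub>T\<^esub> tr (Idt V ?Y \<diamondop> Idt V ?X \<diamondop> m)"
      unfolding e[symmetric, OF assms(1,2)] by (simp add: conjugation_arr[where R = R])
    also have "\<dots> = tr (\<mu> R x y \<diamondop> Idt V M') \<cdot>\<^bsub>T\<^esub> (slide ?Y ?X M' s' \<cdot>\<^bsub>T\<^esub> tr (Idt V ?Y \<diamondop> Idt V ?X \<diamondop> m))"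
      by (simp add: conjugation_mult_cell)
    also have "\<dots> = (tr (\<mu> R x y \<diamondop> Idt V M') \<cdot>\<^bsub>T\<^esub> tr (Idt V ?X \<diamondop> Idt V ?Y \<diamondop> m)) \<cdot>\<^bsub>T\<^esub> slide ?Y ?X M s"
      unfolding sl by simp
    also have "\<dots> = tr (Idt V (\<Theta> R (x \<otimes>\<^bsub>G\<^esub> y)) \<diamondop> m) \<cdot>\<^bsub>T\<^esub> (conjugation y x M s \<cdot>\<^bsub>T\<^esub> tr (\<mu> R y x \<diamondop> Idt V M))"
      unfolding e[OF assms(2,1)] by (simp add: conjugation_mult_cell)
    also have "\<dots> = (tr (Idt V (\<Theta> R (x \<otimes>\<^bsub>G\<^esub> y)) \<diamondop> m) \<cdot>\<^bsub>T\<^esub> conjugation y x M s) \<cdot>\<^bsub>T\<^esub> tr (\<mu> R y x \<diamondop> Idt V M)"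
      by (simp add: conjugation_arr[where R = R])
    finally show "(conjugation y x M' s' \<cdot>\<^bsub>T\<^esub> tr (Idt V (\<Theta> R (y \<otimes>\<^bsub>G\<^esub> x)) \<diamondop> m)) \<cdot>\<^bsub>T\<^esub> tr (\<mu> R y x \<diamondop> Idt V M)
      = (tr (Idt V (\<Theta> R (x \<otimes>\<^bsub>G\<^esub> y)) \<diamondop> m) \<cdot>\<^bsub>T\<^esub> conjugation y x M s) \<cdot>\<^bsub>T\<^esub> tr (\<mu> R y x \<diamondop> Idt V M)" .
  qed (simp_all add: conjugation_arr[where R = R])
qed

text \<open>
  Precomposed with the multiplication of the three letters \<open>\<Theta>(y) \<Theta>(z) \<Theta>(x)\<close>, both sides become the slides
  of \<open>\<Theta>(y)\<close> and \<open>\<Theta>(z)\<close> followed by a multiplication, so \<open>slide_hc1\<close> together with the associativity of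
  \<open>\<mu>\<close> gives the claim.
\<close>

lemma conjugation_mult:
  assumes hb: "half_braiding M s" and MR [simp]: "src M = R" "trg M = R"
    and [simp]: "y \<in> carrier G" "z \<in> carrier G" "x \<in> carrier G"
  shows "conjugation z (x \<otimes>\<^bsub>G\<^esub> y) M (s z) \<cdot>\<^bsub>T\<^esub> conjugation y (z \<otimes>\<^bsub>G\<^esub> x) M (s y) = conjugation (y \<otimes>\<^bsub>G\<^esub> z) x M (s (y \<otimes>\<^bsub>G\<^esub> z))"
proof -
  note [simp] = half_braidingD[OF hb] m_assoc
  have [simp]: "R \<in> ob" using half_braidingD(2)[OF hb] by simp
  let ?X = "\<Theta> R x" and ?Y = "\<Theta> R y" and ?Z = "\<Theta> R z" and ?I = "Idt V M"
  have sa [simp]: "slide (\<Theta> R a) (\<Theta> R b) M (s a) \<in> Arr T"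
    "Dom T (slide (\<Theta> R a) (\<Theta> R b) M (s a)) = tro (\<Theta> R a \<bullet> \<Theta> R b \<bullet> M)"
    "Cod T (slide (\<Theta> R a) (\<Theta> R b) M (s a)) = tro (\<Theta> R b \<bullet> \<Theta> R a \<bullet> M)"
    if "a \<in> carrier G" "b \<in> carrier G" for a b
    using that by (simp_all add: slide_arr[where F' = "\<Theta> R a"])
  have sb [simp]: "slide (\<Theta> R a) (\<Theta> R b \<bullet> \<Theta> R c) M (s a) \<in> Arr T"
    "Dom T (slide (\<Theta> R a) (\<Theta> R b \<bullet> \<Theta> R c) M (s a)) = tro (\<Theta> R a \<bullet> \<Theta> R b \<bullet> \<Theta> R c \<bullet> M)"
    "Cod T (slide (\<Theta> R a) (\<Theta> R b \<bullet> \<Theta> R c) M (s a)) = tro (\<Theta> R b \<bullet> \<Theta> R c \<bullet> \<Theta> R a \<bullet> M)"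
    if "a \<in> carrier G" "b \<in> carrier G" "c \<in> carrier G" for a b c
    using that by (simp_all add: slide_arr[where F' = "\<Theta> R a"])
  have ca [simp]: "conjugation a b M (s a) \<in> Arr T" "Dom T (conjugation a b M (s a)) = tro (\<Theta> R (a \<otimes>\<^bsub>G\<^esub> b) \<bullet> M)"
    "Cod T (conjugation a b M (s a)) = tro (\<Theta> R (b \<otimes>\<^bsub>G\<^esub> a) \<bullet> M)"
    if "a \<in> carrier G" "b \<in> carrier G" for a b
    using that by (simp_all add: conjugation_arr[where R = R])
  have cm: "conjugation a b M (s a) \<cdot>\<^bsub>T\<^esub> tr (\<mu> R a b \<diamondop> ?I) = tr (\<mu> R b a \<diamondop> ?I) \<cdot>\<^bsub>T\<^esub> slide (\<Theta> R a) (\<Theta> R b) M (s a)"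
    if "a \<in> carrier G" "b \<in> carrier G" for a b
    using that by (simp add: conjugation_mult_cell)
  \<comment> \<open>The two ways of multiplying three letters out, as maps of traces.\<close>
  have as: "tr (\<mu> R a (b \<otimes>\<^bsub>G\<^esub> c) \<diamondop> ?I) \<cdot>\<^bsub>T\<^esub> tr (Idt V (\<Theta> R a) \<diamondop> \<mu> R b c \<diamondop> ?I) =
      tr (\<mu> R (a \<otimes>\<^bsub>G\<^esub> b) c \<diamondop> ?I) \<cdot>\<^bsub>T\<^esub> tr (\<mu> R a b \<diamondop> Idt V (\<Theta> R c) \<diamondop> ?I)"
    if [simp]: "a \<in> carrier G" "b \<in> carrier G" "c \<in> carrier G" for a b c
  proof -
    have "(\<mu> R a (b \<otimes>\<^bsub>G\<^esub> c) \<cdot> (Idt V (\<Theta> R a) \<diamondop> \<mu> R b c)) \<diamondop> (?I \<cdot> ?I) =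
      (\<mu> R (a \<otimes>\<^bsub>G\<^esub> b) c \<cdot> (\<mu> R a b \<diamondop> Idt V (\<Theta> R c))) \<diamondop> (?I \<cdot> ?I)"
      by (simp only: mult_assoc that \<open>R \<in> ob\<close>)
    then have "(\<mu> R a (b \<otimes>\<^bsub>G\<^esub> c) \<diamondop> ?I) \<cdot> (Idt V (\<Theta> R a) \<diamondop> \<mu> R b c \<diamondop> ?I) =
      (\<mu> R (a \<otimes>\<^bsub>G\<^esub> b) c \<diamondop> ?I) \<cdot> (\<mu> R a b \<diamondop> Idt V (\<Theta> R c) \<diamondop> ?I)"
      by (subst (asm) (1 2) interchange) (simp_all del: hc2_id)
    then show ?thesis by (simp flip: tr_comp del: hc2_id)
  qed
  have nX: "slide (\<Theta> R a) (\<Theta> R (b \<otimes>\<^bsub>G\<^esub> c)) M (s a) \<cdot>\<^bsub>T\<^esub> tr (Idt V (\<Theta> R a) \<diamondop> \<mu> R b c \<diamondop> ?I) =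
      tr (\<mu> R b c \<diamondop> Idt V (\<Theta> R a) \<diamondop> ?I) \<cdot>\<^bsub>T\<^esub> slide (\<Theta> R a) (\<Theta> R b \<bullet> \<Theta> R c) M (s a)"
    if [simp]: "a \<in> carrier G" "b \<in> carrier G" "c \<in> carrier G" for a b c
    by (rule slide_natural[where H = "\<Theta> R a"]) simp_all
  have nF: "slide (\<Theta> R (y \<otimes>\<^bsub>G\<^esub> z)) ?X M (s (y \<otimes>\<^bsub>G\<^esub> z)) \<cdot>\<^bsub>T\<^esub> tr (\<mu> R y z \<diamondop> Idt V ?X \<diamondop> ?I) =
      tr (Idt V ?X \<diamondop> \<mu> R y z \<diamondop> ?I) \<cdot>\<^bsub>T\<^esub>
      slide (?Y \<bullet> ?Z) ?X M ((Idt V ?Y \<diamondop> s z) \<cdot> (s y \<diamondop> Idt V ?Z))"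
    by (rule slide_natural[where H = "?Y \<bullet> ?Z"])
      (use half_braiding_mult[OF hb, of y z] in simp_all)
  have sm: "slide (?Y \<bullet> ?Z) ?X M ((Idt V ?Y \<diamondop> s z) \<cdot> (s y \<diamondop> Idt V ?Z)) =
      slide ?Z (?X \<bullet> ?Y) M (s z) \<cdot>\<^bsub>T\<^esub> slide ?Y (?Z \<bullet> ?X) M (s y)"
    by (rule slide_hc1) simp_all
  let ?e = "tr (\<mu> R y (z \<otimes>\<^bsub>G\<^esub> x) \<diamondop> ?I)" and ?e' = "tr (Idt V ?Y \<diamondop> \<mu> R z x \<diamondop> ?I)"
  let ?A = "conjugation z (x \<otimes>\<^bsub>G\<^esub> y) M (s z)" and ?B = "conjugation y (z \<otimes>\<^bsub>G\<^esub> x) M (s y)"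
    and ?C = "conjugation (y \<otimes>\<^bsub>G\<^esub> z) x M (s (y \<otimes>\<^bsub>G\<^esub> z))"
  have "(?A \<cdot>\<^bsub>T\<^esub> ?B) \<cdot>\<^bsub>T\<^esub> (?e \<cdot>\<^bsub>T\<^esub> ?e') = ?A \<cdot>\<^bsub>T\<^esub> ((?B \<cdot>\<^bsub>T\<^esub> ?e) \<cdot>\<^bsub>T\<^esub> ?e')" by simp
  also have "\<dots> = ?A \<cdot>\<^bsub>T\<^esub> (tr (\<mu> R (z \<otimes>\<^bsub>G\<^esub> x) y \<diamondop> ?I) \<cdot>\<^bsub>T\<^esub>
      (slide ?Y (\<Theta> R (z \<otimes>\<^bsub>G\<^esub> x)) M (s y) \<cdot>\<^bsub>T\<^esub> ?e'))"
    by (subst cm) simp_all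
  also have "\<dots> = ?A \<cdot>\<^bsub>T\<^esub> ((tr (\<mu> R (z \<otimes>\<^bsub>G\<^esub> x) y \<diamondop> ?I) \<cdot>\<^bsub>T\<^esub> tr (\<mu> R z x \<diamondop> Idt V ?Y \<diamondop> ?I)) \<cdot>\<^bsub>T\<^esub>
      slide ?Y (?Z \<bullet> ?X) M (s y))"
    by (subst nX) simp_all
  also have "\<dots> = (?A \<cdot>\<^bsub>T\<^esub> tr (\<mu> R z (x \<otimes>\<^bsub>G\<^esub> y) \<diamondop> ?I)) \<cdot>\<^bsub>T\<^esub> (tr (Idt V ?Z \<diamondop> \<mu> R x y \<diamondop> ?I) \<cdot>\<^bsub>T\<^esub>
      slide ?Y (?Z \<bullet> ?X) M (s y))"
    by (subst as[symmetric]) simp_all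
  also have "\<dots> = tr (\<mu> R (x \<otimes>\<^bsub>G\<^esub> y) z \<diamondop> ?I) \<cdot>\<^bsub>T\<^esub> ((slide ?Z (\<Theta> R (x \<otimes>\<^bsub>G\<^esub> y)) M (s z) \<cdot>\<^bsub>T\<^esub>
      tr (Idt V ?Z \<diamondop> \<mu> R x y \<diamondop> ?I)) \<cdot>\<^bsub>T\<^esub> slide ?Y (?Z \<bullet> ?X) M (s y))"
    by (subst cm) simp_all
  also have "\<dots> = (tr (\<mu> R (x \<otimes>\<^bsub>G\<^esub> y) z \<diamondop> ?I) \<cdot>\<^bsub>T\<^esub> tr (\<mu> R x y \<diamondop> Idt V ?Z \<diamondop> ?I)) \<cdot>\<^bsub>T\<^esub>
      (slide ?Z (?X \<bullet> ?Y) M (s z) \<cdot>\<^bsub>T\<^esub> slide ?Y (?Z \<bullet> ?X) M (s y))"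
    by (subst nX) simp_all
  also have "\<dots> = tr (\<mu> R x (y \<otimes>\<^bsub>G\<^esub> z) \<diamondop> ?I) \<cdot>\<^bsub>T\<^esub> (tr (Idt V ?X \<diamondop> \<mu> R y z \<diamondop> ?I) \<cdot>\<^bsub>T\<^esub>
      slide (?Y \<bullet> ?Z) ?X M ((Idt V ?Y \<diamondop> s z) \<cdot> (s y \<diamondop> Idt V ?Z)))"
    unfolding sm by (subst as[symmetric]) simp_all
  also have "\<dots> = (?C \<cdot>\<^bsub>T\<^esub> tr (\<mu> R (y \<otimes>\<^bsub>G\<^esub> z) x \<diamondop> ?I)) \<cdot>\<^bsub>T\<^esub> tr (\<mu> R y z \<diamondop> Idt V ?X \<diamondop> ?I)"
    unfolding nF[symmetric] by (subst cm) simp_all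
  also have "\<dots> = ?C \<cdot>\<^bsub>T\<^esub> (?e \<cdot>\<^bsub>T\<^esub> ?e')"
    by (subst as) simp_all
  finally have e: "(?A \<cdot>\<^bsub>T\<^esub> ?B) \<cdot>\<^bsub>T\<^esub> (?e \<cdot>\<^bsub>T\<^esub> ?e') = ?C \<cdot>\<^bsub>T\<^esub> (?e \<cdot>\<^bsub>T\<^esub> ?e')" .
  show ?thesis by (rule T.iso_cancel_right[OF _ e]) simp_all
qed

text \<open>
  By \<open>conjugation_mult\<close> this map is idempotent, and it is invertible; such an endomorphism is an identity.
\<close>

lemma conjugation_one:
  assumes hb: "half_braiding M s" and MR [simp]: "src M = R" "trg M = R" and [simp]: "x \<in> carrier G"
  shows "conjugation \<one>\<^bsub>G\<^esub> x M (s \<one>\<^bsub>G\<^esub>) = Idt T (tro (\<Theta> R x \<bullet> M))"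
proof -
  note [simp] = half_braidingD[OF hb]
  have [simp]: "R \<in> ob" using half_braidingD(2)[OF hb] by simp
  let ?c = "conjugation \<one>\<^bsub>G\<^esub> x M (s \<one>\<^bsub>G\<^esub>)"
  have "is_iso T ?c" by (rule conjugation_iso[where R = R]) simp_all
  moreover have "Dom T ?c = tro (\<Theta> R x \<bullet> M)" "Cod T ?c = tro (\<Theta> R x \<bullet> M)"
    by (simp_all add: conjugation_arr[where R = R])
  moreover have "?c \<cdot>\<^bsub>T\<^esub> ?c = ?c" using conjugation_mult[OF hb MR, of "\<one>\<^bsub>G\<^esub>" "\<one>\<^bsub>G\<^esub>" x] by simp
  ultimately show ?thesis using T.idempotent_iso_id[of ?c] by simp
qed

text \<open>
  \<open>slide_twisted_rot\<close>, transported along the multiplications \<open>\<mu>\<close> by naturality of both operations.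
  The half-braiding of \<open>N\<close> enters the twisted cyclicity at the products \<open>y x\<close> and \<open>x y\<close>, where its
  multiplicativity splits it into the two letters.
\<close>

lemma conjugation_twisted_rot:
  assumes hb: "half_braiding N n" and [simp]: "M \<in> Obj V" "src M = R" "trg M = S"
    and N [simp]: "src N = S" "trg N = R" and [simp]: "y \<in> carrier G" "x \<in> carrier G"
    and m [simp]: "m \<in> Arr V" "Dom V m = M \<bullet> \<Theta> S y" "Cod V m = \<Theta> R y \<bullet> M"
  shows "conjugation y x (N \<bullet> M) ((n y \<diamondop> Idt V M) \<cdot> (Idt V N \<diamondop> m)) \<cdot>\<^bsub>T\<^esub>
      twisted_rot (\<Theta> R (y \<otimes>\<^bsub>G\<^esub> x)) M N (n (y \<otimes>\<^bsub>G\<^esub> x))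
    = twisted_rot (\<Theta> R (x \<otimes>\<^bsub>G\<^esub> y)) M N (n (x \<otimes>\<^bsub>G\<^esub> y)) \<cdot>\<^bsub>T\<^esub>
      conjugation y x (M \<bullet> N) ((m \<diamondop> Idt V N) \<cdot> (Idt V M \<diamondop> n y))"
proof -
  note [simp] = half_braidingD[OF hb]
  have [simp]: "R \<in> ob" "S \<in> ob" using half_braidingD(2,3)[OF hb] by simp_all
  note [simp del] = hc2_id
  have i: "Idt V (M \<bullet> N) = Idt V M \<diamondop> Idt V N" "Idt V (N \<bullet> M) = Idt V N \<diamondop> Idt V M"
    by (simp_all add: hc2_id)
  let ?t = "\<lambda>a b. twisted_rot (\<Theta> R a \<bullet> \<Theta> R b) M N ((Idt V (\<Theta> S a) \<diamondop> n b) \<cdot> (n a \<diamondop> Idt V (\<Theta> R b)))"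
  let ?nm = "(n y \<diamondop> Idt V M) \<cdot> (Idt V N \<diamondop> m)" and ?mn = "(m \<diamondop> Idt V N) \<cdot> (Idt V M \<diamondop> n y)"
  have tr_a [simp]: "twisted_rot (\<Theta> R a) M N (n a) \<in> Arr T"
    "Dom T (twisted_rot (\<Theta> R a) M N (n a)) = tro (\<Theta> R a \<bullet> M \<bullet> N)"
    "Cod T (twisted_rot (\<Theta> R a) M N (n a)) = tro (\<Theta> S a \<bullet> N \<bullet> M)"
    if "a \<in> carrier G" for a using that by (simp_all add: twisted_rot_def)
  have t_a [simp]: "?t a b \<in> Arr T" "Dom T (?t a b) = tro (\<Theta> R a \<bullet> \<Theta> R b \<bullet> M \<bullet> N)"
    "Cod T (?t a b) = tro (\<Theta> S a \<bullet> \<Theta> S b \<bullet> N \<bullet> M)"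
    if "a \<in> carrier G" "b \<in> carrier G" for a b using that by (simp_all add: twisted_rot_def)
  have t: "twisted_rot (\<Theta> R (a \<otimes>\<^bsub>G\<^esub> b)) M N (n (a \<otimes>\<^bsub>G\<^esub> b)) \<cdot>\<^bsub>T\<^esub> tr (\<mu> R a b \<diamondop> Idt V M \<diamondop> Idt V N) =
      tr (\<mu> S a b \<diamondop> Idt V N \<diamondop> Idt V M) \<cdot>\<^bsub>T\<^esub> ?t a b"
    if "a \<in> carrier G" "b \<in> carrier G" for a b
    by (rule twisted_rot_natural[where H = "\<Theta> S a \<bullet> \<Theta> S b"])
      (use that half_braiding_mult[OF hb, of a b] in simp_all)
  have c1 [simp]: "conjugation y x (N \<bullet> M) ?nm \<in> Arr T"
    "Dom T (conjugation y x (N \<bullet> M) ?nm) = tro (\<Theta> S (y \<otimes>\<^bsub>G\<^esub> x) \<bullet> N \<bullet> M)"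
    "Cod T (conjugation y x (N \<bullet> M) ?nm) = tro (\<Theta> S (x \<otimes>\<^bsub>G\<^esub> y) \<bullet> N \<bullet> M)"
    by (simp_all add: conjugation_arr[where R = S])
  have c2 [simp]: "conjugation y x (M \<bullet> N) ?mn \<in> Arr T"
    "Dom T (conjugation y x (M \<bullet> N) ?mn) = tro (\<Theta> R (y \<otimes>\<^bsub>G\<^esub> x) \<bullet> M \<bullet> N)"
    "Cod T (conjugation y x (M \<bullet> N) ?mn) = tro (\<Theta> R (x \<otimes>\<^bsub>G\<^esub> y) \<bullet> M \<bullet> N)"
    by (simp_all add: conjugation_arr[where R = R])
  have s1 [simp]: "slide (\<Theta> S y) (\<Theta> S x) (N \<bullet> M) ?nm \<in> Arr T"
    "Dom T (slide (\<Theta> S y) (\<Theta> S x) (N \<bullet> M) ?nm) = tro (\<Theta> S y \<bullet> \<Theta> S x \<bullet> N \<bullet> M)"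
    "Cod T (slide (\<Theta> S y) (\<Theta> S x) (N \<bullet> M) ?nm) = tro (\<Theta> S x \<bullet> \<Theta> S y \<bullet> N \<bullet> M)"
    by (simp_all add: slide_arr[where F' = "\<Theta> S y"])
  have s2 [simp]: "slide (\<Theta> R y) (\<Theta> R x) (M \<bullet> N) ?mn \<in> Arr T"
    "Dom T (slide (\<Theta> R y) (\<Theta> R x) (M \<bullet> N) ?mn) = tro (\<Theta> R y \<bullet> \<Theta> R x \<bullet> M \<bullet> N)"
    "Cod T (slide (\<Theta> R y) (\<Theta> R x) (M \<bullet> N) ?mn) = tro (\<Theta> R x \<bullet> \<Theta> R y \<bullet> M \<bullet> N)"
    by (simp_all add: slide_arr[where F' = "\<Theta> R y"])
  have m1: "conjugation y x (N \<bullet> M) ?nm \<cdot>\<^bsub>T\<^esub> tr (\<mu> S y x \<diamondop> Idt V N \<diamondop> Idt V M) =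
      tr (\<mu> S x y \<diamondop> Idt V N \<diamondop> Idt V M) \<cdot>\<^bsub>T\<^esub> slide (\<Theta> S y) (\<Theta> S x) (N \<bullet> M) ?nm"
    unfolding i[symmetric] by (rule conjugation_mult_cell) simp_all
  have m2: "conjugation y x (M \<bullet> N) ?mn \<cdot>\<^bsub>T\<^esub> tr (\<mu> R y x \<diamondop> Idt V M \<diamondop> Idt V N) =
      tr (\<mu> R x y \<diamondop> Idt V M \<diamondop> Idt V N) \<cdot>\<^bsub>T\<^esub> slide (\<Theta> R y) (\<Theta> R x) (M \<bullet> N) ?mn"
    unfolding i[symmetric] by (rule conjugation_mult_cell) simp_all
  have core: "slide (\<Theta> S y) (\<Theta> S x) (N \<bullet> M) ?nm \<cdot>\<^bsub>T\<^esub> ?t y x =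
      ?t x y \<cdot>\<^bsub>T\<^esub> slide (\<Theta> R y) (\<Theta> R x) (M \<bullet> N) ?mn"
    by (rule slide_twisted_rot) simp_all
  let ?e = "tr (\<mu> R y x \<diamondop> Idt V M \<diamondop> Idt V N)"
  let ?A = "conjugation y x (N \<bullet> M) ?nm" and ?B = "twisted_rot (\<Theta> R (y \<otimes>\<^bsub>G\<^esub> x)) M N (n (y \<otimes>\<^bsub>G\<^esub> x))"
    and ?C = "twisted_rot (\<Theta> R (x \<otimes>\<^bsub>G\<^esub> y)) M N (n (x \<otimes>\<^bsub>G\<^esub> y))" and ?D = "conjugation y x (M \<bullet> N) ?mn"
  have "(?A \<cdot>\<^bsub>T\<^esub> ?B) \<cdot>\<^bsub>T\<^esub> ?e = ?A \<cdot>\<^bsub>T\<^esub> (?B \<cdot>\<^bsub>T\<^esub> ?e)"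
    by (rule T.comp_assoc_arr) simp_all
  also have "\<dots> = (?A \<cdot>\<^bsub>T\<^esub> tr (\<mu> S y x \<diamondop> Idt V N \<diamondop> Idt V M)) \<cdot>\<^bsub>T\<^esub> ?t y x"
    by (subst t) (simp_all del: V.comp_assoc_arr)
  also have "\<dots> = tr (\<mu> S x y \<diamondop> Idt V N \<diamondop> Idt V M) \<cdot>\<^bsub>T\<^esub>
      (slide (\<Theta> S y) (\<Theta> S x) (N \<bullet> M) ?nm \<cdot>\<^bsub>T\<^esub> ?t y x)"
    unfolding m1 by (rule T.comp_assoc_arr) simp_all
  also have "\<dots> = (tr (\<mu> S x y \<diamondop> Idt V N \<diamondop> Idt V M) \<cdot>\<^bsub>T\<^esub> ?t x y) \<cdot>\<^bsub>T\<^esub>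
      slide (\<Theta> R y) (\<Theta> R x) (M \<bullet> N) ?mn"
    unfolding core by (rule T.comp_assoc_arr[symmetric]) simp_all
  also have "\<dots> = ?C \<cdot>\<^bsub>T\<^esub> (?D \<cdot>\<^bsub>T\<^esub> ?e)"
    unfolding m2 by (subst t[symmetric]) (simp_all del: V.comp_assoc_arr)
  also have "\<dots> = (?C \<cdot>\<^bsub>T\<^esub> ?D) \<cdot>\<^bsub>T\<^esub> ?e"
    by (rule T.comp_assoc_arr[symmetric]) simp_all
  finally have e: "(?A \<cdot>\<^bsub>T\<^esub> ?B) \<cdot>\<^bsub>T\<^esub> ?e = (?C \<cdot>\<^bsub>T\<^esub> ?D) \<cdot>\<^bsub>T\<^esub> ?e" .
  show ?thesis by (rule T.iso_cancel_right[OF _ e]) simp_all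
qed

end

section \<open>Cells of a bicategory\<close>

lemma product_cat_sel [simp]:
  "Obj (product_cat C D) = Obj C \<times> Obj D" "Arr (product_cat C D) = Arr C \<times> Arr D"
  "Dom (product_cat C D) (f, g) = (Dom C f, Dom D g)"
  "Cod (product_cat C D) (f, g) = (Cod C f, Cod D g)"
  "Idt (product_cat C D) (x, y) = (Idt C x, Idt D y)"
  "Comp (product_cat C D) (f', g') (f, g) = (f' \<cdot>\<^bsub>C\<^esub> f, g' \<cdot>\<^bsub>D\<^esub> g)"
  by (simp_all add: product_cat_def)

lemma hom_cat_sel [simp]:
  "Obj (hom_cat B R S) = cells1 B R S"
  "f \<in> Arr (hom_cat B R S) \<longleftrightarrow> f \<in> Arr B \<and> Dom B f \<in> cells1 B R S \<and> Cod B f \<in> cells1 B R S"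
  "Dom (hom_cat B R S) = Dom B" "Cod (hom_cat B R S) = Cod B" "Idt (hom_cat B R S) = Idt B"
  "Comp (hom_cat B R S) = Comp B"
  by (simp_all add: hom_cat_def)

lemma is_iso_hom_cat: "is_iso (hom_cat B R S) f \<Longrightarrow> is_iso B f"
  by (auto simp: is_iso_def inverse_arrows_def cat_hom_def)

context bicategory
begin

lemmas [simp] = dom_in_Obj cod_in_Obj src_in_Cell0 trg_in_Cell0 parallel_src parallel_trg

lemma hcomp1 [simp]:
  assumes "M \<in> Obj B" "N \<in> Obj B" "Trg B M = Src B N"
  shows "M \<odot> N \<in> Obj B" "Src B (M \<odot> N) = Src B M" "Trg B (M \<odot> N) = Trg B N"
proof -
  interpret is_functor "product_cat (hom_cat B (Src B M) (Trg B M)) (hom_cat B (Trg B M) (Trg B N))"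
    "hom_cat B (Src B M) (Trg B N)" "\<lparr>ObMap = \<lambda>(M, N). M \<odot> N, ArMap = \<lambda>(f, g). f \<star> g\<rparr>"
    using assms by (intro hcomp_functor) auto
  show "M \<odot> N \<in> Obj B" "Src B (M \<odot> N) = Src B M" "Trg B (M \<odot> N) = Trg B N"
    using map_Obj[of "(M, N)"] assms by (auto simp: cells1_def)
qed

lemma hcomp2 [simp]:
  assumes "f \<in> Arr B" "g \<in> Arr B" "Trg B (Dom B f) = Src B (Dom B g)"
  shows "f \<star> g \<in> Arr B" "Dom B (f \<star> g) = Dom B f \<odot> Dom B g" "Cod B (f \<star> g) = Cod B f \<odot> Cod B g"
proof -
  let ?M = "Dom B f" and ?N = "Dom B g"
  interpret is_functor "product_cat (hom_cat B (Src B ?M) (Trg B ?M)) (hom_cat B (Trg B ?M) (Trg B ?N))"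
    "hom_cat B (Src B ?M) (Trg B ?N)" "\<lparr>ObMap = \<lambda>(M, N). M \<odot> N, ArMap = \<lambda>(f, g). f \<star> g\<rparr>"
    using assms by (intro hcomp_functor) auto
  show "f \<star> g \<in> Arr B" "Dom B (f \<star> g) = Dom B f \<odot> Dom B g" "Cod B (f \<star> g) = Cod B f \<odot> Cod B g"
    using map_hom[of "(f, g)" "(?M, ?N)" "(Cod B f, Cod B g)"] assms
    by (simp_all add: cat_hom_def cells1_def)
qed

lemma hcomp_id [simp]:
  assumes "M \<in> Obj B" "N \<in> Obj B" "Trg B M = Src B N"
  shows "Idt B M \<star> Idt B N = Idt B (M \<odot> N)"
proof -
  interpret is_functor "product_cat (hom_cat B (Src B M) (Trg B M)) (hom_cat B (Trg B M) (Trg B N))"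
    "hom_cat B (Src B M) (Trg B N)" "\<lparr>ObMap = \<lambda>(M, N). M \<odot> N, ArMap = \<lambda>(f, g). f \<star> g\<rparr>"
    using assms by (intro hcomp_functor) auto
  show ?thesis using map_id[of "(M, N)"] assms by (auto simp: cells1_def)
qed

lemma hcomp_interchange:
  assumes "f \<in> Arr B" "f' \<in> Arr B" "g \<in> Arr B" "g' \<in> Arr B"
    and "Cod B f = Dom B f'" "Cod B g = Dom B g'" "Trg B (Dom B f) = Src B (Dom B g)"
  shows "(f' \<cdot> f) \<star> (g' \<cdot> g) = (f' \<star> g') \<cdot> (f \<star> g)"
proof -
  let ?M = "Dom B f" and ?N = "Dom B g"
  interpret is_functor "product_cat (hom_cat B (Src B ?M) (Trg B ?M)) (hom_cat B (Trg B ?M) (Trg B ?N))"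
    "hom_cat B (Src B ?M) (Trg B ?N)" "\<lparr>ObMap = \<lambda>(M, N). M \<odot> N, ArMap = \<lambda>(f, g). f \<star> g\<rparr>"
    using assms by (intro hcomp_functor) auto
  have "Src B (Dom B f') = Src B ?M" "Trg B (Dom B f') = Trg B ?M"
    "Src B (Dom B g') = Src B ?N" "Trg B (Dom B g') = Trg B ?N"
    using assms parallel_src parallel_trg by metis+
  then show ?thesis
    using map_comp[of "(f, g)" "(?M, ?N)" "(Cod B f, Cod B g)" "(f', g')" "(Cod B f', Cod B g')"] assms
    by (simp add: cat_hom_def cells1_def)
qed

lemma hcomp_iso [simp]:
  assumes "is_iso B f" "is_iso B g" "Trg B (Dom B f) = Src B (Dom B g)"
  shows "is_iso B (f \<star> g)"
proof (rule is_isoI[where g = "cat_inv B f \<star> cat_inv B g"])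
  note [simp] = iso_arr[OF assms(1)] iso_arr[OF assms(2)]
  show "f \<star> g \<in> Arr B" "cat_inv B f \<star> cat_inv B g \<in> Arr B"
    "Dom B (cat_inv B f \<star> cat_inv B g) = Cod B (f \<star> g)"
    "Cod B (cat_inv B f \<star> cat_inv B g) = Dom B (f \<star> g)"
    "(cat_inv B f \<star> cat_inv B g) \<cdot> (f \<star> g) = Idt B (Dom B (f \<star> g))"
    "(f \<star> g) \<cdot> (cat_inv B f \<star> cat_inv B g) = Idt B (Cod B (f \<star> g))"
    using assms by (simp_all flip: hcomp_interchange)
qed

lemma hcomp_cat_inv:
  assumes "is_iso B f" "is_iso B g" "Trg B (Dom B f) = Src B (Dom B g)"
  shows "cat_inv B (f \<star> g) = cat_inv B f \<star> cat_inv B g"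
proof (rule cat_inv_unique)
  note [simp] = iso_arr[OF assms(1)] iso_arr[OF assms(2)]
  show "f \<star> g \<in> Arr B" "cat_inv B f \<star> cat_inv B g \<in> Arr B"
    "Dom B (cat_inv B f \<star> cat_inv B g) = Cod B (f \<star> g)"
    "Cod B (cat_inv B f \<star> cat_inv B g) = Dom B (f \<star> g)"
    "(cat_inv B f \<star> cat_inv B g) \<cdot> (f \<star> g) = Idt B (Dom B (f \<star> g))"
    "(f \<star> g) \<cdot> (cat_inv B f \<star> cat_inv B g) = Idt B (Cod B (f \<star> g))"
    using assms by (simp_all flip: hcomp_interchange)
qed

lemma Assoc_arr [simp]:
  assumes "M \<in> Obj B" "N \<in> Obj B" "K \<in> Obj B" "Trg B M = Src B N" "Trg B N = Src B K"
  shows "Assoc B M N K \<in> Arr B" "Dom B (Assoc B M N K) = (M \<odot> N) \<odot> K"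
    "Cod B (Assoc B M N K) = M \<odot> (N \<odot> K)" "is_iso B (Assoc B M N K)"
proof -
  interpret natural_isomorphism "product_cat (product_cat (hom_cat B (Src B M) (Trg B M))
      (hom_cat B (Trg B M) (Trg B N))) (hom_cat B (Trg B N) (Trg B K))"
    "hom_cat B (Src B M) (Trg B K)"
    "\<lparr>ObMap = \<lambda>((M, N), K). (M \<odot> N) \<odot> K, ArMap = \<lambda>((f, g), k). (f \<star> g) \<star> k\<rparr>"
    "\<lparr>ObMap = \<lambda>((M, N), K). M \<odot> (N \<odot> K), ArMap = \<lambda>((f, g), k). f \<star> (g \<star> k)\<rparr>"
    "(\<lambda>((M, N), K). Assoc B M N K)"
    using assms by (intro assoc_natural) auto
  show "Assoc B M N K \<in> Arr B" "Dom B (Assoc B M N K) = (M \<odot> N) \<odot> K"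
    "Cod B (Assoc B M N K) = M \<odot> (N \<odot> K)" "is_iso B (Assoc B M N K)"
    using component_in_hom[of "((M, N), K)"] component_iso[of "((M, N), K)"] assms
    by (auto simp: cells1_def cat_hom_def dest: is_iso_hom_cat)
qed

lemma Assoc_natural:
  assumes "f \<in> Arr B" "g \<in> Arr B" "k \<in> Arr B"
    and "Trg B (Dom B f) = Src B (Dom B g)" "Trg B (Dom B g) = Src B (Dom B k)"
  shows "Assoc B (Cod B f) (Cod B g) (Cod B k) \<cdot> ((f \<star> g) \<star> k) =
    (f \<star> (g \<star> k)) \<cdot> Assoc B (Dom B f) (Dom B g) (Dom B k)"
proof -
  let ?M = "Dom B f" and ?N = "Dom B g" and ?K = "Dom B k"
  interpret natural_isomorphism "product_cat (product_cat (hom_cat B (Src B ?M) (Trg B ?M))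
      (hom_cat B (Trg B ?M) (Trg B ?N))) (hom_cat B (Trg B ?N) (Trg B ?K))"
    "hom_cat B (Src B ?M) (Trg B ?K)"
    "\<lparr>ObMap = \<lambda>((M, N), K). (M \<odot> N) \<odot> K, ArMap = \<lambda>((f, g), k). (f \<star> g) \<star> k\<rparr>"
    "\<lparr>ObMap = \<lambda>((M, N), K). M \<odot> (N \<odot> K), ArMap = \<lambda>((f, g), k). f \<star> (g \<star> k)\<rparr>"
    "(\<lambda>((M, N), K). Assoc B M N K)"
    using assms by (intro assoc_natural) auto
  show ?thesis
    using naturality[of "((f, g), k)" "((?M, ?N), ?K)" "((Cod B f, Cod B g), Cod B k)"] assms
    by (simp add: cells1_def cat_hom_def)
qed

lemma pentagon_arr:
  assumes "K \<in> Obj B" "L \<in> Obj B" "M \<in> Obj B" "N \<in> Obj B"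
    and "Trg B K = Src B L" "Trg B L = Src B M" "Trg B M = Src B N"
  shows "Assoc B K L (M \<odot> N) \<cdot> Assoc B (K \<odot> L) M N =
      (Idt B K \<star> Assoc B L M N) \<cdot> Assoc B K (L \<odot> M) N \<cdot> (Assoc B K L M \<star> Idt B N)"
  using assms by (intro pentagon[of _ "Src B K" "Trg B K" _ "Trg B L" _ "Trg B M" _ "Trg B N"])
    (simp_all add: cells1_def)

end

section \<open>Strictification by words of 1-cells\<close>

text \<open>
  Words are nonempty since the empty word would have to stand for a unit 1-cell at an unspecified
  0-cell.
\<close>

definition words :: "('o, 'm, 'c, 'z) bicat_scheme \<Rightarrow> 'm list set" where
  "words B = {xs. xs \<noteq> [] \<and> set xs \<subseteq> Obj B \<and> successively (\<lambda>M N. Trg B M = Src B N) xs}"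

definition word_src :: "('o, 'm, 'c, 'z) bicat_scheme \<Rightarrow> 'm list \<Rightarrow> 'o" where
  "word_src B xs = Src B (hd xs)"

definition word_trg :: "('o, 'm, 'c, 'z) bicat_scheme \<Rightarrow> 'm list \<Rightarrow> 'o" where
  "word_trg B xs = Trg B (last xs)"

text \<open>
  Right-bracketed composites without a trailing unit, so that the composite of a one-letter word is
  the letter itself, and \<open>\<Theta> \<odot> (M \<odot> N)\<close> is the composite of \<open>[\<Theta>, M, N]\<close> as well as of \<open>[\<Theta>, M \<odot> N]\<close>.
\<close>

fun word_comp :: "('o, 'm, 'c, 'z) bicat_scheme \<Rightarrow> 'm list \<Rightarrow> 'm" where
  "word_comp B [M] = M"
| "word_comp B (M # N # xs) = M \<odot>\<^bsub>B\<^esub> word_comp B (N # xs)"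
| "word_comp B [] = undefined"

text \<open>
  The canonical rebracketing from \<open>word_comp B xs \<odot> word_comp B ys\<close> to \<open>word_comp B (xs @ ys)\<close>. It is an
  identity when \<open>xs\<close> has one letter.
\<close>

fun word_splice :: "('o, 'm, 'c, 'z) bicat_scheme \<Rightarrow> 'm list \<Rightarrow> 'm list \<Rightarrow> 'c" where
  "word_splice B [M] ys = Idt B (M \<odot>\<^bsub>B\<^esub> word_comp B ys)"
| "word_splice B (M # N # xs) ys = (Idt B M \<star>\<^bsub>B\<^esub> word_splice B (N # xs) ys) \<cdot>\<^bsub>B\<^esub>
     Assoc B M (word_comp B (N # xs)) (word_comp B ys)"
| "word_splice B [] ys = undefined"

text \<open>
  Arrows record their end words, as the composite of a word does not determine the word.
\<close>

definition word_cat :: "('o, 'm, 'c, 'z) bicat_scheme \<Rightarrow> ('m list, 'm list \<times> 'c \<times> 'm list) cat" where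
  "word_cat B = \<lparr>
     Obj = words B,
     Arr = {(xs, f, ys). xs \<in> words B \<and> ys \<in> words B \<and> f \<in> cat_hom B (word_comp B xs) (word_comp B ys)},
     Dom = (\<lambda>(xs, f, ys). xs),
     Cod = (\<lambda>(xs, f, ys). ys),
     Idt = (\<lambda>xs. (xs, Idt B (word_comp B xs), xs)),
     Comp = (\<lambda>(ys, g, zs) (xs, f, ys'). (xs, g \<cdot>\<^bsub>B\<^esub> f, zs))\<rparr>"

fun word_hcomp :: "('o, 'm, 'c, 'z) bicat_scheme \<Rightarrow> 'm list \<times> 'c \<times> 'm list \<Rightarrow>
    'm list \<times> 'c \<times> 'm list \<Rightarrow> 'm list \<times> 'c \<times> 'm list" where
  "word_hcomp B (xs, f, xs') (ys, g, ys') =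
     (xs @ ys, word_splice B xs' ys' \<cdot>\<^bsub>B\<^esub> (f \<star>\<^bsub>B\<^esub> g) \<cdot>\<^bsub>B\<^esub> cat_inv B (word_splice B xs ys), xs' @ ys')"

lemma word_cat_sel [simp]:
  "Obj (word_cat B) = words B"
  "(xs, f, ys) \<in> Arr (word_cat B) \<longleftrightarrow> xs \<in> words B \<and> ys \<in> words B \<and>
     f \<in> Arr B \<and> Dom B f = word_comp B xs \<and> Cod B f = word_comp B ys"
  "Dom (word_cat B) (xs, f, ys) = xs" "Cod (word_cat B) (xs, f, ys) = ys"
  "Idt (word_cat B) xs = (xs, Idt B (word_comp B xs), xs)"
  "Comp (word_cat B) (ys, g, zs) (xs, f, ys') = (xs, g \<cdot>\<^bsub>B\<^esub> f, zs)"
  by (auto simp: word_cat_def cat_hom_def)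

lemma words_single [simp]: "[M] \<in> words B \<longleftrightarrow> M \<in> Obj B"
  by (simp add: words_def)

lemma words_Cons:
  "xs \<noteq> [] \<Longrightarrow> M # xs \<in> words B \<longleftrightarrow> M \<in> Obj B \<and> xs \<in> words B \<and> Trg B M = word_src B xs"
  by (cases xs) (auto simp: words_def word_src_def)

lemma words_Cons2 [simp]:
  "M # N # xs \<in> words B \<longleftrightarrow> M \<in> Obj B \<and> N # xs \<in> words B \<and> Trg B M = Src B N"
  by (auto simp: words_def)

lemma words_nonempty: "xs \<in> words B \<Longrightarrow> xs \<noteq> []"
  by (simp add: words_def)

lemma words_append [simp]:
  "\<lbrakk>xs \<in> words B; ys \<in> words B; word_trg B xs = word_src B ys\<rbrakk> \<Longrightarrow> xs @ ys \<in> words B"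
  by (auto simp: words_def successively_append_iff word_src_def word_trg_def)

lemma word_src_append [simp]: "xs \<in> words B \<Longrightarrow> word_src B (xs @ ys) = word_src B xs"
  by (auto simp: words_def word_src_def)

lemma word_trg_append [simp]: "ys \<in> words B \<Longrightarrow> word_trg B (xs @ ys) = word_trg B ys"
  by (auto simp: words_def word_trg_def)

lemma word_src_Cons [simp]: "word_src B (M # xs) = Src B M"
  by (simp add: word_src_def)

lemma word_trg_single [simp]: "word_trg B [M] = Trg B M"
  by (simp add: word_trg_def)

lemma word_trg_Cons [simp]: "word_trg B (M # N # xs) = word_trg B (N # xs)"
  by (simp add: word_trg_def)

lemma word_comp_Cons: "xs \<noteq> [] \<Longrightarrow> word_comp B (M # xs) = M \<odot>\<^bsub>B\<^esub> word_comp B xs"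
  by (cases xs) simp_all

lemma splice_Cons: "xs \<noteq> [] \<Longrightarrow> word_splice B (M # xs) ys = (Idt B M \<star>\<^bsub>B\<^esub> word_splice B xs ys) \<cdot>\<^bsub>B\<^esub>
    Assoc B M (word_comp B xs) (word_comp B ys)"
  by (cases xs) simp_all

context bicategory
begin

lemma word_comp_cell [simp]:
  assumes "xs \<in> words B"
  shows "word_comp B xs \<in> Obj B" "Src B (word_comp B xs) = word_src B xs"
    "Trg B (word_comp B xs) = word_trg B xs"
proof -
  have "word_comp B xs \<in> Obj B \<and> Src B (word_comp B xs) = word_src B xs \<and>
    Trg B (word_comp B xs) = word_trg B xs"
    using words_nonempty[OF assms] assms
    by (induction xs rule: list_nonempty_induct) (auto simp: words_Cons word_comp_Cons word_trg_def)
  then show "word_comp B xs \<in> Obj B" "Src B (word_comp B xs) = word_src B xs"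
    "Trg B (word_comp B xs) = word_trg B xs" by simp_all
qed

lemma splice_arr_iso:
  assumes "xs \<in> words B" "ys \<in> words B" "word_trg B xs = word_src B ys"
  shows "is_iso B (word_splice B xs ys) \<and> Dom B (word_splice B xs ys) = word_comp B xs \<odot> word_comp B ys \<and>
    Cod B (word_splice B xs ys) = word_comp B (xs @ ys)"
  using words_nonempty[OF assms(1)] assms(1,3)
proof (induction xs rule: list_nonempty_induct)
  case (single M)
  then show ?case using assms(2) words_nonempty[OF assms(2)] by (simp add: word_comp_Cons)
next
  case (cons M xs)
  then have xs: "xs \<in> words B" "M \<in> Obj B" "Trg B M = word_src B xs" "word_trg B xs = word_src B ys"
    by (auto simp: words_Cons word_trg_def)
  with cons have "is_iso B (word_splice B xs ys)" "Dom B (word_splice B xs ys) = word_comp B xs \<odot> word_comp B ys"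
    "Cod B (word_splice B xs ys) = word_comp B (xs @ ys)" by auto
  with xs assms(2) show ?case
    using iso_arr[OF \<open>is_iso B (word_splice B xs ys)\<close>] cons.hyps
    by (simp add: splice_Cons word_comp_Cons)
qed

lemma splice_arr [simp]:
  assumes "xs \<in> words B" "ys \<in> words B" "word_trg B xs = word_src B ys"
  shows "is_iso B (word_splice B xs ys)" "word_splice B xs ys \<in> Arr B"
    "Dom B (word_splice B xs ys) = word_comp B xs \<odot> word_comp B ys"
    "Cod B (word_splice B xs ys) = word_comp B (xs @ ys)"
  using splice_arr_iso[OF assms] iso_arr by auto

text \<open>
  Coherence of the rebracketings, by induction on the first word; the induction step is the pentagon.
\<close>

lemma splice_assoc:
  assumes "xs \<in> words B" "ys \<in> words B" "zs \<in> words B"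
    and "word_trg B xs = word_src B ys" "word_trg B ys = word_src B zs"
  shows "word_splice B (xs @ ys) zs \<cdot> (word_splice B xs ys \<star> Idt B (word_comp B zs)) =
    word_splice B xs (ys @ zs) \<cdot> (Idt B (word_comp B xs) \<star> word_splice B ys zs) \<cdot>
      Assoc B (word_comp B xs) (word_comp B ys) (word_comp B zs)"
  using words_nonempty[OF assms(1)] assms(1,4)
proof (induction xs rule: list_nonempty_induct)
  case (single M)
  then show ?case using assms words_nonempty[OF assms(2)]
    by (simp add: splice_Cons word_comp_Cons)
next
  case (cons M xs)
  then have [simp]: "xs \<in> words B" "M \<in> Obj B" "Trg B M = word_src B xs" "word_trg B xs = word_src B ys"
    and ne: "xs \<noteq> []"
    by (auto simp: words_Cons word_trg_def)
  note [simp] = assms(2,3,5)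
  let ?X = "word_comp B xs" and ?Y = "word_comp B ys" and ?Z = "word_comp B zs"
  let ?m = "Idt B M" and ?z = "Idt B ?Z"
  have IH: "word_splice B (xs @ ys) zs \<cdot> (word_splice B xs ys \<star> ?z) =
      word_splice B xs (ys @ zs) \<cdot> (Idt B ?X \<star> word_splice B ys zs) \<cdot> Assoc B ?X ?Y ?Z"
    using cons.IH by simp
  have n1: "Assoc B M (word_comp B (xs @ ys)) ?Z \<cdot> ((?m \<star> word_splice B xs ys) \<star> ?z) =
      (?m \<star> (word_splice B xs ys \<star> ?z)) \<cdot> Assoc B M (?X \<odot> ?Y) ?Z"
    using Assoc_natural[of ?m "word_splice B xs ys" ?z] by simp
  have n2: "Assoc B M ?X (word_comp B (ys @ zs)) \<cdot> (Idt B (M \<odot> ?X) \<star> word_splice B ys zs) =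
      (?m \<star> (Idt B ?X \<star> word_splice B ys zs)) \<cdot> Assoc B M ?X (?Y \<odot> ?Z)"
    using Assoc_natural[of ?m "Idt B ?X" "word_splice B ys zs"] by simp
  have w: "?m \<star> (f \<cdot> g) = (?m \<star> f) \<cdot> (?m \<star> g)"
    if "f \<in> Arr B" "g \<in> Arr B" "Cod B g = Dom B f" "Src B (Dom B g) = Trg B M" for f g
    using hcomp_interchange[of ?m ?m g f] that by simp
  have "word_splice B ((M # xs) @ ys) zs \<cdot> (word_splice B (M # xs) ys \<star> ?z) =
      (?m \<star> word_splice B (xs @ ys) zs) \<cdot> ((Assoc B M (word_comp B (xs @ ys)) ?Z \<cdot>
        ((?m \<star> word_splice B xs ys) \<star> ?z)) \<cdot> (Assoc B M ?X ?Y \<star> ?z))"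
    using hcomp_interchange[of "Assoc B M ?X ?Y" "?m \<star> word_splice B xs ys" ?z ?z] ne
    by (simp add: splice_Cons word_comp_Cons)
  also have "\<dots> = ((?m \<star> word_splice B (xs @ ys) zs) \<cdot> (?m \<star> (word_splice B xs ys \<star> ?z))) \<cdot>
      (Assoc B M (?X \<odot> ?Y) ?Z \<cdot> (Assoc B M ?X ?Y \<star> ?z))"
    unfolding n1 by simp
  also have "(?m \<star> word_splice B (xs @ ys) zs) \<cdot> (?m \<star> (word_splice B xs ys \<star> ?z)) =
      ?m \<star> (word_splice B xs (ys @ zs) \<cdot> (Idt B ?X \<star> word_splice B ys zs) \<cdot> Assoc B ?X ?Y ?Z)"
    unfolding IH[symmetric] by (rule w[symmetric]) simp_all
  also have "\<dots> = (?m \<star> word_splice B xs (ys @ zs)) \<cdot> (?m \<star> (Idt B ?X \<star> word_splice B ys zs)) \<cdot>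
      (?m \<star> Assoc B ?X ?Y ?Z)"
    by (simp add: w)
  also have "\<dots> \<cdot> (Assoc B M (?X \<odot> ?Y) ?Z \<cdot> (Assoc B M ?X ?Y \<star> ?z)) =
      (?m \<star> word_splice B xs (ys @ zs)) \<cdot> (?m \<star> (Idt B ?X \<star> word_splice B ys zs)) \<cdot>
      ((?m \<star> Assoc B ?X ?Y ?Z) \<cdot> Assoc B M (?X \<odot> ?Y) ?Z \<cdot> (Assoc B M ?X ?Y \<star> ?z))"
    by simp
  also have "\<dots> = (?m \<star> word_splice B xs (ys @ zs)) \<cdot> ((?m \<star> (Idt B ?X \<star> word_splice B ys zs)) \<cdot>
      Assoc B M ?X (?Y \<odot> ?Z)) \<cdot> Assoc B (M \<odot> ?X) ?Y ?Z"
    using pentagon_arr[of M ?X ?Y ?Z] by simp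
  also have "\<dots> = word_splice B (M # xs) (ys @ zs) \<cdot> (Idt B (word_comp B (M # xs)) \<star> word_splice B ys zs) \<cdot>
      Assoc B (word_comp B (M # xs)) ?Y ?Z"
    unfolding n2[symmetric] using ne by (simp add: splice_Cons word_comp_Cons)
  finally show ?case .
qed

lemma word_category: "category (word_cat B)"
  by unfold_locales (auto simp: cat_hom_def word_cat_def)

lemma word_hcomp_hom:
  assumes "f \<in> Arr (word_cat B)" "g \<in> Arr (word_cat B)"
    and "word_trg B (Dom (word_cat B) f) = word_src B (Dom (word_cat B) g)"
  shows "word_hcomp B f g \<in> cat_hom (word_cat B) (Dom (word_cat B) f @ Dom (word_cat B) g)
    (Cod (word_cat B) f @ Cod (word_cat B) g)"
proof -
  obtain xs a xs' ys b ys' where fg: "f = (xs, a, xs')" "g = (ys, b, ys')"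
    by (metis prod_cases3)
  then have [simp]: "xs \<in> words B" "xs' \<in> words B" "ys \<in> words B" "ys' \<in> words B" "a \<in> Arr B" "b \<in> Arr B"
    "Dom B a = word_comp B xs" "Cod B a = word_comp B xs'" "Dom B b = word_comp B ys"
    "Cod B b = word_comp B ys'" "word_trg B xs = word_src B ys"
    using assms by auto
  have [simp]: "word_trg B xs' = word_src B ys'"
    using parallel_trg[of a] parallel_src[of b] by simp
  show ?thesis by (simp add: fg cat_hom_def)
qed

lemma word_parallel:
  assumes "f \<in> Arr (word_cat B)"
  shows "word_src B (Cod (word_cat B) f) = word_src B (Dom (word_cat B) f)"
    and "word_trg B (Cod (word_cat B) f) = word_trg B (Dom (word_cat B) f)"
proof -
  obtain xs a ys where f: "f = (xs, a, ys)" by (metis prod_cases3)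
  with assms parallel_src[of a] parallel_trg[of a]
  show "word_src B (Cod (word_cat B) f) = word_src B (Dom (word_cat B) f)"
    "word_trg B (Cod (word_cat B) f) = word_trg B (Dom (word_cat B) f)" by auto
qed

lemma word_hcomp_interchange:
  assumes "f \<in> Arr (word_cat B)" "f' \<in> Arr (word_cat B)" "g \<in> Arr (word_cat B)" "g' \<in> Arr (word_cat B)"
    and "Cod (word_cat B) f = Dom (word_cat B) f'" "Cod (word_cat B) g = Dom (word_cat B) g'"
    and "word_trg B (Dom (word_cat B) f) = word_src B (Dom (word_cat B) g)"
  shows "word_hcomp B (f' \<cdot>\<^bsub>word_cat B\<^esub> f) (g' \<cdot>\<^bsub>word_cat B\<^esub> g) =
    word_hcomp B f' g' \<cdot>\<^bsub>word_cat B\<^esub> word_hcomp B f g"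
proof -
  obtain xs a xs' xs'' a' ys b ys' ys'' b' where e: "f = (xs, a, xs')" "f' = (xs', a', xs'')"
    "g = (ys, b, ys')" "g' = (ys', b', ys'')"
    using assms(5,6) by (cases f, cases f', cases g, cases g') auto
  have [simp]: "xs \<in> words B" "xs' \<in> words B" "xs'' \<in> words B" "ys \<in> words B" "ys' \<in> words B" "ys'' \<in> words B"
    "a \<in> Arr B" "b \<in> Arr B" "a' \<in> Arr B" "b' \<in> Arr B" "word_trg B xs = word_src B ys"
    "Dom B a = word_comp B xs" "Cod B a = word_comp B xs'" "Dom B b = word_comp B ys"
    "Cod B b = word_comp B ys'" "Dom B a' = word_comp B xs'" "Cod B a' = word_comp B xs''"
    "Dom B b' = word_comp B ys'" "Cod B b' = word_comp B ys''"
    using assms e by auto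
  have [simp]: "word_trg B xs' = word_src B ys'" "word_trg B xs'' = word_src B ys''"
    using parallel_trg[of a] parallel_src[of b] parallel_trg[of a'] parallel_src[of b'] by simp_all
  show ?thesis by (simp add: e hcomp_interchange)
qed

text \<open>
  The defining property of juxtaposition, free of inverses.
\<close>

lemma word_hcomp_splice:
  assumes "(xs, a, xs') \<in> Arr (word_cat B)" "(ys, b, ys') \<in> Arr (word_cat B)"
    and "word_trg B xs = word_src B ys"
  shows "fst (snd (word_hcomp B (xs, a, xs') (ys, b, ys'))) \<cdot> word_splice B xs ys = word_splice B xs' ys' \<cdot> (a \<star> b)"
proof -
  have "word_trg B xs' = word_src B ys'"
    using word_parallel[OF assms(1)] word_parallel[OF assms(2)] assms(3) by simp
  then show ?thesis using assms by simp
qed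

text \<open>
  Both bracketings, precomposed with the invertible rebracketing of \<open>splice_assoc\<close>, equal the same
  composite built from \<open>a \<star> (b \<star> c)\<close>, by naturality of the associator.
\<close>

lemma word_hcomp_assoc:
  assumes "f \<in> Arr (word_cat B)" "g \<in> Arr (word_cat B)" "h \<in> Arr (word_cat B)"
    and "word_trg B (Dom (word_cat B) f) = word_src B (Dom (word_cat B) g)"
    and "word_trg B (Dom (word_cat B) g) = word_src B (Dom (word_cat B) h)"
  shows "word_hcomp B (word_hcomp B f g) h = word_hcomp B f (word_hcomp B g h)"
proof -
  obtain xs a xs' ys b ys' zs c zs' where e: "f = (xs, a, xs')" "g = (ys, b, ys')" "h = (zs, c, zs')"
    by (metis prod_cases3)
  have ar: "(xs, a, xs') \<in> Arr (word_cat B)" "(ys, b, ys') \<in> Arr (word_cat B)" "(zs, c, zs') \<in> Arr (word_cat B)"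
    and t: "word_trg B xs = word_src B ys" "word_trg B ys = word_src B zs"
    using assms e by auto
  note [simp] = t
  have [simp]: "xs \<in> words B" "xs' \<in> words B" "zs' \<in> words B" "ys \<in> words B" "ys' \<in> words B" "zs \<in> words B"
    "a \<in> Arr B" "b \<in> Arr B" "c \<in> Arr B"
    "Dom B a = word_comp B xs" "Cod B a = word_comp B xs'" "Dom B b = word_comp B ys"
    "Cod B b = word_comp B ys'" "Dom B c = word_comp B zs" "Cod B c = word_comp B zs'"
    using ar by auto
  have [simp]: "word_trg B xs' = word_src B ys'" "word_trg B ys' = word_src B zs'"
    using word_parallel[OF ar(1)] word_parallel[OF ar(2)] word_parallel[OF ar(3)] t by auto
  obtain k where k: "word_hcomp B (xs, a, xs') (ys, b, ys') = (xs @ ys, k, xs' @ ys')" by simp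
  obtain l where l: "word_hcomp B (ys, b, ys') (zs, c, zs') = (ys @ zs, l, ys' @ zs')" by simp
  obtain p where p: "word_hcomp B (xs @ ys, k, xs' @ ys') (zs, c, zs') = (xs @ ys @ zs, p, xs' @ ys' @ zs')"
    by simp
  obtain q where q: "word_hcomp B (xs, a, xs') (ys @ zs, l, ys' @ zs') = (xs @ ys @ zs, q, xs' @ ys' @ zs')"
    by simp
  have ka: "(xs @ ys, k, xs' @ ys') \<in> Arr (word_cat B)"
    using word_hcomp_hom[OF ar(1,2)] unfolding k cat_hom_def by simp
  have la: "(ys @ zs, l, ys' @ zs') \<in> Arr (word_cat B)"
    using word_hcomp_hom[OF ar(2,3)] unfolding l cat_hom_def by simp
  have pa: "(xs @ ys @ zs, p, xs' @ ys' @ zs') \<in> Arr (word_cat B)"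
    using word_hcomp_hom[OF ka ar(3)] unfolding p cat_hom_def by simp
  have qa: "(xs @ ys @ zs, q, xs' @ ys' @ zs') \<in> Arr (word_cat B)"
    using word_hcomp_hom[OF ar(1) la] unfolding q cat_hom_def by simp
  have [simp]: "k \<in> Arr B" "Dom B k = word_comp B (xs @ ys)" "Cod B k = word_comp B (xs' @ ys')"
    "l \<in> Arr B" "Dom B l = word_comp B (ys @ zs)" "Cod B l = word_comp B (ys' @ zs')"
    "p \<in> Arr B" "Dom B p = word_comp B (xs @ ys @ zs)" "Cod B p = word_comp B (xs' @ ys' @ zs')"
    "q \<in> Arr B" "Dom B q = word_comp B (xs @ ys @ zs)" "Cod B q = word_comp B (xs' @ ys' @ zs')"
    using ka la pa qa by simp_all
  have ks: "k \<cdot> word_splice B xs ys = word_splice B xs' ys' \<cdot> (a \<star> b)"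
    using word_hcomp_splice[OF ar(1,2) t(1)] unfolding k by simp
  have ls: "l \<cdot> word_splice B ys zs = word_splice B ys' zs' \<cdot> (b \<star> c)"
    using word_hcomp_splice[OF ar(2,3) t(2)] unfolding l by simp
  have ps: "p \<cdot> word_splice B (xs @ ys) zs = word_splice B (xs' @ ys') zs' \<cdot> (k \<star> c)"
    using word_hcomp_splice[OF ka ar(3)] unfolding p by simp
  have qs: "q \<cdot> word_splice B xs (ys @ zs) = word_splice B xs' (ys' @ zs') \<cdot> (a \<star> l)"
    using word_hcomp_splice[OF ar(1) la] unfolding q by simp
  let ?X = "word_comp B xs" and ?Y = "word_comp B ys" and ?Z = "word_comp B zs"
  let ?X' = "word_comp B xs'" and ?Y' = "word_comp B ys'" and ?Z' = "word_comp B zs'"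
  let ?e = "word_splice B (xs @ ys) zs \<cdot> (word_splice B xs ys \<star> Idt B ?Z)"
  have "p \<cdot> ?e = (p \<cdot> word_splice B (xs @ ys) zs) \<cdot> (word_splice B xs ys \<star> Idt B ?Z)"
    by simp
  also have "\<dots> = word_splice B (xs' @ ys') zs' \<cdot> ((k \<cdot> word_splice B xs ys) \<star> c)"
    unfolding ps using hcomp_interchange[of "word_splice B xs ys" k "Idt B ?Z" c] by simp
  also have "\<dots> = (word_splice B (xs' @ ys') zs' \<cdot> (word_splice B xs' ys' \<star> Idt B ?Z')) \<cdot> ((a \<star> b) \<star> c)"
    unfolding ks using hcomp_interchange[of "a \<star> b" "word_splice B xs' ys'" c "Idt B ?Z'"] by simp
  also have "\<dots> = word_splice B xs' (ys' @ zs') \<cdot> (Idt B ?X' \<star> word_splice B ys' zs') \<cdot>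
      (Assoc B ?X' ?Y' ?Z' \<cdot> ((a \<star> b) \<star> c))"
    by (subst splice_assoc) simp_all
  also have "Assoc B ?X' ?Y' ?Z' \<cdot> ((a \<star> b) \<star> c) = (a \<star> (b \<star> c)) \<cdot> Assoc B ?X ?Y ?Z"
    using Assoc_natural[of a b c] by simp
  also have "word_splice B xs' (ys' @ zs') \<cdot> (Idt B ?X' \<star> word_splice B ys' zs') \<cdot> (a \<star> (b \<star> c)) \<cdot> Assoc B ?X ?Y ?Z =
      word_splice B xs' (ys' @ zs') \<cdot> (a \<star> (word_splice B ys' zs' \<cdot> (b \<star> c))) \<cdot> Assoc B ?X ?Y ?Z"
    using hcomp_interchange[of a "Idt B ?X'" "b \<star> c" "word_splice B ys' zs'"] by simp
  also have "\<dots> = (word_splice B xs' (ys' @ zs') \<cdot> (a \<star> l)) \<cdot> (Idt B ?X \<star> word_splice B ys zs) \<cdot> Assoc B ?X ?Y ?Z"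
    unfolding ls[symmetric] using hcomp_interchange[of "Idt B ?X" a "word_splice B ys zs" l] by simp
  also have "\<dots> = q \<cdot> (word_splice B xs (ys @ zs) \<cdot> (Idt B ?X \<star> word_splice B ys zs) \<cdot> Assoc B ?X ?Y ?Z)"
    unfolding qs[symmetric] by simp
  also have "\<dots> = q \<cdot> ?e" by (subst splice_assoc) simp_all
  finally have "p = q" by (rule iso_cancel_right[rotated]) simp_all
  then show ?thesis unfolding e k l p q by simp
qed

end

section \<open>The shadow on words\<close>

definition word_trace_Ob ::
  "('o, 'm, 'c, 'z) bicat_scheme \<Rightarrow> ('o \<Rightarrow> ('m, 'c, 't, 'u) cat_functor) \<Rightarrow> 'm list \<Rightarrow> 't" where
  "word_trace_Ob B sh xs = ObMap (sh (word_src B xs)) (word_comp B xs)"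

fun word_trace :: "('o, 'm, 'c, 'z) bicat_scheme \<Rightarrow> ('o \<Rightarrow> ('m, 'c, 't, 'u) cat_functor) \<Rightarrow>
    'm list \<times> 'c \<times> 'm list \<Rightarrow> 'u" where
  "word_trace B sh (xs, f, ys) = ArMap (sh (word_src B xs)) f"

text \<open>
  The cyclicity of the shadow, conjugated by the rebracketings of \<open>xs @ ys\<close> and \<open>ys @ xs\<close>.
\<close>

definition word_rot :: "('o, 'm, 'c, 'z) bicat_scheme \<Rightarrow> ('t, 'u, 'w) cat_scheme \<Rightarrow>
    ('o \<Rightarrow> ('m, 'c, 't, 'u) cat_functor) \<Rightarrow> ('m \<Rightarrow> 'm \<Rightarrow> 'u) \<Rightarrow> 'm list \<Rightarrow> 'm list \<Rightarrow> 'u" where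
  "word_rot B T sh \<theta> xs ys = ArMap (sh (word_src B ys)) (word_splice B ys xs) \<cdot>\<^bsub>T\<^esub>
     \<theta> (word_comp B xs) (word_comp B ys) \<cdot>\<^bsub>T\<^esub> ArMap (sh (word_src B xs)) (cat_inv B (word_splice B xs ys))"

context shadow
begin

lemma shadow_Obj [simp]:
  assumes "M \<in> Obj B" "Src B M = R" "Trg B M = R"
  shows "ObMap (sh R) M \<in> Obj T"
proof -
  have "R \<in> Cell0 B" using assms by auto
  then interpret S: is_functor "hom_cat B R R" T "sh R" by (rule shadow_functor)
  show ?thesis using S.map_Obj[of M] assms by (simp add: cells1_def)
qed

lemma shadow_arr [simp]:
  assumes "f \<in> Arr B" "Src B (Dom B f) = R" "Trg B (Dom B f) = R"
  shows "ArMap (sh R) f \<in> Arr T" "Dom T (ArMap (sh R) f) = ObMap (sh R) (Dom B f)"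
    "Cod T (ArMap (sh R) f) = ObMap (sh R) (Cod B f)"
proof -
  have "R \<in> Cell0 B" using assms by auto
  then interpret S: is_functor "hom_cat B R R" T "sh R" by (rule shadow_functor)
  show "ArMap (sh R) f \<in> Arr T" "Dom T (ArMap (sh R) f) = ObMap (sh R) (Dom B f)"
    "Cod T (ArMap (sh R) f) = ObMap (sh R) (Cod B f)"
    using S.map_hom[of f "Dom B f" "Cod B f"] assms by (simp_all add: cat_hom_def cells1_def)
qed

lemma shadow_id [simp]:
  assumes "M \<in> Obj B" "Src B M = R" "Trg B M = R"
  shows "ArMap (sh R) (Idt B M) = Idt T (ObMap (sh R) M)"
proof -
  have "R \<in> Cell0 B" using assms by auto
  then interpret S: is_functor "hom_cat B R R" T "sh R" by (rule shadow_functor)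
  show ?thesis using S.map_id[of M] assms by (simp add: cells1_def)
qed

lemma shadow_comp:
  assumes "f \<in> Arr B" "g \<in> Arr B" "Cod B f = Dom B g" "Src B (Dom B f) = R" "Trg B (Dom B f) = R"
  shows "ArMap (sh R) (g \<cdot> f) = ArMap (sh R) g \<cdot>\<^bsub>T\<^esub> ArMap (sh R) f"
proof -
  have "R \<in> Cell0 B" using assms by auto
  then interpret S: is_functor "hom_cat B R R" T "sh R" by (rule shadow_functor)
  have "Src B (Dom B g) = R" "Trg B (Dom B g) = R" using assms parallel_src parallel_trg by metis+
  then show ?thesis using S.map_comp[of f "Dom B f" "Cod B f" g "Cod B g"] assms
    by (simp add: cat_hom_def cells1_def)
qed

lemma shadow_iso [simp]:
  assumes "is_iso B f" "Src B (Dom B f) = R" "Trg B (Dom B f) = R"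
  shows "is_iso T (ArMap (sh R) f)"
proof (rule target.is_isoI[where g = "ArMap (sh R) (cat_inv B f)"])
  note [simp] = iso_arr[OF assms(1)] parallel_src[OF iso_arr[OF assms(1)]] parallel_trg[OF iso_arr[OF assms(1)]]
  show "ArMap (sh R) f \<in> Arr T" "ArMap (sh R) (cat_inv B f) \<in> Arr T"
    "Dom T (ArMap (sh R) (cat_inv B f)) = Cod T (ArMap (sh R) f)"
    "Cod T (ArMap (sh R) (cat_inv B f)) = Dom T (ArMap (sh R) f)"
    "ArMap (sh R) (cat_inv B f) \<cdot>\<^bsub>T\<^esub> ArMap (sh R) f = Idt T (Dom T (ArMap (sh R) f))"
    "ArMap (sh R) f \<cdot>\<^bsub>T\<^esub> ArMap (sh R) (cat_inv B f) = Idt T (Cod T (ArMap (sh R) f))"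
    using assms by (simp_all flip: shadow_comp)
qed

lemma cyclicity_arr [simp]:
  assumes "M \<in> Obj B" "N \<in> Obj B" "Trg B M = Src B N" "Trg B N = Src B M"
  shows "\<theta> M N \<in> Arr T" "Dom T (\<theta> M N) = ObMap (sh (Src B M)) (M \<odot> N)"
    "Cod T (\<theta> M N) = ObMap (sh (Src B N)) (N \<odot> M)" "is_iso T (\<theta> M N)"
proof -
  interpret C: natural_isomorphism
    "product_cat (hom_cat B (Src B M) (Src B N)) (hom_cat B (Src B N) (Src B M))" T
    "\<lparr>ObMap = \<lambda>(M', N'). ObMap (sh (Src B M)) (M' \<odot> N'), ArMap = \<lambda>(f, g). ArMap (sh (Src B M)) (f \<star> g)\<rparr>"
    "\<lparr>ObMap = \<lambda>(M', N'). ObMap (sh (Src B N)) (N' \<odot> M'), ArMap = \<lambda>(f, g). ArMap (sh (Src B N)) (g \<star> f)\<rparr>"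
    "\<lambda>(M, N). \<theta> M N"
    using assms by (intro cyclicity_natural) auto
  show "\<theta> M N \<in> Arr T" "Dom T (\<theta> M N) = ObMap (sh (Src B M)) (M \<odot> N)"
    "Cod T (\<theta> M N) = ObMap (sh (Src B N)) (N \<odot> M)" "is_iso T (\<theta> M N)"
    using C.component_in_hom[of "(M, N)"] C.component_iso[of "(M, N)"] assms
    by (simp_all add: cells1_def cat_hom_def)
qed

lemma cyclicity_nat:
  assumes "f \<in> Arr B" "g \<in> Arr B" "Trg B (Dom B f) = Src B (Dom B g)" "Trg B (Dom B g) = Src B (Dom B f)"
    and "Src B (Dom B f) = R" "Src B (Dom B g) = S"
  shows "\<theta> (Cod B f) (Cod B g) \<cdot>\<^bsub>T\<^esub> ArMap (sh R) (f \<star> g) =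
    ArMap (sh S) (g \<star> f) \<cdot>\<^bsub>T\<^esub> \<theta> (Dom B f) (Dom B g)"
proof -
  interpret C: natural_isomorphism
    "product_cat (hom_cat B R S) (hom_cat B S R)" T
    "\<lparr>ObMap = \<lambda>(M', N'). ObMap (sh R) (M' \<odot> N'), ArMap = \<lambda>(f, g). ArMap (sh R) (f \<star> g)\<rparr>"
    "\<lparr>ObMap = \<lambda>(M', N'). ObMap (sh S) (N' \<odot> M'), ArMap = \<lambda>(f, g). ArMap (sh S) (g \<star> f)\<rparr>"
    "\<lambda>(M, N). \<theta> M N"
    using assms by (intro cyclicity_natural) auto
  show ?thesis
    using C.naturality[of "(f, g)" "(Dom B f, Dom B g)" "(Cod B f, Cod B g)"] assms
    by (simp add: cells1_def cat_hom_def)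
qed

lemma word_rot_arr:
  assumes "xs \<in> words B" "ys \<in> words B" "word_trg B xs = word_src B ys" "word_trg B ys = word_src B xs"
  shows "word_rot B T sh \<theta> xs ys \<in> cat_hom T (word_trace_Ob B sh (xs @ ys)) (word_trace_Ob B sh (ys @ xs))"
    and "is_iso T (word_rot B T sh \<theta> xs ys)"
  using assms by (simp_all add: word_rot_def word_trace_Ob_def cat_hom_def)

lemma word_rot_splice:
  assumes "xs \<in> words B" "ys \<in> words B" "word_trg B xs = word_src B ys" "word_trg B ys = word_src B xs"
    and "word_src B xs = R" "word_src B ys = S"
  shows "word_rot B T sh \<theta> xs ys \<cdot>\<^bsub>T\<^esub> ArMap (sh R) (word_splice B xs ys) =
    ArMap (sh S) (word_splice B ys xs) \<cdot>\<^bsub>T\<^esub> \<theta> (word_comp B xs) (word_comp B ys)"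
proof -
  have "ArMap (sh R) (cat_inv B (word_splice B xs ys)) \<cdot>\<^bsub>T\<^esub> ArMap (sh R) (word_splice B xs ys) =
      Idt T (ObMap (sh R) (word_comp B xs \<odot> word_comp B ys))"
    using assms by (simp flip: shadow_comp)
  then show ?thesis using assms by (simp add: word_rot_def)
qed

lemma word_rot_natural:
  assumes "f \<in> Arr (word_cat B)" "g \<in> Arr (word_cat B)"
    and "word_trg B (Dom (word_cat B) f) = word_src B (Dom (word_cat B) g)"
    and "word_trg B (Dom (word_cat B) g) = word_src B (Dom (word_cat B) f)"
  shows "word_rot B T sh \<theta> (Cod (word_cat B) f) (Cod (word_cat B) g) \<cdot>\<^bsub>T\<^esub> word_trace B sh (word_hcomp B f g) =
    word_trace B sh (word_hcomp B g f) \<cdot>\<^bsub>T\<^esub> word_rot B T sh \<theta> (Dom (word_cat B) f) (Dom (word_cat B) g)"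
proof -
  obtain xs a xs' ys b ys' where fg: "f = (xs, a, xs')" "g = (ys, b, ys')"
    by (metis prod_cases3)
  have ar: "(xs, a, xs') \<in> Arr (word_cat B)" "(ys, b, ys') \<in> Arr (word_cat B)"
    and t [simp]: "word_trg B xs = word_src B ys" "word_trg B ys = word_src B xs"
    using assms fg by auto
  have [simp]: "xs \<in> words B" "xs' \<in> words B" "ys \<in> words B" "ys' \<in> words B" "a \<in> Arr B" "b \<in> Arr B"
    "Dom B a = word_comp B xs" "Cod B a = word_comp B xs'" "Dom B b = word_comp B ys"
    "Cod B b = word_comp B ys'"
    using ar by auto
  have [simp]: "word_src B xs' = word_src B xs" "word_src B ys' = word_src B ys"
    "word_trg B xs' = word_src B ys" "word_trg B ys' = word_src B xs"
    using word_parallel[OF ar(1)] word_parallel[OF ar(2)] by simp_all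
  let ?R = "word_src B xs" and ?S = "word_src B ys"
  let ?r = "word_rot B T sh \<theta> xs' ys'" and ?i = "ArMap (sh ?R) (cat_inv B (word_splice B xs ys))"
  note [simp] = word_rot_arr[unfolded cat_hom_def word_trace_Ob_def, simplified]
  have "?r \<cdot>\<^bsub>T\<^esub> word_trace B sh (word_hcomp B f g) =
      (?r \<cdot>\<^bsub>T\<^esub> ArMap (sh ?R) (word_splice B xs' ys')) \<cdot>\<^bsub>T\<^esub> (ArMap (sh ?R) (a \<star> b) \<cdot>\<^bsub>T\<^esub> ?i)"
    by (simp add: fg words_nonempty shadow_comp)
  also have "\<dots> = ArMap (sh ?S) (word_splice B ys' xs') \<cdot>\<^bsub>T\<^esub>
      ((\<theta> (word_comp B xs') (word_comp B ys') \<cdot>\<^bsub>T\<^esub> ArMap (sh ?R) (a \<star> b)) \<cdot>\<^bsub>T\<^esub> ?i)"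
    by (subst word_rot_splice[where S = ?S]) simp_all
  also have "\<theta> (word_comp B xs') (word_comp B ys') \<cdot>\<^bsub>T\<^esub> ArMap (sh ?R) (a \<star> b) =
      ArMap (sh ?S) (b \<star> a) \<cdot>\<^bsub>T\<^esub> \<theta> (word_comp B xs) (word_comp B ys)"
    using cyclicity_nat[of a b] by simp
  also have "ArMap (sh ?S) (word_splice B ys' xs') \<cdot>\<^bsub>T\<^esub>
      ((ArMap (sh ?S) (b \<star> a) \<cdot>\<^bsub>T\<^esub> \<theta> (word_comp B xs) (word_comp B ys)) \<cdot>\<^bsub>T\<^esub> ?i) =
      ArMap (sh ?S) (word_splice B ys' xs' \<cdot> (b \<star> a) \<cdot> cat_inv B (word_splice B ys xs) \<cdot> word_splice B ys xs) \<cdot>\<^bsub>T\<^esub>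
        (\<theta> (word_comp B xs) (word_comp B ys) \<cdot>\<^bsub>T\<^esub> ?i)"
    by (simp add: shadow_comp)
  also have "\<dots> = word_trace B sh (word_hcomp B g f) \<cdot>\<^bsub>T\<^esub> word_rot B T sh \<theta> xs ys"
    by (simp add: fg word_rot_def shadow_comp del: cat_inv_comp)
  finally show ?thesis by (simp add: fg)
qed

text \<open>
  Precomposing with the rebracketing of the threefold concatenation turns every word rotation into
  a cyclicity map of \<open>B\<close>, and the rebracketings met on the way are matched with the associators of the
  hexagon by \<open>splice_assoc\<close>.
\<close>

lemma word_rot_hexagon:
  assumes [simp]: "xs \<in> words B" "ys \<in> words B" "zs \<in> words B"
    and [simp]: "word_trg B xs = word_src B ys" "word_trg B ys = word_src B zs" "word_trg B zs = word_src B xs"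
  shows "word_rot B T sh \<theta> (xs @ ys) zs = word_rot B T sh \<theta> ys (zs @ xs) \<cdot>\<^bsub>T\<^esub> word_rot B T sh \<theta> xs (ys @ zs)"
proof -
  let ?X = "word_comp B xs" and ?Y = "word_comp B ys" and ?Z = "word_comp B zs"
  let ?r = "word_rot B T sh \<theta>"
  have ra [simp]: "?r us vs \<in> Arr T" "Dom T (?r us vs) = ObMap (sh (word_src B us)) (word_comp B (us @ vs))"
    "Cod T (?r us vs) = ObMap (sh (word_src B vs)) (word_comp B (vs @ us))"
    if "us \<in> words B" "vs \<in> words B" "word_trg B us = word_src B vs" "word_trg B vs = word_src B us" for us vs
    using word_rot_arr(1)[OF that] that by (simp_all add: cat_hom_def word_trace_Ob_def)
  let ?sx = "ArMap (sh (word_src B xs))" and ?sy = "ArMap (sh (word_src B ys))" and ?sz = "ArMap (sh (word_src B zs))"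
  let ?e = "word_splice B (xs @ ys) zs \<cdot> (word_splice B xs ys \<star> Idt B ?Z)"
  have n1: "\<theta> (word_comp B (xs @ ys)) ?Z \<cdot>\<^bsub>T\<^esub> ?sx (word_splice B xs ys \<star> Idt B ?Z) =
      ?sz (Idt B ?Z \<star> word_splice B xs ys) \<cdot>\<^bsub>T\<^esub> \<theta> (?X \<odot> ?Y) ?Z"
    using cyclicity_nat[of "word_splice B xs ys" "Idt B ?Z"] by simp
  have n2: "\<theta> ?X (word_comp B (ys @ zs)) \<cdot>\<^bsub>T\<^esub> ?sx (Idt B ?X \<star> word_splice B ys zs) =
      ?sy (word_splice B ys zs \<star> Idt B ?X) \<cdot>\<^bsub>T\<^esub> \<theta> ?X (?Y \<odot> ?Z)"
    using cyclicity_nat[of "Idt B ?X" "word_splice B ys zs"] by simp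
  have n3: "\<theta> ?Y (word_comp B (zs @ xs)) \<cdot>\<^bsub>T\<^esub> ?sy (Idt B ?Y \<star> word_splice B zs xs) =
      ?sz (word_splice B zs xs \<star> Idt B ?Y) \<cdot>\<^bsub>T\<^esub> \<theta> ?Y (?Z \<odot> ?X)"
    using cyclicity_nat[of "Idt B ?Y" "word_splice B zs xs"] by simp
  have hex: "\<theta> (?X \<odot> ?Y) ?Z = ?sz (Assoc B ?Z ?X ?Y) \<cdot>\<^bsub>T\<^esub> \<theta> ?Y (?Z \<odot> ?X) \<cdot>\<^bsub>T\<^esub>
        ?sy (Assoc B ?Y ?Z ?X) \<cdot>\<^bsub>T\<^esub> \<theta> ?X (?Y \<odot> ?Z) \<cdot>\<^bsub>T\<^esub> ?sx (Assoc B ?X ?Y ?Z)"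
    by (rule cyclicity_hexagon) (simp_all add: cells1_def)
  have "?r (xs @ ys) zs \<cdot>\<^bsub>T\<^esub> ?sx ?e = (?r (xs @ ys) zs \<cdot>\<^bsub>T\<^esub> ?sx (word_splice B (xs @ ys) zs)) \<cdot>\<^bsub>T\<^esub>
      ?sx (word_splice B xs ys \<star> Idt B ?Z)"
    by (simp add: shadow_comp)
  also have "\<dots> = ?sz (word_splice B zs (xs @ ys)) \<cdot>\<^bsub>T\<^esub>
      (\<theta> (word_comp B (xs @ ys)) ?Z \<cdot>\<^bsub>T\<^esub> ?sx (word_splice B xs ys \<star> Idt B ?Z))"
    by (subst word_rot_splice[where S = "word_src B zs"]) simp_all
  also have "\<dots> = ?sz (word_splice B zs (xs @ ys) \<cdot> (Idt B ?Z \<star> word_splice B xs ys) \<cdot> Assoc B ?Z ?X ?Y) \<cdot>\<^bsub>T\<^esub>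
      \<theta> ?Y (?Z \<odot> ?X) \<cdot>\<^bsub>T\<^esub> ?sy (Assoc B ?Y ?Z ?X) \<cdot>\<^bsub>T\<^esub> \<theta> ?X (?Y \<odot> ?Z) \<cdot>\<^bsub>T\<^esub> ?sx (Assoc B ?X ?Y ?Z)"
    unfolding n1 hex by (simp add: shadow_comp)
  also have "\<dots> = ?sz (word_splice B (zs @ xs) ys) \<cdot>\<^bsub>T\<^esub> (?sz (word_splice B zs xs \<star> Idt B ?Y) \<cdot>\<^bsub>T\<^esub>
      \<theta> ?Y (?Z \<odot> ?X)) \<cdot>\<^bsub>T\<^esub> ?sy (Assoc B ?Y ?Z ?X) \<cdot>\<^bsub>T\<^esub> \<theta> ?X (?Y \<odot> ?Z) \<cdot>\<^bsub>T\<^esub> ?sx (Assoc B ?X ?Y ?Z)"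
    by (subst splice_assoc[symmetric]) (simp_all add: shadow_comp)
  also have "\<dots> = (?sz (word_splice B (zs @ xs) ys) \<cdot>\<^bsub>T\<^esub> \<theta> ?Y (word_comp B (zs @ xs))) \<cdot>\<^bsub>T\<^esub>
      ?sy (Idt B ?Y \<star> word_splice B zs xs) \<cdot>\<^bsub>T\<^esub> ?sy (Assoc B ?Y ?Z ?X) \<cdot>\<^bsub>T\<^esub> \<theta> ?X (?Y \<odot> ?Z) \<cdot>\<^bsub>T\<^esub> ?sx (Assoc B ?X ?Y ?Z)"
    unfolding n3[symmetric] by simp
  also have "?sz (word_splice B (zs @ xs) ys) \<cdot>\<^bsub>T\<^esub> \<theta> ?Y (word_comp B (zs @ xs)) =
      ?r ys (zs @ xs) \<cdot>\<^bsub>T\<^esub> ?sy (word_splice B ys (zs @ xs))"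
    by (subst word_rot_splice[where S = "word_src B zs"]) simp_all
  also have "(?r ys (zs @ xs) \<cdot>\<^bsub>T\<^esub> ?sy (word_splice B ys (zs @ xs))) \<cdot>\<^bsub>T\<^esub>
      ?sy (Idt B ?Y \<star> word_splice B zs xs) \<cdot>\<^bsub>T\<^esub> ?sy (Assoc B ?Y ?Z ?X) \<cdot>\<^bsub>T\<^esub> \<theta> ?X (?Y \<odot> ?Z) \<cdot>\<^bsub>T\<^esub> ?sx (Assoc B ?X ?Y ?Z)
    = ?r ys (zs @ xs) \<cdot>\<^bsub>T\<^esub> ?sy (word_splice B ys (zs @ xs) \<cdot> (Idt B ?Y \<star> word_splice B zs xs) \<cdot> Assoc B ?Y ?Z ?X) \<cdot>\<^bsub>T\<^esub>
      \<theta> ?X (?Y \<odot> ?Z) \<cdot>\<^bsub>T\<^esub> ?sx (Assoc B ?X ?Y ?Z)"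
    by (simp add: shadow_comp)
  also have "\<dots> = ?r ys (zs @ xs) \<cdot>\<^bsub>T\<^esub> ?sy (word_splice B (ys @ zs) xs) \<cdot>\<^bsub>T\<^esub> (?sy (word_splice B ys zs \<star> Idt B ?X) \<cdot>\<^bsub>T\<^esub>
      \<theta> ?X (?Y \<odot> ?Z)) \<cdot>\<^bsub>T\<^esub> ?sx (Assoc B ?X ?Y ?Z)"
    by (subst splice_assoc[symmetric]) (simp_all add: shadow_comp)
  also have "\<dots> = ?r ys (zs @ xs) \<cdot>\<^bsub>T\<^esub> (?sy (word_splice B (ys @ zs) xs) \<cdot>\<^bsub>T\<^esub> \<theta> ?X (word_comp B (ys @ zs))) \<cdot>\<^bsub>T\<^esub>
      ?sx (Idt B ?X \<star> word_splice B ys zs) \<cdot>\<^bsub>T\<^esub> ?sx (Assoc B ?X ?Y ?Z)"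
    unfolding n2[symmetric] by simp
  also have "?sy (word_splice B (ys @ zs) xs) \<cdot>\<^bsub>T\<^esub> \<theta> ?X (word_comp B (ys @ zs)) =
      ?r xs (ys @ zs) \<cdot>\<^bsub>T\<^esub> ?sx (word_splice B xs (ys @ zs))"
    by (subst word_rot_splice[where S = "word_src B ys"]) simp_all
  also have "?r ys (zs @ xs) \<cdot>\<^bsub>T\<^esub> (?r xs (ys @ zs) \<cdot>\<^bsub>T\<^esub> ?sx (word_splice B xs (ys @ zs))) \<cdot>\<^bsub>T\<^esub>
      ?sx (Idt B ?X \<star> word_splice B ys zs) \<cdot>\<^bsub>T\<^esub> ?sx (Assoc B ?X ?Y ?Z) =
      (?r ys (zs @ xs) \<cdot>\<^bsub>T\<^esub> ?r xs (ys @ zs)) \<cdot>\<^bsub>T\<^esub>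
      ?sx (word_splice B xs (ys @ zs) \<cdot> (Idt B ?X \<star> word_splice B ys zs) \<cdot> Assoc B ?X ?Y ?Z)"
    by (simp add: shadow_comp)
  also have "word_splice B xs (ys @ zs) \<cdot> (Idt B ?X \<star> word_splice B ys zs) \<cdot> Assoc B ?X ?Y ?Z = ?e"
    by (rule splice_assoc[symmetric]) simp_all
  finally show ?thesis by (rule target.iso_cancel_right[rotated]) simp_all
qed

lemma strict_shadow_words:
  "strict_shadow (word_cat B) T (word_src B) (word_trg B) (@) (word_hcomp B)
    (word_trace_Ob B sh) (word_trace B sh) (word_rot B T sh \<theta>)"
proof (intro strict_shadow.intro strict_shadow_axioms.intro word_category target.category_axioms, goal_cases)
  case (7 f g)
  then show ?case by (rule word_hcomp_hom)
next
  case (8 M N)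
  then show ?case by simp
next
  case (11 f)
  then show ?case
    using word_parallel(1)[of f] by (cases f) (auto simp: word_trace_Ob_def cat_hom_def)
next
  case (13 f g)
  then show ?case
    using word_parallel(1)[of f] by (cases f; cases g) (auto simp: shadow_comp)
next
  case (14 M N)
  then show ?case by (intro word_rot_arr) simp_all
qed (simp_all add: word_parallel word_hcomp_interchange word_hcomp_assoc word_rot_natural
    word_rot_hexagon word_rot_arr(2) word_trace_Ob_def del: word_hcomp.simps)

end

section \<open>Conjugation of twisted shadows\<close>

text \<open>
  The hypotheses of the theorem. Its group 1-cells become one-letter words, which makes them strict
  twisting data on words.
\<close>

locale twisted_shadow_data = shadow B T sh \<theta> + twisting_data B G \<Theta> \<mu> \<eta>
  for B :: "('o, 'm, 'c, 'z) bicat_scheme" (structure) and T :: "('t, 'u, 'w) cat_scheme"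
    and sh \<theta> and G :: "('g, 'y) monoid_scheme" and \<Theta> \<mu> \<eta>
begin

lemma Theta_cell [simp]:
  assumes "A \<in> Cell0 B" "g \<in> carrier G"
  shows "\<Theta> A g \<in> Obj B" "Src B (\<Theta> A g) = A" "Trg B (\<Theta> A g) = A"
  using Theta_Pic[OF assms] by (simp_all add: Pic_def cells1_def)

lemma mu_arr [simp]:
  assumes "A \<in> Cell0 B" "g \<in> carrier G" "h \<in> carrier G"
  shows "\<mu> A g h \<in> Arr B" "Dom B (\<mu> A g h) = \<Theta> A g \<odot> \<Theta> A h"
    "Cod B (\<mu> A g h) = \<Theta> A (g \<otimes>\<^bsub>G\<^esub> h)" "is_iso B (\<mu> A g h)"
  using mu_in_hom[OF assms] by (simp_all add: Pic_def cat_hom_def)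

sublocale W: strict_twist "word_cat B" T "word_src B" "word_trg B" "(@)" "word_hcomp B"
  "word_trace_Ob B sh" "word_trace B sh" "word_rot B T sh \<theta>" G "Cell0 B"
  "\<lambda>A g. [\<Theta> A g]" "\<lambda>A g h. ([\<Theta> A g, \<Theta> A h], \<mu> A g h, [\<Theta> A (g \<otimes>\<^bsub>G\<^esub> h)])"
proof (intro strict_twist.intro strict_shadow_words strict_twist_axioms.intro is_group)
  fix A g h assume [simp]: "A \<in> Cell0 B" "g \<in> carrier G" "h \<in> carrier G"
  interpret S: strict_shadow "word_cat B" T "word_src B" "word_trg B" "(@)" "word_hcomp B"
    "word_trace_Ob B sh" "word_trace B sh" "word_rot B T sh \<theta>" by (rule strict_shadow_words)
  show "is_iso (word_cat B) ([\<Theta> A g, \<Theta> A h], \<mu> A g h, [\<Theta> A (g \<otimes>\<^bsub>G\<^esub> h)])"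
    by (rule S.V.is_isoI[where g = "([\<Theta> A (g \<otimes>\<^bsub>G\<^esub> h)], cat_inv B (\<mu> A g h), [\<Theta> A g, \<Theta> A h])"]) simp_all
next
  fix A g h k assume [simp]: "A \<in> Cell0 B" "g \<in> carrier G" "h \<in> carrier G" "k \<in> carrier G"
  let ?a = "Assoc B (\<Theta> A g) (\<Theta> A h) (\<Theta> A k)"
  have "\<mu> A (g \<otimes>\<^bsub>G\<^esub> h) k \<cdot> (\<mu> A g h \<star> Idt B (\<Theta> A k)) \<cdot> cat_inv B ?a =
    (\<mu> A g (h \<otimes>\<^bsub>G\<^esub> k) \<cdot> (Idt B (\<Theta> A g) \<star> \<mu> A h k) \<cdot> ?a) \<cdot> cat_inv B ?a"
    unfolding mu_assoc[of A g h k, simplified] by (simp add: m_assoc)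
  also have "\<dots> = \<mu> A g (h \<otimes>\<^bsub>G\<^esub> k) \<cdot> (Idt B (\<Theta> A g) \<star> \<mu> A h k)"
    by simp
  finally show "([\<Theta> A g, \<Theta> A (h \<otimes>\<^bsub>G\<^esub> k)], \<mu> A g (h \<otimes>\<^bsub>G\<^esub> k), [\<Theta> A (g \<otimes>\<^bsub>G\<^esub> (h \<otimes>\<^bsub>G\<^esub> k))]) \<cdot>\<^bsub>word_cat B\<^esub>
      word_hcomp B (Idt (word_cat B) [\<Theta> A g]) ([\<Theta> A h, \<Theta> A k], \<mu> A h k, [\<Theta> A (h \<otimes>\<^bsub>G\<^esub> k)]) =
    ([\<Theta> A (g \<otimes>\<^bsub>G\<^esub> h), \<Theta> A k], \<mu> A (g \<otimes>\<^bsub>G\<^esub> h) k, [\<Theta> A (g \<otimes>\<^bsub>G\<^esub> h \<otimes>\<^bsub>G\<^esub> k)]) \<cdot>\<^bsub>word_cat B\<^esub>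
      word_hcomp B ([\<Theta> A g, \<Theta> A h], \<mu> A g h, [\<Theta> A (g \<otimes>\<^bsub>G\<^esub> h)]) (Idt (word_cat B) [\<Theta> A k])"
    by (simp add: m_assoc)
qed (simp_all add: cat_hom_def)

abbreviation "BG \<equiv> twist_bicat B G \<Theta> \<mu> \<eta>"

abbreviation "twist \<equiv> is_twist B G \<Theta> \<mu> \<eta>"

text \<open>
  The components of the half-braiding of a twist, as arrows between two-letter words.
\<close>

definition braid :: "'m \<times> ('g \<Rightarrow> 'c) \<Rightarrow> 'g \<Rightarrow> 'm list \<times> 'c \<times> 'm list" where
  "braid x y = ([fst x, \<Theta> (Trg B (fst x)) y], cat_inv B (snd x y), [\<Theta> (Src B (fst x)) y, fst x])"

lemma twistD:
  assumes "twist (M, \<tau>)"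
  shows "M \<in> Obj B" "Src B M \<in> Cell0 B" "Trg B M \<in> Cell0 B"
    and "g \<in> carrier G \<Longrightarrow> is_iso B (\<tau> g)" "g \<in> carrier G \<Longrightarrow> \<tau> g \<in> Arr B"
    and "g \<in> carrier G \<Longrightarrow> Dom B (\<tau> g) = \<Theta> (Src B M) g \<odot> M"
    and "g \<in> carrier G \<Longrightarrow> Cod B (\<tau> g) = M \<odot> \<Theta> (Trg B M) g"
  using assms by (auto simp: is_twist_def Let_def cat_hom_def)

text \<open>
  The formula for \<open>\<tau> (y \<otimes> z)\<close> in the definition of a twist, inverted factor by factor.
\<close>

lemma half_braiding_braid:
  assumes tw: "twist (M, \<tau>)"
  shows "W.half_braiding [M] (braid (M, \<tau>))"
proof -
  note [simp] = twistD[OF tw]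
  let ?R = "Src B M" and ?S = "Trg B M"
  have iso: "is_iso (word_cat B) (braid (M, \<tau>) y)" if [simp]: "y \<in> carrier G" for y
    by (rule W.V.is_isoI[where g = "([\<Theta> ?R y, M], \<tau> y, [M, \<Theta> ?S y])"]) (simp_all add: braid_def)
  have mult: "cat_inv B (\<tau> (y \<otimes>\<^bsub>G\<^esub> z)) \<cdot> (Idt B M \<star> \<mu> ?S y z) =
      (\<mu> ?R y z \<star> Idt B M) \<cdot> cat_inv B (Assoc B (\<Theta> ?R y) (\<Theta> ?R z) M) \<cdot>
      (Idt B (\<Theta> ?R y) \<star> cat_inv B (\<tau> z)) \<cdot> Assoc B (\<Theta> ?R y) M (\<Theta> ?S z) \<cdot>
      (cat_inv B (\<tau> y) \<star> Idt B (\<Theta> ?S z)) \<cdot> cat_inv B (Assoc B M (\<Theta> ?S y) (\<Theta> ?S z))"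
    (is "_ = ?r")
    if [simp]: "y \<in> carrier G" "z \<in> carrier G" for y z
  proof (rule iso_cancel_left[where f = "\<tau> (y \<otimes>\<^bsub>G\<^esub> z)"])
    have w: "cat_inv B (\<mu> ?R y z) \<star> Idt B M = cat_inv B (\<mu> ?R y z \<star> Idt B M)"
      "Idt B (\<Theta> ?R y) \<star> cat_inv B (\<tau> z) = cat_inv B (Idt B (\<Theta> ?R y) \<star> \<tau> z)"
      "cat_inv B (\<tau> y) \<star> Idt B (\<Theta> ?S z) = cat_inv B (\<tau> y \<star> Idt B (\<Theta> ?S z))"
      by (simp_all add: hcomp_cat_inv)
    have "\<tau> (y \<otimes>\<^bsub>G\<^esub> z) = (Idt B M \<star> \<mu> ?S y z) \<cdot> Assoc B M (\<Theta> ?S y) (\<Theta> ?S z) \<cdot>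
          (\<tau> y \<star> Idt B (\<Theta> ?S z)) \<cdot> cat_inv B (Assoc B (\<Theta> ?R y) M (\<Theta> ?S z)) \<cdot>
          (Idt B (\<Theta> ?R y) \<star> \<tau> z) \<cdot> Assoc B (\<Theta> ?R y) (\<Theta> ?R z) M \<cdot>
          (cat_inv B (\<mu> ?R y z) \<star> Idt B M)"
      using tw that by (simp add: is_twist_def Let_def)
    then have "\<tau> (y \<otimes>\<^bsub>G\<^esub> z) \<cdot> ?r = Idt B M \<star> \<mu> ?S y z"
      unfolding w by simp
    then show "\<tau> (y \<otimes>\<^bsub>G\<^esub> z) \<cdot> cat_inv B (\<tau> (y \<otimes>\<^bsub>G\<^esub> z)) \<cdot> (Idt B M \<star> \<mu> ?S y z) = \<tau> (y \<otimes>\<^bsub>G\<^esub> z) \<cdot> ?r"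
      by simp
  qed simp_all
  show ?thesis
    by (simp add: W.half_braiding_def iso) (simp add: braid_def cat_hom_def mult)
qed

text \<open>
  The associators in the definition of the twisted cyclicity are the rebracketings of the words
  \<open>[\<Theta>, M, N]\<close>, \<open>[N, \<Theta>, M]\<close> and \<open>[\<Theta>, N, M]\<close>.
\<close>

lemma twisted_cyclicity_eq:
  assumes M: "twist (M, \<tau>)" and N: "twist (N, \<sigma>)"
    and [simp]: "Trg B M = Src B N" "Trg B N = Src B M" and [simp]: "g \<in> carrier G"
  shows "twisted_cyclicity B T G \<Theta> sh \<theta> g (M, \<tau>) (N, \<sigma>) =
    W.twisted_rot [\<Theta> (Src B M) (inv\<^bsub>G\<^esub> g)] [M] [N] (braid (N, \<sigma>) (inv\<^bsub>G\<^esub> g))"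
proof -
  note [simp] = twistD[OF M] twistD[OF N]
  show ?thesis
    by (simp add: twisted_cyclicity_def Let_def transport_map_def W.twisted_rot_def word_rot_def
        braid_def shadow_comp)
qed

text \<open>
  The identity of \<open>M \<odot> N\<close> is an isomorphism of words from \<open>[M \<odot> N]\<close> to \<open>[M, N]\<close> that intertwines the
  twist of the composite with the juxtaposed half-braidings. Naturality of conjugation applies to
  it, and in front of it any \<open>\<Theta> z\<close> gives an identity 2-cell, which the shadow sends to an identity.
\<close>

lemma conjugation_regroup:
  assumes M: "twist (M, \<tau>)" and N: "twist (N, \<sigma>)"
    and [simp]: "Trg B M = Src B N" "Trg B N = Src B M" and [simp]: "y \<in> carrier G" "x \<in> carrier G"
  shows "W.conjugation y x [M \<odot> N] (braid (twist_hcomp B G \<Theta> (M, \<tau>) (N, \<sigma>)) y) =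
    W.conjugation y x ([M] @ [N]) (word_hcomp B (braid (M, \<tau>) y) (Idt (word_cat B) [N]) \<cdot>\<^bsub>word_cat B\<^esub>
      word_hcomp B (Idt (word_cat B) [M]) (braid (N, \<sigma>) y))" (is "?c = ?c'")
proof -
  note [simp] = twistD[OF M] twistD[OF N]
  let ?r = "([M \<odot> N], Idt B (M \<odot> N), [M, N])" and ?R = "Src B M"
  let ?s = "braid (twist_hcomp B G \<Theta> (M, \<tau>) (N, \<sigma>)) y"
    and ?s' = "word_hcomp B (braid (M, \<tau>) y) (Idt (word_cat B) [N]) \<cdot>\<^bsub>word_cat B\<^esub>
      word_hcomp B (Idt (word_cat B) [M]) (braid (N, \<sigma>) y)"
  have w: "Idt B M \<star> cat_inv B (\<sigma> y) = cat_inv B (Idt B M \<star> \<sigma> y)"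
    "cat_inv B (\<tau> y) \<star> Idt B N = cat_inv B (\<tau> y \<star> Idt B N)"
    by (simp_all add: hcomp_cat_inv)
  have "?c' \<cdot>\<^bsub>T\<^esub> word_trace B sh (word_hcomp B (Idt (word_cat B) [\<Theta> ?R (y \<otimes>\<^bsub>G\<^esub> x)]) ?r) =
    word_trace B sh (word_hcomp B (Idt (word_cat B) [\<Theta> ?R (x \<otimes>\<^bsub>G\<^esub> y)]) ?r) \<cdot>\<^bsub>T\<^esub> ?c"
    by (rule W.conjugation_natural)
      (simp_all add: braid_def twist_hcomp_def w cat_inv_comp_rev)
  moreover have "word_trace B sh (word_hcomp B (Idt (word_cat B) [\<Theta> ?R z]) ?r) =
      Idt T (ObMap (sh ?R) (\<Theta> ?R z \<odot> (M \<odot> N)))" if "z \<in> carrier G" for z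
    using that by simp
  moreover have "?c \<in> Arr T" "Cod T ?c = ObMap (sh ?R) (\<Theta> ?R (x \<otimes>\<^bsub>G\<^esub> y) \<odot> (M \<odot> N))"
    by (simp_all add: W.conjugation_arr[where R = ?R] word_trace_Ob_def braid_def twist_hcomp_def)
  moreover have "?c' \<in> Arr T" "Dom T ?c' = ObMap (sh ?R) (\<Theta> ?R (y \<otimes>\<^bsub>G\<^esub> x) \<odot> (M \<odot> N))"
    by (simp_all add: W.conjugation_arr[where R = ?R] word_trace_Ob_def braid_def)
  ultimately show ?thesis by simp
qed

lemma twist_bicat_sel [simp]:
  "Obj BG = {x. twist x}" "Arr BG = {p. is_twist_2cell B G \<Theta> \<mu> \<eta> p}"
  "Dom BG (x, f, y) = x" "Cod BG (x, f, y) = y" "Idt BG x = (x, Idt B (fst x), x)"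
  "Comp BG (y', g, z) (x, f, y) = (x, g \<cdot> f, z)"
  "Cell0 BG = Cell0 B" "HComp1 BG = twist_hcomp B G \<Theta>"
  "cells1 BG R S = {x. twist x \<and> Src B (fst x) = R \<and> Trg B (fst x) = S}"
  by (auto simp: twist_bicat_def Let_def cells1_def)

lemma twist_2cellD:
  assumes "is_twist_2cell B G \<Theta> \<mu> \<eta> ((M, \<tau>), f, (N, \<sigma>))"
  shows "twist (M, \<tau>)" "twist (N, \<sigma>)" "f \<in> Arr B" "Dom B f = M" "Cod B f = N"
    and "g \<in> carrier G \<Longrightarrow> \<sigma> g \<cdot> (Idt B (\<Theta> (Src B M) g) \<star> f) = (f \<star> Idt B (\<Theta> (Trg B M) g)) \<cdot> \<tau> g"
    and "Src B N = Src B M" "Trg B N = Trg B M"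
proof -
  show f: "twist (M, \<tau>)" "twist (N, \<sigma>)" "f \<in> Arr B" "Dom B f = M" "Cod B f = N"
    "g \<in> carrier G \<Longrightarrow> \<sigma> g \<cdot> (Idt B (\<Theta> (Src B M) g) \<star> f) = (f \<star> Idt B (\<Theta> (Trg B M) g)) \<cdot> \<tau> g"
    using assms by (simp_all add: is_twist_2cell_def cat_hom_def)
  show "Src B N = Src B M" "Trg B N = Trg B M"
    using parallel_src[OF f(3)] parallel_trg[OF f(3)] f(4,5) by simp_all
qed

lemma twist_2cell_comp:
  assumes f: "is_twist_2cell B G \<Theta> \<mu> \<eta> ((M, \<tau>), f, (N, \<sigma>))"
    and g: "is_twist_2cell B G \<Theta> \<mu> \<eta> ((N, \<sigma>), g, (K, \<rho>))"
  shows "is_twist_2cell B G \<Theta> \<mu> \<eta> ((M, \<tau>), g \<cdot> f, (K, \<rho>))"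
proof -
  note f' [simp] = twist_2cellD(1-5)[OF f] twist_2cellD(7,8)[OF f]
  note g' [simp] = twist_2cellD(2-5)[OF g] twist_2cellD(7,8)[OF g]
  note [simp] = twistD[OF f'(1)] twistD[OF f'(2)] twistD[OF g'(1)]
  have "\<rho> a \<cdot> (Idt B (\<Theta> (Src B M) a) \<star> (g \<cdot> f)) = ((g \<cdot> f) \<star> Idt B (\<Theta> (Trg B M) a)) \<cdot> \<tau> a"
    if [simp]: "a \<in> carrier G" for a
  proof -
    let ?l = "Idt B (\<Theta> (Src B M) a)" and ?r = "Idt B (\<Theta> (Trg B M) a)"
    have "\<rho> a \<cdot> (?l \<star> (g \<cdot> f)) = (\<rho> a \<cdot> (?l \<star> g)) \<cdot> (?l \<star> f)"
      using hcomp_interchange[of ?l ?l f g] by simp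
    also have "\<dots> = (g \<star> ?r) \<cdot> (\<sigma> a \<cdot> (?l \<star> f))"
      using twist_2cellD(6)[OF g that] by simp
    also have "\<dots> = ((g \<cdot> f) \<star> ?r) \<cdot> \<tau> a"
      unfolding twist_2cellD(6)[OF f that] using hcomp_interchange[of f g ?r ?r] by simp
    finally show ?thesis .
  qed
  then show ?thesis by (simp add: is_twist_2cell_def cat_hom_def)
qed

lemma twist_2cell_id:
  assumes "twist (M, \<tau>)"
  shows "is_twist_2cell B G \<Theta> \<mu> \<eta> ((M, \<tau>), Idt B M, (M, \<tau>))"
  using assms twistD[OF assms] by (simp add: is_twist_2cell_def cat_hom_def)

lemma twist_homI:
  assumes "is_twist_2cell B G \<Theta> \<mu> \<eta> ((M, \<tau>), a, (N, \<sigma>))" "Src B M = R" "Trg B M = S"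
  shows "((M, \<tau>), a, (N, \<sigma>)) \<in> cat_hom (hom_cat BG R S) (M, \<tau>) (N, \<sigma>)"
  using assms twist_2cellD[OF assms(1)] by (simp add: cat_hom_def)

lemma twist_homE:
  assumes "f \<in> cat_hom (hom_cat BG R S) x y"
  obtains M \<tau> a N \<sigma> where "f = ((M, \<tau>), a, (N, \<sigma>))" "x = (M, \<tau>)" "y = (N, \<sigma>)"
    "is_twist_2cell B G \<Theta> \<mu> \<eta> ((M, \<tau>), a, (N, \<sigma>))" "Src B M = R" "Trg B M = S"
proof -
  obtain M \<tau> a N \<sigma> where f: "f = ((M, \<tau>), a, (N, \<sigma>))" by (metis prod_cases3 surj_pair)
  show thesis using assms unfolding f by (intro that[OF f]) (auto simp: cat_hom_def)
qed

lemma twist_hom_category: "category (hom_cat BG R S)"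
proof (unfold_locales, goal_cases)
  case (1 f)
  then show ?case by simp
next
  case (2 f)
  then show ?case by simp
next
  case (3 x)
  then show ?case using twist_homI[OF twist_2cell_id] by (cases x) simp
next
  case (4 f x y g z)
  from 4(1) obtain M \<tau> a N \<sigma> where f: "f = ((M, \<tau>), a, (N, \<sigma>))" "x = (M, \<tau>)" "y = (N, \<sigma>)"
    "is_twist_2cell B G \<Theta> \<mu> \<eta> ((M, \<tau>), a, (N, \<sigma>))" "Src B M = R" "Trg B M = S" by (rule twist_homE)
  from 4(2) f(3) obtain b K \<rho> where g: "g = ((N, \<sigma>), b, (K, \<rho>))" "z = (K, \<rho>)"
    "is_twist_2cell B G \<Theta> \<mu> \<eta> ((N, \<sigma>), b, (K, \<rho>))" by (auto elim!: twist_homE)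
  show ?case
    using twist_homI[OF twist_2cell_comp[OF f(4) g(3)] f(5,6)] by (simp add: f(1,2) g(1,2))
next
  case (5 f x y)
  then show ?case by (rule twist_homE) (simp add: twist_2cellD)
next
  case (6 f x y)
  then show ?case by (rule twist_homE) (simp add: twist_2cellD)
next
  case (7 f w x g y h z)
  from 7(1) obtain M \<tau> a N \<sigma> where f: "f = ((M, \<tau>), a, (N, \<sigma>))" "x = (N, \<sigma>)"
    "is_twist_2cell B G \<Theta> \<mu> \<eta> ((M, \<tau>), a, (N, \<sigma>))" by (rule twist_homE)
  from 7(2) f(2) obtain b K \<rho> where g: "g = ((N, \<sigma>), b, (K, \<rho>))" "y = (K, \<rho>)"
    "is_twist_2cell B G \<Theta> \<mu> \<eta> ((N, \<sigma>), b, (K, \<rho>))" by (auto elim!: twist_homE)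
  from 7(3) g(2) obtain c L \<kappa> where h: "h = ((K, \<rho>), c, (L, \<kappa>))"
    "is_twist_2cell B G \<Theta> \<mu> \<eta> ((K, \<rho>), c, (L, \<kappa>))" by (auto elim!: twist_homE)
  show ?case by (simp add: f(1) g(1) h(1) twist_2cellD(3-5)[OF f(3)] twist_2cellD(3-5)[OF g(3)]
      twist_2cellD(3-5)[OF h(2)])
qed

lemma twisted_shadow_functor:
  assumes [simp]: "R \<in> Cell0 B" "g \<in> carrier G"
  shows "is_functor (hom_cat BG R R) T (twisted_shadow B G \<Theta> sh g R)"
proof (intro is_functor.intro twist_hom_category target.category_axioms is_functor_axioms.intro, goal_cases)
  case (1 x)
  then show ?case
    by (cases x) (auto simp: twisted_shadow_def left_twist_def twistD)
next
  case (2 f x y)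
  then obtain M \<tau> a N \<sigma> where f: "f = ((M, \<tau>), a, (N, \<sigma>))" and xy: "x = (M, \<tau>)" "y = (N, \<sigma>)"
    and c: "is_twist_2cell B G \<Theta> \<mu> \<eta> ((M, \<tau>), a, (N, \<sigma>))" and [simp]: "Src B M = R" "Trg B M = R"
    by (rule twist_homE)
  note d [simp] = twist_2cellD(1-5)[OF c] twist_2cellD(7,8)[OF c]
  note [simp] = twistD[OF d(1)] twistD[OF d(2)]
  show ?case
    by (simp add: f xy cat_hom_def twisted_shadow_def left_twist_def left_twist_2cell_def)
next
  case (3 x)
  then show ?case
    by (cases x) (auto simp: twisted_shadow_def left_twist_def left_twist_2cell_def twistD)
next
  case (4 f x y h z)
  from 4(1) obtain M \<tau> a N \<sigma> where f: "f = ((M, \<tau>), a, (N, \<sigma>))" and y: "y = (N, \<sigma>)"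
    and c1: "is_twist_2cell B G \<Theta> \<mu> \<eta> ((M, \<tau>), a, (N, \<sigma>))" and [simp]: "Src B M = R" "Trg B M = R"
    by (rule twist_homE)
  from 4(2) y obtain b K \<rho> where h: "h = ((N, \<sigma>), b, (K, \<rho>))"
    and c2: "is_twist_2cell B G \<Theta> \<mu> \<eta> ((N, \<sigma>), b, (K, \<rho>))"
    by (auto elim!: twist_homE)
  note d [simp] = twist_2cellD(1-5)[OF c1] twist_2cellD(7,8)[OF c1]
  note e [simp] = twist_2cellD(2-5)[OF c2] twist_2cellD(7,8)[OF c2]
  note [simp] = twistD[OF d(1)] twistD[OF d(2)] twistD[OF e(1)]
  let ?t = "Idt B (\<Theta> R (inv\<^bsub>G\<^esub> g))"
  have "?t \<star> (b \<cdot> a) = (?t \<star> b) \<cdot> (?t \<star> a)" using hcomp_interchange[of ?t ?t a b] by simp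
  then show ?case by (simp add: f h twisted_shadow_def left_twist_2cell_def shadow_comp)
qed

text \<open>
  The exponents are chosen such that \<open>h\<inverse> (h g\<inverse>) = g\<inverse>\<close> and \<open>(h g\<inverse>) h\<inverse> = (h g h\<inverse>)\<inverse>\<close>; the half-braiding at
  \<open>h\<inverse>\<close> is the transport map of \<open>h\<close>.
\<close>

definition twisted_conj :: "'o \<Rightarrow> 'g \<Rightarrow> 'g \<Rightarrow> 'm \<times> ('g \<Rightarrow> 'c) \<Rightarrow> 'u" where
  "twisted_conj R h g x =
    W.conjugation (inv\<^bsub>G\<^esub> h) (h \<otimes>\<^bsub>G\<^esub> inv\<^bsub>G\<^esub> g) [fst x] (braid x (inv\<^bsub>G\<^esub> h))"

lemma twisted_conj_exponents:
  assumes "g \<in> carrier G" "h \<in> carrier G"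
  shows "inv\<^bsub>G\<^esub> h \<otimes>\<^bsub>G\<^esub> (h \<otimes>\<^bsub>G\<^esub> inv\<^bsub>G\<^esub> g) = inv\<^bsub>G\<^esub> g"
    and "inv\<^bsub>G\<^esub> (h \<otimes>\<^bsub>G\<^esub> g \<otimes>\<^bsub>G\<^esub> inv\<^bsub>G\<^esub> h) = h \<otimes>\<^bsub>G\<^esub> inv\<^bsub>G\<^esub> g \<otimes>\<^bsub>G\<^esub> inv\<^bsub>G\<^esub> h"
  using assms by (simp_all add: inv_mult_group flip: m_assoc)

lemma twisted_conj_natural:
  assumes [simp]: "R \<in> Cell0 B" "g \<in> carrier G" "h \<in> carrier G"
  shows "natural_isomorphism (hom_cat BG R R) T (twisted_shadow B G \<Theta> sh g R)
    (twisted_shadow B G \<Theta> sh (h \<otimes>\<^bsub>G\<^esub> g \<otimes>\<^bsub>G\<^esub> inv\<^bsub>G\<^esub> h) R) (twisted_conj R h g)"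
proof (intro natural_isomorphism.intro twisted_shadow_functor natural_isomorphism_axioms.intro, goal_cases)
  case (5 x)
  then obtain M \<tau> where x: "x = (M, \<tau>)" and tw: "twist (M, \<tau>)" and [simp]: "Src B M = R" "Trg B M = R"
    by (cases x) auto
  note [simp] = twistD[OF tw] W.half_braidingD[OF half_braiding_braid[OF tw]]
  show ?case
    by (simp add: x twisted_conj_def cat_hom_def W.conjugation_arr[where R = R] twisted_conj_exponents
        twisted_shadow_def left_twist_def word_trace_Ob_def)
next
  case (6 x)
  then obtain M \<tau> where x: "x = (M, \<tau>)" and tw: "twist (M, \<tau>)" and [simp]: "Src B M = R" "Trg B M = R"
    by (cases x) auto
  note [simp] = twistD[OF tw] W.half_braidingD[OF half_braiding_braid[OF tw]]
  show ?case
    unfolding x twisted_conj_def by (rule W.conjugation_iso[where R = R]) simp_all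
next
  case (7 f x y)
  then obtain M \<tau> a N \<sigma> where f: "f = ((M, \<tau>), a, (N, \<sigma>))" and xy: "x = (M, \<tau>)" "y = (N, \<sigma>)"
    and c: "is_twist_2cell B G \<Theta> \<mu> \<eta> ((M, \<tau>), a, (N, \<sigma>))" and [simp]: "Src B M = R" "Trg B M = R"
    by (rule twist_homE)
  note d [simp] = twist_2cellD(1-5)[OF c] twist_2cellD(7,8)[OF c]
  note [simp] = twistD[OF d(1)] twistD[OF d(2)]
  let ?y = "inv\<^bsub>G\<^esub> h" and ?x = "h \<otimes>\<^bsub>G\<^esub> inv\<^bsub>G\<^esub> g"
  have comm: "cat_inv B (\<sigma> z) \<cdot> (a \<star> Idt B (\<Theta> R z)) = (Idt B (\<Theta> R z) \<star> a) \<cdot> cat_inv B (\<tau> z)"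
    if [simp]: "z \<in> carrier G" for z
  proof -
    have "cat_inv B (\<sigma> z) \<cdot> (a \<star> Idt B (\<Theta> R z)) =
        cat_inv B (\<sigma> z) \<cdot> (((a \<star> Idt B (\<Theta> R z)) \<cdot> \<tau> z) \<cdot> cat_inv B (\<tau> z))" by simp
    also have "\<dots> = cat_inv B (\<sigma> z) \<cdot> ((\<sigma> z \<cdot> (Idt B (\<Theta> R z) \<star> a)) \<cdot> cat_inv B (\<tau> z))"
      using twist_2cellD(6)[OF c that] by simp
    also have "\<dots> = (Idt B (\<Theta> R z) \<star> a) \<cdot> cat_inv B (\<tau> z)" by simp
    finally show ?thesis .
  qed
  have "twisted_conj R h g (N, \<sigma>) \<cdot>\<^bsub>T\<^esub>
      word_trace B sh (word_hcomp B (Idt (word_cat B) [\<Theta> R (?y \<otimes>\<^bsub>G\<^esub> ?x)]) ([M], a, [N])) =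
    word_trace B sh (word_hcomp B (Idt (word_cat B) [\<Theta> R (?x \<otimes>\<^bsub>G\<^esub> ?y)]) ([M], a, [N])) \<cdot>\<^bsub>T\<^esub>
      twisted_conj R h g (M, \<tau>)"
    unfolding twisted_conj_def fst_conv
    by (rule W.conjugation_natural) (simp_all add: braid_def comm)
  then show ?case
    by (simp add: f xy twisted_conj_exponents twisted_shadow_def left_twist_2cell_def)
qed simp_all

lemma twisted_conj_cyclicity:
  assumes M: "twist (M, \<tau>)" and N: "twist (N, \<sigma>)"
    and src [simp]: "Src B M = R" "Trg B M = S" "Src B N = S" "Trg B N = R"
    and [simp]: "g \<in> carrier G" "h \<in> carrier G"
  shows "twisted_conj S h g (twist_hcomp B G \<Theta> (N, \<sigma>) (M, \<tau>)) \<cdot>\<^bsub>T\<^esub>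
      twisted_cyclicity B T G \<Theta> sh \<theta> g (M, \<tau>) (N, \<sigma>) =
    twisted_cyclicity B T G \<Theta> sh \<theta> (h \<otimes>\<^bsub>G\<^esub> g \<otimes>\<^bsub>G\<^esub> inv\<^bsub>G\<^esub> h) (M, \<tau>) (N, \<sigma>) \<cdot>\<^bsub>T\<^esub>
      twisted_conj R h g (twist_hcomp B G \<Theta> (M, \<tau>) (N, \<sigma>))"
proof -
  note [simp] = twistD[OF M] twistD[OF N]
  let ?y = "inv\<^bsub>G\<^esub> h" and ?x = "h \<otimes>\<^bsub>G\<^esub> inv\<^bsub>G\<^esub> g"
  have c: "twisted_conj S h g (twist_hcomp B G \<Theta> (N, \<sigma>) (M, \<tau>)) =
      W.conjugation ?y ?x ([N] @ [M]) (word_hcomp B (braid (N, \<sigma>) ?y) (Idt (word_cat B) [M]) \<cdot>\<^bsub>word_cat B\<^esub>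
        word_hcomp B (Idt (word_cat B) [N]) (braid (M, \<tau>) ?y))"
    "twisted_conj R h g (twist_hcomp B G \<Theta> (M, \<tau>) (N, \<sigma>)) =
      W.conjugation ?y ?x ([M] @ [N]) (word_hcomp B (braid (M, \<tau>) ?y) (Idt (word_cat B) [N]) \<cdot>\<^bsub>word_cat B\<^esub>
        word_hcomp B (Idt (word_cat B) [M]) (braid (N, \<sigma>) ?y))"
    using conjugation_regroup[OF N M, of ?y ?x] conjugation_regroup[OF M N, of ?y ?x]
    by (simp_all add: twisted_conj_def twist_hcomp_def)
  have t: "twisted_cyclicity B T G \<Theta> sh \<theta> a (M, \<tau>) (N, \<sigma>) =
      W.twisted_rot [\<Theta> R (inv\<^bsub>G\<^esub> a)] [M] [N] (braid (N, \<sigma>) (inv\<^bsub>G\<^esub> a))" if "a \<in> carrier G" for a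
    using twisted_cyclicity_eq[OF M N _ _ that] by simp
  have e: "inv\<^bsub>G\<^esub> g = ?y \<otimes>\<^bsub>G\<^esub> ?x" "inv\<^bsub>G\<^esub> (h \<otimes>\<^bsub>G\<^esub> g \<otimes>\<^bsub>G\<^esub> inv\<^bsub>G\<^esub> h) = ?x \<otimes>\<^bsub>G\<^esub> ?y"
    using twisted_conj_exponents[of g h] by simp_all
  have "W.conjugation ?y ?x ([N] @ [M]) (word_hcomp B (braid (N, \<sigma>) ?y) (Idt (word_cat B) [M]) \<cdot>\<^bsub>word_cat B\<^esub>
        word_hcomp B (Idt (word_cat B) [N]) (braid (M, \<tau>) ?y)) \<cdot>\<^bsub>T\<^esub>
      W.twisted_rot [\<Theta> R (?y \<otimes>\<^bsub>G\<^esub> ?x)] [M] [N] (braid (N, \<sigma>) (?y \<otimes>\<^bsub>G\<^esub> ?x)) =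
    W.twisted_rot [\<Theta> R (?x \<otimes>\<^bsub>G\<^esub> ?y)] [M] [N] (braid (N, \<sigma>) (?x \<otimes>\<^bsub>G\<^esub> ?y)) \<cdot>\<^bsub>T\<^esub>
      W.conjugation ?y ?x ([M] @ [N]) (word_hcomp B (braid (M, \<tau>) ?y) (Idt (word_cat B) [N]) \<cdot>\<^bsub>word_cat B\<^esub>
        word_hcomp B (Idt (word_cat B) [M]) (braid (N, \<sigma>) ?y))"
    by (rule W.conjugation_twisted_rot[OF half_braiding_braid[OF N]])
      (simp_all add: W.half_braidingD[OF half_braiding_braid[OF M]])
  then show ?thesis
    by (simp only: c t e(2) e(1)[symmetric] inv_closed m_closed assms)
qed

lemma twisted_conj_one:
  assumes tw: "twist (M, \<tau>)" and [simp]: "Src B M = R" "Trg B M = R" "g \<in> carrier G"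
  shows "twisted_conj R \<one>\<^bsub>G\<^esub> g (M, \<tau>) = Idt T (ObMap (twisted_shadow B G \<Theta> sh g R) (M, \<tau>))"
  using W.conjugation_one[OF half_braiding_braid[OF tw], of R "inv\<^bsub>G\<^esub> g"] twistD(2)[OF tw]
  by (simp add: twisted_conj_def twisted_shadow_def left_twist_def word_trace_Ob_def)

text \<open>
  \<open>conjugation_mult\<close> for \<open>y = h\<inverse>\<close>, \<open>z = k\<inverse>\<close>, \<open>x = k h g\<inverse>\<close>.
\<close>

lemma twisted_conj_mult:
  assumes tw: "twist (M, \<tau>)" and [simp]: "Src B M = R" "Trg B M = R"
    and [simp]: "g \<in> carrier G" "h \<in> carrier G" "k \<in> carrier G"
  shows "twisted_conj R k (h \<otimes>\<^bsub>G\<^esub> g \<otimes>\<^bsub>G\<^esub> inv\<^bsub>G\<^esub> h) (M, \<tau>) \<cdot>\<^bsub>T\<^esub> twisted_conj R h g (M, \<tau>) =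
    twisted_conj R (k \<otimes>\<^bsub>G\<^esub> h) g (M, \<tau>)"
proof -
  let ?x = "k \<otimes>\<^bsub>G\<^esub> h \<otimes>\<^bsub>G\<^esub> inv\<^bsub>G\<^esub> g" and ?y = "inv\<^bsub>G\<^esub> h" and ?z = "inv\<^bsub>G\<^esub> k"
  have "?z \<otimes>\<^bsub>G\<^esub> ?x = h \<otimes>\<^bsub>G\<^esub> inv\<^bsub>G\<^esub> g" "?y \<otimes>\<^bsub>G\<^esub> ?z = inv\<^bsub>G\<^esub> (k \<otimes>\<^bsub>G\<^esub> h)"
    "?x \<otimes>\<^bsub>G\<^esub> ?y = k \<otimes>\<^bsub>G\<^esub> inv\<^bsub>G\<^esub> (h \<otimes>\<^bsub>G\<^esub> g \<otimes>\<^bsub>G\<^esub> inv\<^bsub>G\<^esub> h)"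
    by (simp_all add: inv_mult_group flip: m_assoc)
  with W.conjugation_mult[OF half_braiding_braid[OF tw], of R ?y ?z ?x]
  show ?thesis by (simp add: twisted_conj_def)
qed

end

theorem proposition4p5:
  fixes B :: "('o, 'm, 'c, 'z) bicat_scheme"
    and T :: "('t, 'u, 'w) cat_scheme"
    and sh :: "'o \<Rightarrow> ('m, 'c, 't, 'u) cat_functor"
    and \<theta> :: "'m \<Rightarrow> 'm \<Rightarrow> 'u"
    and G :: "('g, 'y) monoid_scheme"
    and \<Theta> :: "'o \<Rightarrow> 'g \<Rightarrow> 'm"
    and \<mu> :: "'o \<Rightarrow> 'g \<Rightarrow> 'g \<Rightarrow> 'c"
    and \<eta> :: "'o \<Rightarrow> 'c"
  defines "BG \<equiv> twist_bicat B G \<Theta> \<mu> \<eta>"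
    and "tsh \<equiv> twisted_shadow B G \<Theta> sh"
    and "t\<theta> \<equiv> twisted_cyclicity B T G \<Theta> sh \<theta>"
  assumes "shadow B T sh \<theta>"
    and "twisting_data B G \<Theta> \<mu> \<eta>"
  shows "\<exists>\<C> :: 'o \<Rightarrow> 'g \<Rightarrow> 'g \<Rightarrow> 'm \<times> ('g \<Rightarrow> 'c) \<Rightarrow> 'u.
    (\<forall>R \<in> Cell0 BG. \<forall>g \<in> carrier G. \<forall>h \<in> carrier G.
       natural_isomorphism (hom_cat BG R R) T
         (tsh g R) (tsh (h \<otimes>\<^bsub>G\<^esub> g \<otimes>\<^bsub>G\<^esub> inv\<^bsub>G\<^esub> h) R) (\<C> R h g)) \<and>
    (\<forall>R \<in> Cell0 BG. \<forall>S \<in> Cell0 BG. \<forall>M \<in> cells1 BG R S. \<forall>N \<in> cells1 BG S R.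
       \<forall>g \<in> carrier G. \<forall>h \<in> carrier G.
         \<C> S h g (N \<odot>\<^bsub>BG\<^esub> M) \<cdot>\<^bsub>T\<^esub> t\<theta> g M N =
         t\<theta> (h \<otimes>\<^bsub>G\<^esub> g \<otimes>\<^bsub>G\<^esub> inv\<^bsub>G\<^esub> h) M N \<cdot>\<^bsub>T\<^esub> \<C> R h g (M \<odot>\<^bsub>BG\<^esub> N)) \<and>
    (\<forall>R \<in> Cell0 BG. \<forall>M \<in> cells1 BG R R. \<forall>g \<in> carrier G.
       \<C> R \<one>\<^bsub>G\<^esub> g M = Idt T (ObMap (tsh g R) M)) \<and>
    (\<forall>R \<in> Cell0 BG. \<forall>M \<in> cells1 BG R R.
       \<forall>g \<in> carrier G. \<forall>h \<in> carrier G. \<forall>k \<in> carrier G.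
         \<C> R k (h \<otimes>\<^bsub>G\<^esub> g \<otimes>\<^bsub>G\<^esub> inv\<^bsub>G\<^esub> h) M \<cdot>\<^bsub>T\<^esub> \<C> R h g M = \<C> R (k \<otimes>\<^bsub>G\<^esub> h) g M)"
proof -
  interpret twisted_shadow_data B T sh \<theta> G \<Theta> \<mu> \<eta>
    using assms(4,5) by (rule twisted_shadow_data.intro)
  show ?thesis
    unfolding BG_def tsh_def t\<theta>_def
  proof (intro exI[where x = twisted_conj] conjI ballI, goal_cases)
    case (1 R g h)
    then show ?case by (intro twisted_conj_natural) simp_all
  next
    case (2 R S M N g h)
    then show ?case by (cases M; cases N) (auto intro: twisted_conj_cyclicity)
  next
    case (3 R M g)
    then show ?case by (cases M) (auto intro: twisted_conj_one)
  next
    case (4 R M g h k)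
    then show ?case by (cases M) (auto intro: twisted_conj_mult)
  qed
qed

end
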